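(* Let $\mathfrak D=(Z,X,Y;U,V,W;\Gamma)$ be a $\Pi_+$-admissible BTOA interpolation data set with BTOA-Pick matrix $\mathbf\Gamma_{\mathfrak D}$. Then there exists $S\in\mathcal S^{p\times m}(\Pi_+)$ satisfying the interpolation conditions $$(XS)^{\wedge L}(Z)=Y,\qquad (SU)^{\wedge R}(W)=V,\qquad (XSU)^{\wedge L,R}(Z,W)=\Gamma\qquad( * )$$ if and only if $\mathbf\Gamma_{\mathfrak D}$ is positive semidefinite. If $\mathbf\Gamma_{\mathfrak D}$ is strictly positive definite, define the $(p+m)\times(p+m)$ rational matrix function $$\Theta(\lambda)=\begin{bmatrix}\Theta_{11}(\lambda)&\Theta_{12}(\lambda)\\ \Theta_{21}(\lambda)&\Theta_{22}(\lambda)\end{bmatrix}=\begin{bmatrix}I_p&0\\0&I_m\end{bmatrix}+\begin{bmatrix}-X^*&V\\-Y^*&U\end{bmatrix}\begin{bmatrix}\lambda I+Z^*&0\\0&\lambda I-W\end{bmatrix}^{-1}\mathbf\Gamma_{\mathfrak D}^{-1}\begin{bmatrix}X&-Y\\-V^*&U^*\end{bmatrix}.$$ Then a function $S$ is in $\mathcal S^{p\times m}(\Pi_+)$ and satisfies $( * )$ if and only if $$S(\lambda)=(\Theta_{11}(\lambda)G(\lambda)+\Theta_{12}(\lambda))(\Theta_{21}(\lambda)G(\lambda)+\Theta_{22}(\lambda))^{-1}$$ for some $G\in\mathcal S^{p\times m}(\Pi_+)$.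
   Context: $\Pi_+=\{z\in\mathbb C:\operatorname{Re}z>0\}$. $\mathcal S^{p\times m}(\Pi_+)$ is the Schur class: analytic functions $S:\Pi_+\to\mathbb C^{p\times m}$ with $\|S(\lambda)\|\le1$ on $\Pi_+$. A $\Pi_+$-admissible BTOA interpolation data set is a septet of matrices $\mathfrak D=(Z,X,Y;U,V,W;\Gamma)$ with $Z\in\mathbb C^{n_Z\times n_Z}$, $X\in\mathbb C^{n_Z\times p}$, $Y\in\mathbb C^{n_Z\times m}$, $W\in\mathbb C^{n_W\times n_W}$, $U\in\mathbb C^{m\times n_W}$, $V\in\mathbb C^{p\times n_W}$, $\Gamma\in\mathbb C^{n_Z\times n_W}$ such that: (1) $\sigma(Z)\cup\sigma(W)\subset\Pi_+$; (2) $(Z,X)$ is controllable ($\operatorname{rank}[X\ ZX\ \cdots\ Z^{n_Z-1}X]=n_Z$) and $(U,W)$ is observable ($\bigcap_{k\ge0}\ker UW^k=\{0\}$); (3) $\Gamma W-Z\Gamma=XV-YU$. For $S$ analytic on $\Pi_+$, the operator-argument point evaluations are $(XS)^{\wedge L}(Z)=\sum_{z_0\in\sigma(Z)}\operatorname{Res}_{\lambda=z_0}(\lambda I-Z)^{-1}XS(\lambda)$, $(SU)^{\wedge R}(W)=\sum_{z_0\in\sigma(W)}\operatorname{Res}_{\lambda=z_0}S(\lambda)U(\lambda I-W)^{-1}$, $(XSU)^{\wedge L,R}(Z,W)=\sum_{z_0\in\sigma(Z)\cup\sigma(W)}\operatorname{Res}_{\lambda=z_0}(\lambda I-Z)^{-1}XS(\lambda)U(\lambda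 I-W)^{-1}$. The BTOA-Pick matrix is $\mathbf\Gamma_{\mathfrak D}=\begin{bmatrix}\Gamma_L&\Gamma\\ \Gamma^*&\Gamma_R\end{bmatrix}$, where $\Gamma_L,\Gamma_R$ are the unique solutions of $\Gamma_LZ^*+Z\Gamma_L=XX^*-YY^*$ and $\Gamma_RW+W^*\Gamma_R=U^*U-V^*V$. The linear-fractional formula is understood as an identity of meromorphic functions on $\Pi_+$ ($\Theta$ may have poles in $\sigma(W)$), removable singularities being removed. *)

theory Defs
  imports "HOL-Complex_Analysis.Complex_Analysis"
begin

unbundle no fps_syntax

text \<open>
  An $r \times c$ complex matrix has type \<open>complex ^ 'c ^ 'r\<close>. The multiplication \<open>*\<close> and power
  \<open>^\<close> inherited by vector types are componentwise, hence the separate matrix power below.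
\<close>

definition right_half_plane :: "complex set"  (\<open>\<Pi>\<^sub>+\<close>)
  where "\<Pi>\<^sub>+ = {z. Re z > 0}"

subsection \<open>Matrices\<close>

definition ctranspose :: "complex ^ 'c ^ 'r \<Rightarrow> complex ^ 'r ^ 'c"  (\<open>_\<^sup>\<dagger>\<close> [1000] 999)
  where "A\<^sup>\<dagger> = (\<chi> i j. cnj (A $ j $ i))"

primrec mat_pow :: "complex ^ 'n ^ 'n \<Rightarrow> nat \<Rightarrow> complex ^ 'n ^ 'n" where
  "mat_pow A 0 = mat 1"
| "mat_pow A (Suc k) = A ** mat_pow A k"

definition spectrum :: "complex ^ 'n ^ 'n \<Rightarrow> complex set"
  where "spectrum A = {z. \<not> invertible (mat z - A)}"

definition block_matrix ::
  "complex ^ 'c ^ 'r \<Rightarrow> complex ^ 'd ^ 'r \<Rightarrow> complex ^ 'c ^ 's \<Rightarrow> complex ^ 'd ^ 's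
    \<Rightarrow> complex ^ ('c + 'd) ^ ('r + 's)"
  where "block_matrix A B C D = (\<chi> i j.
    (case i of
       Inl a \<Rightarrow> (case j of Inl b \<Rightarrow> A $ a $ b | Inr b \<Rightarrow> B $ a $ b)
     | Inr a \<Rightarrow> (case j of Inl b \<Rightarrow> C $ a $ b | Inr b \<Rightarrow> D $ a $ b)))"

definition block11 ::
  "complex ^ ('c::finite + 'd::finite) ^ ('r::finite + 's::finite) \<Rightarrow> complex ^ 'c ^ 'r"
  where "block11 M = (\<chi> i j. M $ Inl i $ Inl j)"

definition block12 ::
  "complex ^ ('c::finite + 'd::finite) ^ ('r::finite + 's::finite) \<Rightarrow> complex ^ 'd ^ 'r"
  where "block12 M = (\<chi> i j. M $ Inl i $ Inr j)"

definition block21 ::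
  "complex ^ ('c::finite + 'd::finite) ^ ('r::finite + 's::finite) \<Rightarrow> complex ^ 'c ^ 's"
  where "block21 M = (\<chi> i j. M $ Inr i $ Inl j)"

definition block22 ::
  "complex ^ ('c::finite + 'd::finite) ^ ('r::finite + 's::finite) \<Rightarrow> complex ^ 'd ^ 's"
  where "block22 M = (\<chi> i j. M $ Inr i $ Inr j)"

text \<open>
  The inner product of the library on \<open>complex ^ 'n\<close> is the real one, i.e. the real part of the
  Hermitian inner product; for a Hermitian matrix $M$ the value $v^* M v$ is real anyway.
\<close>

definition pos_semidefinite :: "complex ^ 'n ^ 'n \<Rightarrow> bool"
  where "pos_semidefinite M \<longleftrightarrow> M\<^sup>\<dagger> = M \<and> (\<forall>v. inner (M *v v) v \<ge> 0)"

definition pos_definite :: "complex ^ 'n ^ 'n \<Rightarrow> bool"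
  where "pos_definite M \<longleftrightarrow> M\<^sup>\<dagger> = M \<and> (\<forall>v. v \<noteq> 0 \<longrightarrow> inner (M *v v) v > 0)"

subsection \<open>The Schur class of the right half-plane\<close>

text \<open>
  The vector norm of \<open>complex ^ 'n\<close> is the Euclidean one, so \<open>onorm\<close> is the spectral norm.
  Only the values of $S$ on the half-plane matter.
\<close>

definition schur_class :: "(complex \<Rightarrow> complex ^ 'm ^ 'p) set"
  where "schur_class = {S. (\<forall>i j. (\<lambda>z. S z $ i $ j) holomorphic_on \<Pi>\<^sub>+) \<and>
                           (\<forall>z\<in>\<Pi>\<^sub>+. onorm ((*v) (S z)) \<le> 1)}"

subsection \<open>Admissible data sets\<close>

text \<open>
  The matrix $[X\ ZX\ \cdots\ Z^{n-1}X]$, where $n$ is the size of $Z$. Its columns are indexed by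
  pairs; \<open>to_nat_on UNIV\<close> enumerates the finite type \<open>'z\<close> as $0, \ldots, n-1$.
\<close>

definition controllability_matrix ::
  "complex ^ 'z ^ 'z \<Rightarrow> complex ^ 'p ^ 'z \<Rightarrow> complex ^ ('z \<times> 'p) ^ 'z"
  where "controllability_matrix Z X =
    (\<chi> i kj. (mat_pow Z (to_nat_on (UNIV :: 'z set) (fst kj)) ** X) $ i $ snd kj)"

definition controllable :: "complex ^ 'z ^ 'z \<Rightarrow> complex ^ 'p ^ 'z \<Rightarrow> bool"
  where "controllable Z X \<longleftrightarrow> rank (controllability_matrix Z X) = CARD('z)"

definition observable :: "complex ^ 'w ^ 'm \<Rightarrow> complex ^ 'w ^ 'w \<Rightarrow> bool"
  where "observable U W \<longleftrightarrow> (\<Inter>k. {v. (U ** mat_pow W k) *v v = 0}) = {0}"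

definition BTOA_admissible ::
  "complex ^ 'z ^ 'z \<Rightarrow> complex ^ 'p ^ 'z \<Rightarrow> complex ^ 'm ^ 'z \<Rightarrow>
   complex ^ 'w ^ 'm \<Rightarrow> complex ^ 'w ^ 'p \<Rightarrow> complex ^ 'w ^ 'w \<Rightarrow>
   complex ^ 'w ^ 'z \<Rightarrow> bool"
  where "BTOA_admissible Z X Y U V W \<Gamma> \<longleftrightarrow>
    spectrum Z \<union> spectrum W \<subseteq> \<Pi>\<^sub>+ \<and>
    controllable Z X \<and> observable U W \<and>
    \<Gamma> ** W - Z ** \<Gamma> = X ** V - Y ** U"

subsection \<open>Operator-argument point evaluations\<close>

text \<open>
  A residue depends only on the values in a punctured neighbourhood of the point, so the
  unspecified value of \<open>matrix_inv (mat z - Z)\<close> at the eigenvalues of $Z$ is irrelevant.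
\<close>

definition mat_residue :: "(complex \<Rightarrow> complex ^ 'c ^ 'r) \<Rightarrow> complex \<Rightarrow> complex ^ 'c ^ 'r"
  where "mat_residue F z0 = (\<chi> i j. residue (\<lambda>z. F z $ i $ j) z0)"

definition left_eval ::
  "complex ^ 'p ^ 'z \<Rightarrow> (complex \<Rightarrow> complex ^ 'm ^ 'p) \<Rightarrow> complex ^ 'z ^ 'z \<Rightarrow> complex ^ 'm ^ 'z"
  where "left_eval X S Z =
    (\<Sum>z0\<in>spectrum Z. mat_residue (\<lambda>z. matrix_inv (mat z - Z) ** X ** S z) z0)"

definition right_eval ::
  "(complex \<Rightarrow> complex ^ 'm ^ 'p) \<Rightarrow> complex ^ 'w ^ 'm \<Rightarrow> complex ^ 'w ^ 'w \<Rightarrow> complex ^ 'w ^ 'p"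
  where "right_eval S U W =
    (\<Sum>z0\<in>spectrum W. mat_residue (\<lambda>z. S z ** U ** matrix_inv (mat z - W)) z0)"

definition left_right_eval ::
  "complex ^ 'p ^ 'z \<Rightarrow> (complex \<Rightarrow> complex ^ 'm ^ 'p) \<Rightarrow> complex ^ 'w ^ 'm \<Rightarrow>
   complex ^ 'z ^ 'z \<Rightarrow> complex ^ 'w ^ 'w \<Rightarrow> complex ^ 'w ^ 'z"
  where "left_right_eval X S U Z W =
    (\<Sum>z0\<in>spectrum Z \<union> spectrum W.
       mat_residue (\<lambda>z. matrix_inv (mat z - Z) ** X ** S z ** U ** matrix_inv (mat z - W)) z0)"

definition BTOA_interpolant ::
  "complex ^ 'z ^ 'z \<Rightarrow> complex ^ 'p ^ 'z \<Rightarrow> complex ^ 'm ^ 'z \<Rightarrow>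
   complex ^ 'w ^ 'm \<Rightarrow> complex ^ 'w ^ 'p \<Rightarrow> complex ^ 'w ^ 'w \<Rightarrow>
   complex ^ 'w ^ 'z \<Rightarrow> (complex \<Rightarrow> complex ^ 'm ^ 'p) \<Rightarrow> bool"
  where "BTOA_interpolant Z X Y U V W \<Gamma> S \<longleftrightarrow>
    left_eval X S Z = Y \<and> right_eval S U W = V \<and> left_right_eval X S U Z W = \<Gamma>"

subsection \<open>The BTOA-Pick matrix\<close>

definition pick_left ::
  "complex ^ 'z ^ 'z \<Rightarrow> complex ^ 'p ^ 'z \<Rightarrow> complex ^ 'm ^ 'z \<Rightarrow> complex ^ 'z ^ 'z"
  where "pick_left Z X Y = (THE G. G ** Z\<^sup>\<dagger> + Z ** G = X ** X\<^sup>\<dagger> - Y ** Y\<^sup>\<dagger>)"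

definition pick_right ::
  "complex ^ 'w ^ 'm \<Rightarrow> complex ^ 'w ^ 'p \<Rightarrow> complex ^ 'w ^ 'w \<Rightarrow> complex ^ 'w ^ 'w"
  where "pick_right U V W = (THE G. G ** W + W\<^sup>\<dagger> ** G = U\<^sup>\<dagger> ** U - V\<^sup>\<dagger> ** V)"

definition pick_matrix ::
  "complex ^ 'z ^ 'z \<Rightarrow> complex ^ 'p ^ 'z \<Rightarrow> complex ^ 'm ^ 'z \<Rightarrow>
   complex ^ 'w ^ 'm \<Rightarrow> complex ^ 'w ^ 'p \<Rightarrow> complex ^ 'w ^ 'w \<Rightarrow>
   complex ^ 'w ^ 'z \<Rightarrow> complex ^ ('z + 'w) ^ ('z + 'w)"
  where "pick_matrix Z X Y U V W \<Gamma> =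
    block_matrix (pick_left Z X Y) \<Gamma> (\<Gamma>\<^sup>\<dagger>) (pick_right U V W)"

subsection \<open>The linear-fractional parametrization\<close>

definition BTOA_Theta ::
  "complex ^ 'z ^ 'z \<Rightarrow> complex ^ 'p ^ 'z \<Rightarrow> complex ^ 'm ^ 'z \<Rightarrow>
   complex ^ 'w ^ 'm \<Rightarrow> complex ^ 'w ^ 'p \<Rightarrow> complex ^ 'w ^ 'w \<Rightarrow>
   complex ^ 'w ^ 'z \<Rightarrow> complex \<Rightarrow> complex ^ ('p + 'm) ^ ('p + 'm)"
  where "BTOA_Theta Z X Y U V W \<Gamma> z =
    block_matrix (mat 1) 0 0 (mat 1) +
    block_matrix (- (X\<^sup>\<dagger>)) V (- (Y\<^sup>\<dagger>)) U **
    matrix_inv (block_matrix (mat z + Z\<^sup>\<dagger>) 0 0 (mat z - W)) **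
    matrix_inv (pick_matrix Z X Y U V W \<Gamma>) **
    block_matrix X (- Y) (- (V\<^sup>\<dagger>)) (U\<^sup>\<dagger>)"

definition lft_denominator ::
  "complex ^ ('p + 'm) ^ ('p + 'm) \<Rightarrow> complex ^ 'm ^ 'p \<Rightarrow> complex ^ 'm ^ 'm"
  where "lft_denominator M G = block21 M ** G + block22 M"

definition lft ::
  "complex ^ ('p + 'm) ^ ('p + 'm) \<Rightarrow> complex ^ 'm ^ 'p \<Rightarrow> complex ^ 'm ^ 'p"
  where "lft M G = (block11 M ** G + block12 M) ** matrix_inv (lft_denominator M G)"

definition mat_remove_sings :: "(complex \<Rightarrow> complex ^ 'c ^ 'r) \<Rightarrow> complex \<Rightarrow> complex ^ 'c ^ 'r"
  where "mat_remove_sings F z = (\<chi> i j. remove_sings (\<lambda>s. F s $ i $ j) z)"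

end

theory Submission
  imports Defs
begin

text \<open>
  The interpolation conditions say that $XS - Y = (\lambda - Z) H$,
  $SU - V = L (\lambda - W)$ and $HU - \Gamma = K (\lambda - W)$ with $H$, $L$, $K$ analytic on the
  half-plane. A Cayley transform moves these identities to the unit disc, where positivity of the Pick
  matrix is the mean over the circles $|\zeta| = t$, as $t$ tends to 1, of the pointwise inequality
  $0 \le |g|^2 + |k|^2 - 2\,\mathrm{Re}\,\langle k, S g\rangle$ for suitable rational $g$ and $k$.

  For a positive definite Pick matrix $P$ write $\Theta = I - C (\lambda - A)^{-1} P^{-1} C^* J$ with
  $PA + A^*P + C^*JC = 0$. The closed-loop matrix $\lambda - A - B C_2$ belonging to a Schur parameter
  $G$ is invertible on the whole half-plane by an energy identity, which gives a pole-free formula for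
  the linear-fractional transform of $G$. Conversely, positivity of the Pick matrix of the data enlarged
  by one further right condition $S(z_0) v$ is exactly the inequality which makes the inverse
  linear-fractional transform of an interpolant contractive.

  In the semidefinite case the data are replaced by those of $rS$, $r < 1$: the new Pick matrix is
  positive definite by controllability and observability, and Montel's theorem lets $r$ tend to 1.
\<close>

unbundle no fps_syntax

text \<open>No boundary values of \<open>S\<close> are used, which is why means are taken over
  circles inside the disc, at the price of error terms 1 - t^2 times a bounded quantity. Residues at
  common eigenvalues of \<open>Z\<close> and \<open>W\<close> are unwieldy, which is why they are
  traded at once for the divisibility relations: these are pointwise and treat Jordan blocks and
  shared eigenvalues alike. In the parametrization the obstacle is that \<Theta> may have poles in
  the spectrum of \<open>W\<close>. The linear-fractional expression is meaningless there, so the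
  interpolation property is proved for the closed-loop formula, which agrees with it elsewhere. In
  the inverse direction, positivity of the enlarged Pick matrix contains a free test vector;
  minimising over it gives the contraction estimate. A singular Pick matrix cannot simply be
  perturbed by a multiple of the identity, since it is determined by the data; scaling
  \<open>Y\<close>, \<open>V\<close> and \<Gamma> by r preserves the Sylvester equation and
  corresponds to passing from S to rS.\<close>

lemma mat_vec [simp]: "mat c *v x = c *s (x::'a::semiring_1^'n)"
  by (simp add: matrix_vector_mult_def mat_def vec_eq_iff if_distrib[where f="\<lambda>a. a * _"] cong: if_cong)

lemma mat_vec_scale: "A *v (c *s x) = c *s (A *v (x::'a::comm_semiring_1^'n))"
  by (simp add: matrix_vector_mult_def vec_eq_iff sum_distrib_left algebra_simps)

lemma uminus_mat_vec: "(- A) *v x = - (A *v (x::'a::ring_1^'n))"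
  by (simp add: matrix_vector_mult_def vec_eq_iff sum_negf)

lemma mat_vec_uminus: "A *v (- x) = - (A *v (x::'a::ring_1^'n))"
  by (simp add: matrix_vector_mult_def vec_eq_iff sum_negf)

text \<open>Products of rectangular matrices are out of reach of ring normalization. Matrix
  identities are therefore evaluated at a vector and expanded into sums of iterated
  \<open>*v\<close> terms, where additive simplification suffices.\<close>

lemmas mvec = matrix_vector_mul_assoc[symmetric] matrix_vector_mult_add_rdistrib
  matrix_vector_mult_diff_rdistrib matrix_vector_right_distrib matrix_vector_mult_diff_distrib
  mat_vec_scale uminus_mat_vec mat_vec_uminus vector_add_ldistrib vector_ssub_ldistrib
  vector_sadd_rdistrib vector_sub_rdistrib vector_smult_assoc vector_smult_rneg vector_smult_lneg

lemma mat_eq_vec: "(A::'a::semiring_1^'n^'m) = B \<longleftrightarrow> (\<forall>x. A *v x = B *v x)"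
  by (simp add: matrix_eq)

lemma mat_eqI: "(\<And>x. A *v x = B *v x) \<Longrightarrow> (A::'a::semiring_1^'n^'m) = B"
  by (simp add: matrix_eq)

lemma matrix_inv_right': "invertible A \<Longrightarrow> A ** matrix_inv A = mat 1"
  unfolding invertible_def matrix_inv_def by (rule someI2_ex) auto

lemma matrix_inv_left': "invertible A \<Longrightarrow> matrix_inv A ** A = mat 1"
  unfolding invertible_def matrix_inv_def by (rule someI2_ex) auto

lemma inv_vec: "invertible A \<Longrightarrow> A *v (matrix_inv A *v x) = x"
  "invertible A \<Longrightarrow> matrix_inv A *v (A *v y) = (y::'a::semiring_1^'n)"
  by (simp_all add: matrix_vector_mul_assoc matrix_inv_right' matrix_inv_left')

lemma matrix_inv_eqI:
  fixes A :: "'a::field^'n^'n"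
  assumes "A ** B = mat 1" shows "matrix_inv A = B" "invertible A"
proof -
  show i: "invertible A" using assms invertible_right_inverse by blast
  have "matrix_inv A = matrix_inv A ** (A ** B)" by (simp add: assms)
  then show "matrix_inv A = B" by (simp add: matrix_mul_assoc matrix_inv_left' i)
qed

lemma invertible_kerI:
  fixes A :: "'a::field^'n^'n"
  shows "(\<And>x. A *v x = 0 \<Longrightarrow> x = 0) \<Longrightarrow> invertible A"
  by (simp add: invertible_left_inverse matrix_left_invertible_ker)

lemma invertible_ker:
  fixes A :: "'a::field^'n^'n"
  shows "invertible A \<Longrightarrow> A *v x = 0 \<Longrightarrow> x = 0"
  by (metis inv_vec(2) matrix_vector_mult_0_right)

lemma invertible_mult_iff:
  fixes A B :: "'a::field^'n^'n"
  shows "invertible (A ** B) \<longleftrightarrow> invertible A \<and> invertible B"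
  by (auto simp: invertible_det_nz det_mul)

subsection \<open>Adjoints\<close>

lemma ctranspose_nth: "A\<^sup>\<dagger> $ i $ j = cnj (A $ j $ i)"
  by (simp add: ctranspose_def)

lemma ctranspose_ctranspose [simp]: "(A\<^sup>\<dagger>)\<^sup>\<dagger> = A"
  by (simp add: vec_eq_iff ctranspose_nth)

lemma inner_complex_cnj: "inner (a * b) c = inner b (cnj a * (c::complex))"
  by (simp add: inner_complex_def algebra_simps)

lemma ctranspose_inner: "inner (A *v x) y = inner x (A\<^sup>\<dagger> *v y)"
proof -
  have "inner (A *v x) y = (\<Sum>i\<in>UNIV. \<Sum>j\<in>UNIV. inner (A$i$j * x$j) (y$i))"
    by (simp add: inner_vec_def matrix_vector_mult_def inner_sum_left)
  also have "\<dots> = (\<Sum>j\<in>UNIV. \<Sum>i\<in>UNIV. inner (A$i$j * x$j) (y$i))" by (rule sum.swap)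
  also have "\<dots> = inner x (A\<^sup>\<dagger> *v y)"
    by (simp add: inner_vec_def matrix_vector_mult_def inner_sum_right ctranspose_nth inner_complex_cnj)
  finally show ?thesis .
qed

lemma inner_ctranspose: "inner x (A *v y) = inner (A\<^sup>\<dagger> *v x) y"
  by (simp add: ctranspose_inner)

lemma inner_smult: "inner (c *s x) y = inner x (cnj c *s (y::complex^'n))"
  by (simp add: inner_vec_def inner_complex_cnj)

lemma inner_smult_right: "inner x (c *s y) = inner (cnj c *s x) (y::complex^'n)"
  by (simp add: inner_smult)

lemma ctranspose_mult: "(A ** B)\<^sup>\<dagger> = B\<^sup>\<dagger> ** A\<^sup>\<dagger>"
  by (simp add: vec_eq_iff ctranspose_nth matrix_matrix_mult_def mult.commute)

lemma ctranspose_add: "(A + B)\<^sup>\<dagger> = A\<^sup>\<dagger> + B\<^sup>\<dagger>"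
  and ctranspose_diff: "(A - B)\<^sup>\<dagger> = A\<^sup>\<dagger> - B\<^sup>\<dagger>"
  and ctranspose_uminus: "(- A)\<^sup>\<dagger> = - (A\<^sup>\<dagger>)"
  and ctranspose_mat: "(mat c)\<^sup>\<dagger> = mat (cnj c)"
  and ctranspose_0: "0\<^sup>\<dagger> = 0"
  by (auto simp: vec_eq_iff ctranspose_nth mat_def)

lemmas ctr = ctranspose_mult ctranspose_add ctranspose_diff ctranspose_uminus ctranspose_mat ctranspose_0

lemma invertible_ctranspose:
  fixes A :: "complex^'n^'n" shows "invertible (A\<^sup>\<dagger>) \<longleftrightarrow> invertible A"
proof -
  have "invertible (A\<^sup>\<dagger>)" if i: "invertible A" for A :: "complex^'n^'n"
  proof -
    have "A\<^sup>\<dagger> ** (matrix_inv A)\<^sup>\<dagger> = (matrix_inv A ** A)\<^sup>\<dagger>" by (simp add: ctr)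
    also have "\<dots> = mat 1" by (simp add: matrix_inv_left' i ctr)
    finally show ?thesis by (rule matrix_inv_eqI)
  qed
  from this[of A] this[of "A\<^sup>\<dagger>"] show ?thesis by auto
qed

lemma matrix_inv_ctranspose:
  fixes A :: "complex^'n^'n" assumes "invertible A"
  shows "matrix_inv (A\<^sup>\<dagger>) = (matrix_inv A)\<^sup>\<dagger>"
proof (rule matrix_inv_eqI)
  have "A\<^sup>\<dagger> ** (matrix_inv A)\<^sup>\<dagger> = (matrix_inv A ** A)\<^sup>\<dagger>" by (simp add: ctr)
  then show "A\<^sup>\<dagger> ** (matrix_inv A)\<^sup>\<dagger> = mat 1" by (simp add: matrix_inv_left' assms ctr)
qed

lemma spectrum_ctranspose: "z \<in> spectrum (A\<^sup>\<dagger>) \<longleftrightarrow> cnj z \<in> spectrum A"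
proof -
  have "mat z - A\<^sup>\<dagger> = (mat (cnj z) - A)\<^sup>\<dagger>" by (simp add: ctr)
  then show ?thesis by (simp add: spectrum_def invertible_ctranspose)
qed

text \<open>For Hermitian \<open>P\<close> the matrix i \<open>P\<close> is skew-Hermitian, so its
  real quadratic form vanishes and only the real part of \<open>c\<close> survives.\<close>

lemma inner_hermitian_smult:
  assumes "P\<^sup>\<dagger> = P" shows "inner w (c *s (P *v w)) = Re c * inner w (P *v (w::complex^'n))"
proof -
  have *: "c *s x = Re c *\<^sub>R x + Im c *\<^sub>R (\<i> *s x)" for x :: "complex^'n"
  proof -
    have "c * y = Re c *\<^sub>R y + Im c *\<^sub>R (\<i> * y)" for y by (simp add: complex_eq_iff)
    then show ?thesis by (simp only: vec_eq_iff vector_add_component vector_scaleR_component vector_smult_component) blast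
  qed
  have "inner w (\<i> *s (P *v w)) = inner (P *v ((-\<i>) *s w)) w"
    by (simp add: inner_smult_right ctranspose_inner assms)
  also have "\<dots> = - inner w (\<i> *s (P *v w))"
    by (simp add: mvec inner_commute)
  finally show ?thesis by (subst *) (simp add: inner_add_right)
qed

subsection \<open>Entrywise holomorphic matrix functions\<close>

text \<open>\<open>holomorphic_on\<close> concerns scalar functions, hence the entrywise form;
  closure under sums, products and inverses is lifted from the entries.\<close>

definition mholo :: "(complex \<Rightarrow> complex^'m^'n) \<Rightarrow> complex set \<Rightarrow> bool"
  where "mholo F A \<longleftrightarrow> (\<forall>i j. (\<lambda>z. F z $ i $ j) holomorphic_on A)"

lemma mholo_const: "mholo (\<lambda>z. C) A"
  by (simp add: mholo_def)

lemma mholo_mat: "f holomorphic_on A \<Longrightarrow> mholo (\<lambda>z. mat (f z)) A"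
  unfolding mholo_def mat_def by (intro allI, rename_tac i j, case_tac "i = j") auto

lemma mholo_add: "mholo F A \<Longrightarrow> mholo G A \<Longrightarrow> mholo (\<lambda>z. F z + G z) A"
  by (auto simp: mholo_def intro!: holomorphic_intros)

lemma mholo_diff: "mholo F A \<Longrightarrow> mholo G A \<Longrightarrow> mholo (\<lambda>z. F z - G z) A"
  by (auto simp: mholo_def intro!: holomorphic_intros)

lemma mholo_uminus: "mholo F A \<Longrightarrow> mholo (\<lambda>z. - F z) A"
  by (auto simp: mholo_def intro!: holomorphic_intros)

lemma mholo_mult: "mholo F A \<Longrightarrow> mholo G A \<Longrightarrow> mholo (\<lambda>z. F z ** G z) A"
  by (auto simp: mholo_def matrix_matrix_mult_def intro!: holomorphic_intros)

lemma mholo_id: "mholo (\<lambda>z. mat z) A"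
  by (intro mholo_mat holomorphic_intros)

lemma mholo_subset: "mholo F A \<Longrightarrow> B \<subseteq> A \<Longrightarrow> mholo F B"
  unfolding mholo_def using holomorphic_on_subset by blast

lemma mholo_cong: "(\<And>z. z \<in> A \<Longrightarrow> F z = G z) \<Longrightarrow> mholo F A \<longleftrightarrow> mholo G A"
  unfolding mholo_def by (intro all_cong1 holomorphic_cong) auto

lemma mholo_compose: "mholo F B \<Longrightarrow> g holomorphic_on A \<Longrightarrow> g ` A \<subseteq> B \<Longrightarrow> mholo (\<lambda>z. F (g z)) A"
  unfolding mholo_def using holomorphic_on_compose_gen[of g A _ B, unfolded o_def] by blast

lemma mholo_transpose: "mholo F A \<Longrightarrow> mholo (\<lambda>z. transpose (F z)) A"
  by (auto simp: mholo_def transpose_def)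

lemma mholo_det:
  assumes "mholo F A" shows "(\<lambda>z. det (F z)) holomorphic_on A"
  using assms unfolding det_def mholo_def by (intro holomorphic_intros) auto

text \<open>Cramer's rule: the entries of the inverse are quotients of determinants, which is how
  inversion preserves holomorphy.\<close>

lemma matrix_inv_nth:
  fixes A :: "'a::field^'n^'n"
  assumes "invertible A"
  shows "matrix_inv A $ k $ j = det (\<chi> i l. if l = k then mat 1 $ i $ j else A $ i $ l) / det A"
proof -
  have d: "det A \<noteq> 0" using assms by (simp add: invertible_det_nz)
  have "A *v column j (matrix_inv A) = column j (mat 1)"
    by (simp add: matrix_inv_right'[OF assms, symmetric] column_def matrix_vector_mult_def matrix_matrix_mult_def)
  then have "column j (matrix_inv A) = (\<chi> k. det (\<chi> i l. if l = k then column j (mat 1) $ i else A $ i $ l) / det A)"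
    using cramer[OF d] by blast
  then have "column j (matrix_inv A) $ k = det (\<chi> i l. if l = k then column j (mat 1) $ i else A $ i $ l) / det A"
    by simp
  then show ?thesis by (simp add: column_def cong: if_cong)
qed

lemma mholo_inv:
  fixes F :: "complex \<Rightarrow> complex^'n^'n"
  assumes "mholo F A" "\<And>z. z \<in> A \<Longrightarrow> invertible (F z)"
  shows "mholo (\<lambda>z. matrix_inv (F z)) A"
  unfolding mholo_def
proof (intro allI)
  fix k j
  have "mholo (\<lambda>z. \<chi> i l. if l = k then mat 1 $ i $ j else F z $ i $ l) A"
    unfolding mholo_def
  proof (intro allI)
    fix i l show "(\<lambda>z. (\<chi> i l. if l = k then mat 1 $ i $ j else F z $ i $ l) $ i $ l) holomorphic_on A"
      using assms(1) by (cases "l = k") (auto simp: mholo_def)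
  qed
  then have "(\<lambda>z. det (\<chi> i l. if l = k then mat 1 $ i $ j else F z $ i $ l) / det (F z)) holomorphic_on A"
    using assms by (intro holomorphic_intros mholo_det) (auto simp: invertible_det_nz)
  then show "(\<lambda>z. matrix_inv (F z) $ k $ j) holomorphic_on A"
    by (rule holomorphic_transform) (simp add: matrix_inv_nth assms(2))
qed

lemmas mholo_intros = mholo_const mholo_id mholo_add mholo_diff mholo_uminus mholo_mult mholo_inv

section \<open>Schur functions, the half-plane and spectra of matrices\<close>

lemma schur_class_mholo: "S \<in> schur_class \<Longrightarrow> mholo S \<Pi>\<^sub>+"
  by (simp add: schur_class_def mholo_def)

lemma schur_class_le: "S \<in> schur_class \<Longrightarrow> z \<in> \<Pi>\<^sub>+ \<Longrightarrow> norm (S z *v v) \<le> norm v"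
proof -
  assume a: "S \<in> schur_class" "z \<in> \<Pi>\<^sub>+"
  have "norm (S z *v v) \<le> onorm ((*v) (S z)) * norm v"
    by (rule onorm) (simp add: linear_linear)
  also have "\<dots> \<le> 1 * norm v" using a by (intro mult_right_mono) (auto simp: schur_class_def)
  finally show ?thesis by simp
qed

lemma schur_classI:
  "mholo S \<Pi>\<^sub>+ \<Longrightarrow> (\<And>z v. z \<in> \<Pi>\<^sub>+ \<Longrightarrow> norm (S z *v v) \<le> norm v) \<Longrightarrow> S \<in> schur_class"
  by (auto simp: schur_class_def mholo_def intro!: onorm_le)

lemma open_RHP: "open \<Pi>\<^sub>+"
  by (simp add: right_half_plane_def open_halfspace_Re_gt)

lemma RHP_iff: "z \<in> \<Pi>\<^sub>+ \<longleftrightarrow> Re z > 0"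
  by (simp add: right_half_plane_def)

lemma norm_smult: "norm (c *s x) = norm c * norm (x::complex^'n)"
  by (simp add: norm_vec_def L2_set_right_distrib norm_mult)

lemma spectrum_bounded:
  fixes A :: "complex^'n^'n"
  shows "\<exists>b>0. \<forall>z\<in>spectrum A. norm z \<le> b"
proof -
  obtain b where b: "b > 0" "\<And>x. norm (A *v x) \<le> norm x * b"
    using bounded_linear.pos_bounded[of "(*v) A"] by (auto simp: linear_linear)
  have "norm z \<le> b" if "z \<in> spectrum A" for z
  proof -
    obtain x where x: "(mat z - A) *v x = 0" "x \<noteq> 0"
      using \<open>z \<in> spectrum A\<close> invertible_kerI unfolding spectrum_def by blast
    then have "A *v x = z *s x" by (simp add: mvec)
    then show ?thesis using b(2)[of x] x(2) by (simp add: norm_smult mult.commute)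
  qed
  then show ?thesis using b(1) by blast
qed

text \<open>The determinant of z - \<open>A\<close> is entire and not identically zero, so it has
  finitely many zeros in the compact disc that contains the spectrum.\<close>

lemma finite_spectrum: 
  fixes A :: "complex^'n^'n"
  shows "finite (spectrum A)"
proof -
  obtain b where b: "b > 0" "\<And>z. z \<in> spectrum A \<Longrightarrow> norm z \<le> b" using spectrum_bounded by blast
  define d where "d z = det (mat z - A)" for z
  have d: "d holomorphic_on UNIV" unfolding d_def by (intro mholo_det mholo_intros)
  \<comment> \<open>A point beyond the spectral bound shows that the determinant is not identically
    zero, which settles the constant case below.\<close>
  have "of_real (b+1) \<notin> spectrum A" using b(2)[of "of_real (b+1)"] b(1) by (auto simp: norm_of_real simp del: of_real_add)
  then have nz: "d (of_real (b+1)) \<noteq> 0" by (simp add: spectrum_def d_def invertible_det_nz)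
  have "finite {z \<in> cball 0 b. d z = 0}"
  proof (cases "d constant_on UNIV")
    case True
    then obtain y where "\<And>z. d z = y" unfolding constant_on_def by auto
    then have "d z \<noteq> 0" for z using nz by simp
    then show ?thesis by simp
  next
    case False
    then show ?thesis by (intro holomorphic_compact_finite_zeros[OF d]) auto
  qed
  moreover have "spectrum A \<subseteq> {z \<in> cball 0 b. d z = 0}"
    using b(2) by (auto simp: spectrum_def d_def invertible_det_nz)
  ultimately show ?thesis by (rule finite_subset[rotated])
qed

subsection \<open>Mean values over circles\<close>

text \<open>The average over the circle of radius \<open>t\<close> about 0. Stating it through
  \<open>has_integral\<close> carries integrability along with the value.\<close>

definition has_mean :: "real \<Rightarrow> (complex \<Rightarrow> 'a::real_normed_vector) \<Rightarrow> 'a \<Rightarrow> bool"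
  where "has_mean t f c \<longleftrightarrow> ((\<lambda>\<theta>. f (of_real t * cis \<theta>)) has_integral (2 * pi) *\<^sub>R c) {0..2*pi}"

lemma has_mean_add: "has_mean t f a \<Longrightarrow> has_mean t g b \<Longrightarrow> has_mean t (\<lambda>z. f z + g z) (a + b)"
  unfolding has_mean_def by (simp add: has_integral_add scaleR_add_right)

lemma has_mean_uminus: "has_mean t f a \<Longrightarrow> has_mean t (\<lambda>z. - f z) (- a)"
  unfolding has_mean_def by (simp add: has_integral_neg)

lemma has_mean_diff: "has_mean t f a \<Longrightarrow> has_mean t g b \<Longrightarrow> has_mean t (\<lambda>z. f z - g z) (a - b)"
  unfolding has_mean_def by (simp add: has_integral_diff scaleR_diff_right)

lemma has_mean_cmult: "has_mean t f a \<Longrightarrow> has_mean t (\<lambda>z. c * f z) (c * (a::real))"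
  unfolding has_mean_def by (drule has_integral_mult_right[where c = c]) (simp add: algebra_simps)

lemma has_mean_const: "has_mean t (\<lambda>z. c::real) c"
  unfolding has_mean_def using has_integral_const_real[of c 0 "2*pi"] by simp

lemma has_mean_linear: "bounded_linear h \<Longrightarrow> has_mean t f a \<Longrightarrow> has_mean t (\<lambda>z. h (f z)) (h a)"
  unfolding has_mean_def using has_integral_linear[of _ _ _ h] 
  by (force simp: o_def linear_simps(5) bounded_linear.linear linear_scale)

lemma has_mean_cong: "(\<And>z. norm z = t \<Longrightarrow> f z = g z) \<Longrightarrow> 0 \<le> t \<Longrightarrow> has_mean t f a \<longleftrightarrow> has_mean t g a"
  unfolding has_mean_def by (intro has_integral_cong) (simp add: norm_mult)

lemma has_mean_mono:
  "has_mean t f a \<Longrightarrow> has_mean t g b \<Longrightarrow> 0 \<le> t \<Longrightarrow> (\<And>z. norm z = t \<Longrightarrow> f z \<le> g z) \<Longrightarrow> a \<le> (b::real)"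
  unfolding has_mean_def
  using has_integral_le[of "\<lambda>\<theta>. f (of_real t * cis \<theta>)" "(2*pi) *\<^sub>R a" "{0..2*pi}" "\<lambda>\<theta>. g (of_real t * cis \<theta>)" "(2*pi) *\<^sub>R b"]
  by (simp add: norm_mult)

text \<open>On the circle dz = i z d\<theta>, which accounts for the factor
  \<open>z\<close>.\<close>

lemma has_contour_integral_circlepath_mean:
  "(f has_contour_integral (2 * of_real pi * \<i> * c)) (circlepath 0 t) \<longleftrightarrow> has_mean t (\<lambda>z. z * f z) c"
proof -
  have "(f has_contour_integral (2 * of_real pi * \<i> * c)) (circlepath 0 t) \<longleftrightarrow>
     ((\<lambda>\<theta>. \<i> * (of_real t * cis \<theta> * f (of_real t * cis \<theta>))) has_integral (\<i> * ((2 * pi) *\<^sub>R c))) {0..2*pi}"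
    unfolding circlepath_def
    by (subst has_contour_integral_part_circlepath_iff) (simp_all add: algebra_simps scaleR_conv_of_real)
  also have "\<dots> \<longleftrightarrow> has_mean t (\<lambda>z. z * f z) c"
  proof
    assume "((\<lambda>\<theta>. \<i> * (of_real t * cis \<theta> * f (of_real t * cis \<theta>))) has_integral (\<i> * ((2 * pi) *\<^sub>R c))) {0..2*pi}"
    from has_integral_mult_right[OF this, of "-\<i>"] show "has_mean t (\<lambda>z. z * f z) c"
      unfolding has_mean_def by (simp add: mult.assoc[symmetric])
  next
    assume "has_mean t (\<lambda>z. z * f z) c"
    from has_integral_mult_right[OF this[unfolded has_mean_def], of "\<i>"]
    show "((\<lambda>\<theta>. \<i> * (of_real t * cis \<theta> * f (of_real t * cis \<theta>))) has_integral (\<i> * ((2 * pi) *\<^sub>R c))) {0..2*pi}" .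
  qed
  finally show ?thesis .
qed

lemma has_mean_holomorphic:
  assumes "f holomorphic_on cball 0 t" "t > 0"
  shows "has_mean t f (f 0)"
proof -
  have "((\<lambda>u. f u / (u - 0)) has_contour_integral (2 * of_real pi * \<i> * f 0)) (circlepath 0 t)"
    by (rule Cauchy_integral_circlepath_simple) (use assms in auto)
  then have "has_mean t (\<lambda>z. z * (f z / (z - 0))) (f 0)"
    by (simp only: has_contour_integral_circlepath_mean)
  then show ?thesis
    by (rule has_mean_cong[THEN iffD1, rotated 2]) (use assms in auto)
qed

text \<open>The real inner product is the real part of an expression that is complex-linear in the
  entries of \<open>M\<close>. With constant vectors, the mean value property thereby reaches matrix
  functions.\<close>

lemma mat_bilinear: "inner x (M *v y) = Re (\<Sum>i\<in>UNIV. \<Sum>j\<in>UNIV. cnj (x $ i) * M $ i $ j * y $ j)"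
  by (simp add: inner_vec_def matrix_vector_mult_def inner_complex_def sum_distrib_left
      sum_distrib_right algebra_simps flip: sum.distrib sum_subtractf)

lemma has_mean_mholo:
  assumes "mholo F (cball 0 t)" "t > 0"
  shows "has_mean t (\<lambda>z. inner x (F z *v y)) (inner x (F 0 *v y))"
proof -
  let ?f = "\<lambda>z. \<Sum>i\<in>UNIV. \<Sum>j\<in>UNIV. cnj (x $ i) * F z $ i $ j * y $ j"
  have "has_mean t ?f (?f 0)"
    using assms unfolding mholo_def by (intro has_mean_holomorphic holomorphic_intros) auto
  then show ?thesis unfolding mat_bilinear by (rule has_mean_linear[OF bounded_linear_Re])
qed

text \<open>Here $E(\zeta) = (t^2 - \zeta Z^*)^{-1}$: on the circle $|\zeta| = t$ the adjoint of the
  resolvent agrees with the function $\zeta E(\zeta)$, which is holomorphic inside.\<close>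

lemma resolvent_adjoint_circle:
  fixes Z :: "complex^'n^'n"
  assumes t: "0 < t" "\<And>z. z \<in> spectrum Z \<Longrightarrow> norm z < t"
  shows "norm u \<le> t \<Longrightarrow> invertible (mat ((of_real t)^2) - mat u ** Z\<^sup>\<dagger>)"
    and "norm u = t \<Longrightarrow> (matrix_inv (mat u - Z))\<^sup>\<dagger> = mat u ** matrix_inv (mat ((of_real t)^2) - mat u ** Z\<^sup>\<dagger>)"
proof -
  show inv: "invertible (mat ((of_real t)^2) - mat u ** Z\<^sup>\<dagger>)" if u: "norm u \<le> t" for u
  proof (cases "u = 0")
    case True
    then have "(mat ((of_real t)^2) - mat u ** Z\<^sup>\<dagger>) ** mat (inverse ((of_real t)^2)) = (mat 1 :: complex^'n^'n)"
      using t(1) by (intro mat_eqI) (simp add: mvec)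
    then show ?thesis by (rule matrix_inv_eqI)
  next
    case False
    \<comment> \<open>\<open>cnj w\<close> is the mirror image of \<open>u\<close> in the circle of
      radius \<open>t\<close>; it lies on or outside that circle and is no eigenvalue of
      \<open>Z\<close>.\<close>
    define w where "w = (of_real t)^2 / u"
    have "norm w \<ge> t" using u False t(1) by (simp add: w_def norm_divide field_simps power2_eq_square norm_mult)
    then have "cnj w \<notin> spectrum Z" using t(2)[of "cnj w"] by auto
    then have "invertible (mat w - Z\<^sup>\<dagger>)" using spectrum_ctranspose[of w Z] by (simp add: spectrum_def)
    moreover have "invertible (mat u :: complex^'n^'n)"
      by (rule matrix_inv_eqI(2)[of _ "mat (inverse u)"], rule mat_eqI) (simp add: mvec False)
    ultimately have "invertible (mat u ** (mat w - Z\<^sup>\<dagger>))" by (simp add: invertible_mult_iff)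
    moreover have "mat u ** (mat w - Z\<^sup>\<dagger>) = mat ((of_real t)^2) - mat u ** Z\<^sup>\<dagger>"
      using False by (intro mat_eqI) (simp add: mvec w_def)
    ultimately show ?thesis by simp
  qed
  assume u: "norm u = t"
  have cu: "u * cnj u = (of_real t)^2" using complex_norm_square[of u] u by (simp only: of_real_power)
  have "u \<notin> spectrum Z" using t(2)[of u] u by auto
  then have iu: "invertible (mat u - Z)" by (simp add: spectrum_def)
  then have ia: "invertible ((mat u - Z)\<^sup>\<dagger>)" by (simp add: invertible_ctranspose)
  have "(mat u - Z)\<^sup>\<dagger> ** (mat u ** matrix_inv (mat ((of_real t)^2) - mat u ** Z\<^sup>\<dagger>)) = mat 1" (is "?L = _")
  proof (rule mat_eqI)
    fix x
    define y where "y = matrix_inv (mat ((of_real t)^2) - mat u ** Z\<^sup>\<dagger>) *v x"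
    have "x = (mat ((of_real t)^2) - mat u ** Z\<^sup>\<dagger>) *v y" unfolding y_def by (simp add: inv_vec inv u)
    moreover have "?L *v x = (mat u - Z)\<^sup>\<dagger> *v (u *s y)" by (simp add: mvec y_def)
    ultimately show "?L *v x = mat 1 *v x"
      by (simp add: ctr mvec flip: cu)
  qed
  from matrix_inv_eqI(1)[OF this] show "(matrix_inv (mat u - Z))\<^sup>\<dagger> = mat u ** matrix_inv (mat ((of_real t)^2) - mat u ** Z\<^sup>\<dagger>)"
    by (simp add: matrix_inv_ctranspose iu)
qed

definition adj_res :: "real \<Rightarrow> complex^'n^'n \<Rightarrow> complex \<Rightarrow> complex^'n^'n"
  where "adj_res t Z u = matrix_inv (mat ((of_real t)^2) - mat u ** Z\<^sup>\<dagger>)"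

lemma mholo_adj_res:
  assumes t: "0 < t" "\<And>z. z \<in> spectrum Z \<Longrightarrow> norm z < t"
  shows "mholo (adj_res t Z) (cball 0 t)"
  unfolding adj_res_def using resolvent_adjoint_circle(1)[OF t]
  by (intro mholo_inv mholo_intros) auto

lemma adj_res_0: "t > 0 \<Longrightarrow> adj_res t Z 0 = mat (1 / (of_real t)^2)"
  unfolding adj_res_def by (rule matrix_inv_eqI, rule mat_eqI) (simp add: mvec)

text \<open>The residue theorem, all winding numbers being 1. It makes sums over a spectrum
  computable as means over one large circle.\<close>

lemma residue_sum_mean:
  assumes "finite A" "A \<subseteq> ball 0 t" "t > 0" "f holomorphic_on (UNIV - A)"
  shows "has_mean t (\<lambda>z. z * f z) (\<Sum>a\<in>A. residue f a)"
proof -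
  have sub: "path_image (circlepath 0 t) \<subseteq> UNIV - A" using assms(2,3) by auto
  have "contour_integral (circlepath 0 t) f
        = 2 * pi * \<i> * (\<Sum>p\<in>A. winding_number (circlepath 0 t) p * residue f p)"
    by (rule Residue_theorem[of UNIV]) (use assms sub in auto)
  also have "(\<Sum>p\<in>A. winding_number (circlepath 0 t) p * residue f p) = (\<Sum>a\<in>A. residue f a)"
    by (rule sum.cong) (use assms(2) in \<open>auto simp: winding_number_circlepath\<close>)
  finally have eq: "contour_integral (circlepath 0 t) f = 2 * pi * \<i> * (\<Sum>a\<in>A. residue f a)" .
  have "continuous_on (path_image (circlepath 0 t)) f"
    by (rule holomorphic_on_imp_continuous_on, rule holomorphic_on_subset[OF assms(4) sub])
  then have "f contour_integrable_on (circlepath 0 t)"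
    by (rule contour_integrable_continuous_circlepath)
  then have "(f has_contour_integral (2 * of_real pi * \<i> * (\<Sum>a\<in>A. residue f a))) (circlepath 0 t)"
    using eq has_contour_integral_integral[of f "circlepath 0 t"] by simp
  then show ?thesis by (simp only: has_contour_integral_circlepath_mean)
qed

lemma has_mean_unique: "has_mean t f a \<Longrightarrow> has_mean t f b \<Longrightarrow> a = b"
  unfolding has_mean_def by (drule (1) has_integral_unique) simp

subsection \<open>Stein equations in the unit disc\<close>

abbreviation res :: "complex^'n^'n \<Rightarrow> complex \<Rightarrow> complex^'n^'n"
  where "res Z u \<equiv> matrix_inv (mat u - Z)"

lemma res_vec:
  assumes "u \<notin> spectrum Z"
  shows "Z *v (res Z u *v x) = u *s (res Z u *v x) - x"
    and "Z\<^sup>\<dagger> *v ((res Z u)\<^sup>\<dagger> *v x) = cnj u *s ((res Z u)\<^sup>\<dagger> *v x) - x"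
proof -
  have i: "invertible (mat u - Z)" using assms by (simp add: spectrum_def)
  have "(mat u - Z) *v (res Z u *v x) = x" by (simp only: inv_vec i)
  then show "Z *v (res Z u *v x) = u *s (res Z u *v x) - x" by (simp add: mvec algebra_simps)
  have "(mat u - Z)\<^sup>\<dagger> *v ((res Z u)\<^sup>\<dagger> *v x) = x"
    using inv_vec(1)[of "(mat u - Z)\<^sup>\<dagger>"] i by (simp add: invertible_ctranspose flip: matrix_inv_ctranspose)
  then show "Z\<^sup>\<dagger> *v ((res Z u)\<^sup>\<dagger> *v x) = cnj u *s ((res Z u)\<^sup>\<dagger> *v x) - x"
    by (simp add: ctr mvec algebra_simps)
qed

text \<open>Substitute the two eigen-like relations and use that \<open>cnj c * c\<close> is t^2. In
  the applications \<open>a\<close> and \<open>b\<close> are resolvent vectors: the term with 1 -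
  t^2 is an error that disappears as \<open>t\<close> tends to 1, and the means of the other terms
  are explicit.\<close>

lemma stein_pointwise:
  fixes M :: "complex^'n^'n"
  assumes "M *v a = c *s a - x" "M *v b = c *s b - y" "norm c = t"
  shows "inner a ((G - M\<^sup>\<dagger> ** G ** M) *v b) =
    (1 - t^2) * inner a (G *v b) + inner (c *s a) (G *v y) + inner x (G *v (c *s b)) - inner x (G *v y)"
proof -
  have "cnj c * c = of_real (t^2)" using assms(3) complex_norm_square[of c] by (metis mult.commute)
  then have "inner (c *s a) (c *s (G *v b)) = t^2 * inner a (G *v b)"
    by (simp add: inner_smult vector_smult_assoc) (simp add: inner_vec_def inner_complex_def sum_distrib_left algebra_simps flip: of_real_power)
  moreover have "inner a ((G - M\<^sup>\<dagger> ** G ** M) *v b) = inner a (G *v b) - inner (M *v a) (G *v (M *v b))"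
    by (simp add: mvec inner_diff_right inner_ctranspose)
  ultimately show ?thesis by (simp add: assms mvec inner_diff_left inner_diff_right algebra_simps)
qed

lemma has_mean_mholo_cong:
  assumes "mholo F (cball 0 t)" "t > 0" "\<And>u. norm u = t \<Longrightarrow> f u = inner x (F u *v y)" "c = inner x (F 0 *v y)"
  shows "has_mean t f c"
  using has_mean_cong[THEN iffD2, OF assms(3) _ has_mean_mholo[OF assms(1,2)]] assms(2,4) by simp

text \<open>On the circle \<open>cnj u\<close> times the adjoint resolvent is t^2
  \<open>adj_res t Z u\<close>, which is holomorphic inside and equals the identity at 0. The second
  mean is the adjoint of the first.\<close>

lemma has_mean_res:
  fixes Z :: "complex^'n^'n"
  assumes t: "0 < t" "\<And>z. z \<in> spectrum Z \<Longrightarrow> norm z < t"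
  shows "has_mean t (\<lambda>u. inner (cnj u *s ((res Z u)\<^sup>\<dagger> *v x)) v) (inner x v)" 
    and "has_mean t (\<lambda>u. inner (u *s (res Z u *v x)) v) (inner x v)"
proof -
  have cu: "cnj u * u = (of_real t)^2" if "norm u = t" for u using that complex_norm_square[of u] by (simp add: mult.commute)
  have m: "mholo (\<lambda>u. mat ((of_real t)^2) ** adj_res t Z u) (cball 0 t)"
    by (intro mholo_intros mholo_adj_res t)
  show "has_mean t (\<lambda>u. inner (cnj u *s ((res Z u)\<^sup>\<dagger> *v x)) v) (inner x v)"
    using t by (intro has_mean_mholo_cong[OF m t(1), where x = v and y = x])
     (simp_all add: resolvent_adjoint_circle(2)[OF t] adj_res_0 inner_commute mvec cu flip: adj_res_def)
  have *: "inner (u *s (res Z u *v x)) v = inner (cnj u *s ((res Z u)\<^sup>\<dagger> *v v)) x" for u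
    by (subst inner_commute[of "cnj u *s _"]) (simp only: inner_smult ctranspose_inner mat_vec_scale)
  show "has_mean t (\<lambda>u. inner (u *s (res Z u *v x)) v) (inner x v)"
    unfolding * using t by (intro has_mean_mholo_cong[OF m t(1), where x = x and y = v])
     (simp_all add: resolvent_adjoint_circle(2)[OF t] adj_res_0 inner_commute mvec cu flip: adj_res_def)
qed

lemma spectrum_disc:
  fixes Z :: "complex^'n^'n"
  assumes "\<And>z. z \<in> spectrum Z \<Longrightarrow> norm z < 1"
  obtains t0 where "0 < t0" "t0 < 1" "\<And>z. z \<in> spectrum Z \<Longrightarrow> norm z < t0"
proof -
  define m where "m = Max (insert 0 (norm ` spectrum Z))"
  have f: "finite (insert 0 (norm ` spectrum Z))" by (simp add: finite_spectrum)
  have "m < 1" unfolding m_def using assms by (subst Max_less_iff[OF f]) auto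
  moreover have "0 \<le> m" "\<And>z. z \<in> spectrum Z \<Longrightarrow> norm z \<le> m"
    unfolding m_def using Max_ge[OF f] by auto
  ultimately show ?thesis by (intro that[of "(m+1)/2"]) force+
qed

lemma mholo_bounded:
  assumes F: "mholo F A" "compact K" "K \<subseteq> A"
  obtains C where "\<And>u. u \<in> K \<Longrightarrow> norm (F u *v x) \<le> C" "\<And>u. u \<in> K \<Longrightarrow> norm ((F u)\<^sup>\<dagger> *v y) \<le> C"
proof -
  have c: "continuous_on K (\<lambda>u. F u $ i $ j)" for i j
    using F holomorphic_on_imp_continuous_on holomorphic_on_subset unfolding mholo_def by metis
  have "continuous_on K (\<lambda>u. F u *v x)" "continuous_on K (\<lambda>u. (F u)\<^sup>\<dagger> *v y)"
    unfolding matrix_vector_mult_def ctranspose_def by (auto intro!: continuous_intros c)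
  then have "bounded ((\<lambda>u. F u *v x) ` K)" "bounded ((\<lambda>u. (F u)\<^sup>\<dagger> *v y) ` K)"
    using compact_continuous_image F(2) compact_imp_bounded by blast+
  then obtain C D where "\<And>u. u \<in> K \<Longrightarrow> norm (F u *v x) \<le> C" "\<And>u. u \<in> K \<Longrightarrow> norm ((F u)\<^sup>\<dagger> *v y) \<le> D"
    by (auto simp: bounded_iff)
  then show ?thesis by (intro that[of "max C D"]) force+
qed

lemma mat_inner_bound:
  fixes G :: "complex^'n^'m"
  shows "\<exists>C\<ge>0. \<forall>a b. norm a \<le> D \<longrightarrow> norm b \<le> D \<longrightarrow> \<bar>inner a (G *v b)\<bar> \<le> C"
proof -
  obtain B where B: "B > 0" "\<And>x. norm (G *v x) \<le> norm x * B"
    using bounded_linear.pos_bounded[of "(*v) G"] by (auto simp: linear_linear)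
  have "\<bar>inner a (G *v b)\<bar> \<le> \<bar>D\<bar> * (\<bar>D\<bar> * B)" if "norm a \<le> D" "norm b \<le> D" for a b
  proof -
    have "\<bar>inner a (G *v b)\<bar> \<le> norm a * norm (G *v b)" by (rule Cauchy_Schwarz_ineq2)
    also have "\<dots> \<le> norm a * (norm b * B)" by (intro mult_left_mono B(2)) auto
    also have "\<dots> \<le> \<bar>D\<bar> * (\<bar>D\<bar> * B)" using that B by (intro mult_mono) auto
    finally show ?thesis .
  qed
  then show ?thesis using B by (intro exI[of _ "\<bar>D\<bar> * (\<bar>D\<bar> * B)"]) auto
qed

text \<open>The bound does not depend on the radius, so error terms of order 1 - t^2 vanish in the
  limit.\<close>

lemma res_annulus_bound:
  fixes Z :: "complex^'n^'n"
  assumes t: "\<And>z. z \<in> spectrum Z \<Longrightarrow> norm z < t0"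
  obtains C where "\<And>u. t0 \<le> norm u \<Longrightarrow> norm u \<le> 1 \<Longrightarrow> norm (res Z u *v x) \<le> C"
    "\<And>u. t0 \<le> norm u \<Longrightarrow> norm u \<le> 1 \<Longrightarrow> norm ((res Z u)\<^sup>\<dagger> *v y) \<le> C"
proof -
  have "mholo (res Z) (- spectrum Z)"
    by (intro mholo_intros) (auto simp: spectrum_def)
  moreover have "compact (cball 0 1 - ball 0 t0 :: complex set)" by (simp add: compact_diff)
  moreover have "cball 0 1 - ball 0 t0 \<subseteq> - spectrum Z" using t by auto
  ultimately obtain C where "\<And>u. u \<in> cball 0 1 - ball 0 t0 \<Longrightarrow> norm (res Z u *v x) \<le> C"
    "\<And>u. u \<in> cball 0 1 - ball 0 t0 \<Longrightarrow> norm ((res Z u)\<^sup>\<dagger> *v y) \<le> C"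
    by (rule mholo_bounded[of "res Z" _ _ x y]) blast
  then show ?thesis by (intro that[of C]) auto
qed

lemma nonneg_at_1:
  fixes f :: "real \<Rightarrow> real"
  assumes "continuous_on UNIV f" "t0 < 1" "\<And>t. t0 < t \<Longrightarrow> t < 1 \<Longrightarrow> 0 \<le> f t"
  shows "0 \<le> f 1"
proof (rule tendsto_lowerbound)
  show "(f \<longlongrightarrow> f 1) (at_left 1)"
    using assms(1) by (meson UNIV_I continuous_on_def tendsto_within_subset top_greatest)
  show "\<forall>\<^sub>F t in at_left 1. 0 \<le> f t"
    using assms(2,3) eventually_at_left by blast
qed simp

text \<open>Averaging \<open>stein_pointwise\<close> for the homogeneous equation bounds
  \<open>inner x (G *v y)\<close> by (1 - t^2) C for all \<open>x\<close> and \<open>y\<close>. In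
  the limit it is at most 0, and \<open>x\<close> = \<open>G *v y\<close> gives the claim.\<close>

lemma stein_unique:
  fixes Z G :: "complex^'n^'n"
  assumes Z: "\<And>z. z \<in> spectrum Z \<Longrightarrow> norm z < 1" and G: "G = Z ** G ** Z\<^sup>\<dagger>"
  shows "G = 0"
proof -
  obtain t0 where t0: "0 < t0" "t0 < 1" "\<And>z. z \<in> spectrum Z \<Longrightarrow> norm z < t0"
    using spectrum_disc[OF Z] by blast
  have "0 \<le> - inner x (G *v y)" for x y
  proof -
    obtain D where D: "\<And>u. t0 \<le> norm u \<Longrightarrow> norm u \<le> 1 \<Longrightarrow> norm ((res Z u)\<^sup>\<dagger> *v x) \<le> D"
      using res_annulus_bound[of Z t0 x x] t0(3) by metis
    obtain D' where D': "\<And>u. t0 \<le> norm u \<Longrightarrow> norm u \<le> 1 \<Longrightarrow> norm ((res Z u)\<^sup>\<dagger> *v y) \<le> D'"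
      using res_annulus_bound[of Z t0 y y] t0(3) by metis
    obtain C where C: "\<And>a b. norm a \<le> max D D' \<Longrightarrow> norm b \<le> max D D' \<Longrightarrow> \<bar>inner a (G *v b)\<bar> \<le> C"
      using mat_inner_bound by metis
    have "0 \<le> (1 - t^2) * C - inner x (G *v y)" if t: "t0 < t" "t < 1" for t
    proof -
      have st: "\<And>z. z \<in> spectrum Z \<Longrightarrow> norm z < t" using t0(3) t by force
      have tp: "0 < t" using t0 t by simp
      have t2: "0 \<le> 1 - t^2" using t tp by (simp add: power_le_one)
      let ?f = "\<lambda>u. inner (cnj u *s ((res Z u)\<^sup>\<dagger> *v x)) (G *v y) + inner (cnj u *s ((res Z u)\<^sup>\<dagger> *v y)) (G\<^sup>\<dagger> *v x) - inner x (G *v y)"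
      have "has_mean t ?f (inner x (G *v y) + inner y (G\<^sup>\<dagger> *v x) - inner x (G *v y))"
        by (intro has_mean_diff has_mean_add has_mean_res has_mean_const tp st)
      moreover have "inner y (G\<^sup>\<dagger> *v x) = inner x (G *v y)"
        by (metis ctranspose_inner inner_commute)
      ultimately have "has_mean t ?f (inner x (G *v y))" by simp
      moreover have "?f u \<le> (1 - t^2) * C" if u: "norm u = t" for u
      proof -
        have "u \<notin> spectrum Z" using st u by auto
        note r = res_vec(2)[OF this]
        have "inner ((res Z u)\<^sup>\<dagger> *v x) ((G - (Z\<^sup>\<dagger>)\<^sup>\<dagger> ** G ** Z\<^sup>\<dagger>) *v ((res Z u)\<^sup>\<dagger> *v y)) = (1 - t^2) * inner ((res Z u)\<^sup>\<dagger> *v x) (G *v ((res Z u)\<^sup>\<dagger> *v y)) + ?f u"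
          by (subst stein_pointwise[OF r r, of t])
            (use u in \<open>simp_all add: inner_ctranspose[of x] inner_commute[of "G\<^sup>\<dagger> *v x"]\<close>)
        then have "?f u = (1 - t^2) * - inner ((res Z u)\<^sup>\<dagger> *v x) (G *v ((res Z u)\<^sup>\<dagger> *v y))"
          using G by simp
        moreover have "\<bar>inner ((res Z u)\<^sup>\<dagger> *v x) (G *v ((res Z u)\<^sup>\<dagger> *v y))\<bar> \<le> C"
          using u t D[of u] D'[of u] by (intro C) auto
        ultimately show ?thesis using t2 by (metis abs_le_iff mult_left_mono)
      qed
      ultimately have "inner x (G *v y) \<le> (1 - t^2) * C"
        using has_mean_mono[OF _ has_mean_const[of t "(1 - t^2) * C"]] tp by fastforce
      then show ?thesis by simp
    qed
    then have "0 \<le> (1 - 1^2) * C - inner x (G *v y)"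
      by (intro nonneg_at_1[of "\<lambda>t. (1 - t^2) * C - inner x (G *v y)" t0] continuous_intros t0)
    then show ?thesis by simp
  qed
  from this[of "G *v y" y for y] have "G *v y = 0" for y
    by (metis inner_ge_zero inner_eq_zero_iff neg_0_le_iff_le order_antisym)
  then show ?thesis by (intro mat_eqI) simp
qed

subsection \<open>Necessity in the disc\<close>

text \<open>With $a = (\zeta - Z)^{-*} x$, $b = (\zeta - W)^{-1} y$ and $q = \bar\zeta\, Y^* a$ the inequality that
  is averaged comes from $g = U b + q$ and $k = \bar\zeta\, X^* a + V b$; all terms with a factor that is
  analytic in the disc and vanishes at 0 have mean 0.\<close>

lemma disc_necessity:
  fixes Z :: "complex^'z^'z" and X :: "complex^'p^'z" and Y :: "complex^'m^'z"
    and U :: "complex^'w^'m" and V :: "complex^'w^'p" and W :: "complex^'w^'w"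
    and \<Gamma> :: "complex^'w^'z"
  assumes sZ: "\<And>z. z \<in> spectrum Z \<Longrightarrow> norm z < 1" and sW: "\<And>z. z \<in> spectrum W \<Longrightarrow> norm z < 1"
    and S: "mholo S (ball 0 1)" "\<And>u v. norm u < 1 \<Longrightarrow> norm (S u *v v) \<le> norm v"
    and HLK: "mholo H (ball 0 1)" "mholo L (ball 0 1)" "mholo K (ball 0 1)"
    and eH: "\<And>u. norm u < 1 \<Longrightarrow> X ** S u - Y = (mat u - Z) ** H u"
    and eL: "\<And>u. norm u < 1 \<Longrightarrow> S u ** U - V = L u ** (mat u - W)"
    and eK: "\<And>u. norm u < 1 \<Longrightarrow> H u ** U - \<Gamma> = K u ** (mat u - W)"
    and syl: "\<Gamma> ** W - Z ** \<Gamma> = X ** V - Y ** U"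
    and GL: "GL - Z ** GL ** Z\<^sup>\<dagger> = X ** X\<^sup>\<dagger> - Y ** Y\<^sup>\<dagger>"
    and GR: "GR - W\<^sup>\<dagger> ** GR ** W = U\<^sup>\<dagger> ** U - V\<^sup>\<dagger> ** V"
  shows "0 \<le> inner x (GL *v x) + inner y (GR *v y) - 2 * inner x (\<Gamma> *v y)"
proof -
  obtain tZ where tZ: "0 < tZ" "tZ < 1" "\<And>z. z \<in> spectrum Z \<Longrightarrow> norm z < tZ" using spectrum_disc[OF sZ] by blast
  obtain tW where tW: "0 < tW" "tW < 1" "\<And>z. z \<in> spectrum W \<Longrightarrow> norm z < tW" using spectrum_disc[OF sW] by blast
  define t0 where "t0 = max tZ tW"
  have t0: "0 < t0" "t0 < 1" "\<And>z. z \<in> spectrum Z \<Longrightarrow> norm z < t0" "\<And>z. z \<in> spectrum W \<Longrightarrow> norm z < t0"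
    using tZ tW unfolding t0_def by force+
  define a where "a u = (res Z u)\<^sup>\<dagger> *v x" for u
  define b where "b u = res W u *v y" for u
  obtain D where D: "\<And>u. t0 \<le> norm u \<Longrightarrow> norm u \<le> 1 \<Longrightarrow> norm (a u) \<le> D"
    using res_annulus_bound[of Z t0 x x] t0(3) unfolding a_def by metis
  obtain D' where D': "\<And>u. t0 \<le> norm u \<Longrightarrow> norm u \<le> 1 \<Longrightarrow> norm (b u) \<le> D'"
    using res_annulus_bound[of W t0 y y] t0(4) unfolding b_def by metis
  obtain CL where CL: "CL \<ge> 0" "\<And>a b. norm a \<le> D \<Longrightarrow> norm b \<le> D \<Longrightarrow> \<bar>inner a (GL *v b)\<bar> \<le> CL"
    using mat_inner_bound by metis
  obtain CR where CR: "CR \<ge> 0" "\<And>a b. norm a \<le> D' \<Longrightarrow> norm b \<le> D' \<Longrightarrow> \<bar>inner a (GR *v b)\<bar> \<le> CR"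
    using mat_inner_bound by metis
  \<comment> \<open>The factor t^2 on \<open>GL\<close> stems from the \<open>cnj u\<close> in
    \<open>f\<close> and \<open>q\<close>; the last summand dominates the two error terms of
    \<open>stein_pointwise\<close>. At t = 1 both distortions disappear.\<close>
  have "0 \<le> t^2 * inner x (GL *v x) + inner y (GR *v y) - 2 * inner x (\<Gamma> *v y) + (1 - t^2) * (CL + CR)"
    if t: "t0 < t" "t < 1" for t
  proof -
    have stZ: "\<And>z. z \<in> spectrum Z \<Longrightarrow> norm z < t" and stW: "\<And>z. z \<in> spectrum W \<Longrightarrow> norm z < t"
      using t0 t by force+
    have tp: "0 < t" using t0 t by simp
    have t2: "0 \<le> 1 - t^2" "t^2 \<le> 1" using t tp by (simp_all add: power_le_one)
    have sub: "cball 0 t \<subseteq> (ball 0 1 :: complex set)" using t by auto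
    note S' = mholo_subset[OF S(1) sub] and H' = mholo_subset[OF HLK(1) sub]
      and L' = mholo_subset[OF HLK(2) sub] and K' = mholo_subset[OF HLK(3) sub]
    note rZ = mholo_adj_res[of t Z, OF tp stZ] and rW = mholo_adj_res[of t W, OF tp stW]
    have a_circ: "a u = u *s (adj_res t Z u *v x)" if "norm u = t" for u
      using resolvent_adjoint_circle(2)[of t Z u, OF tp stZ that] by (simp add: a_def adj_res_def mvec)
    have b_circ: "inner (b u) v = inner y (u *s (adj_res t W u *v v))" if "norm u = t" for u v
      using resolvent_adjoint_circle(2)[of t W u, OF tp stW that] by (simp add: b_def adj_res_def mvec ctranspose_inner)
    have cu: "cnj u * u = (of_real t)^2" if "norm u = t" for u
      using that complex_norm_square[of u] by (simp add: mult.commute)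
    define q where "q u = cnj u *s (Y\<^sup>\<dagger> *v a u)" for u
    \<comment> \<open>On the circle \<open>q\<close> coincides with a function holomorphic inside,
      so it can stand in the right slot of the means below. \<open>b\<close> stands in the left
      slot, where its adjoint supplies the factor \<open>u\<close> that vanishes at 0.\<close>
    have q_circ: "q u = (of_real t)^2 *s (Y\<^sup>\<dagger> *v (adj_res t Z u *v x))" if "norm u = t" for u
      by (simp add: q_def a_circ that mvec cu)
    have m1: "has_mean t (\<lambda>u. inner (V *v b u) (L u *v y)) 0"
      by (rule has_mean_mholo_cong[where x = y and y = y and F = "\<lambda>u. mat u ** adj_res t W u ** V\<^sup>\<dagger> ** L u"])
        (auto intro!: mholo_intros rW L' tp simp: ctranspose_inner b_circ mvec)
    have m2: "has_mean t (\<lambda>u. inner x (H u *v (u *s q u))) 0"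
      by (rule has_mean_mholo_cong[where x = x and y = x and F = "\<lambda>u. H u ** mat u ** mat ((of_real t)^2) ** Y\<^sup>\<dagger> ** adj_res t Z u"])
        (auto intro!: mholo_intros rZ H' tp simp: mvec q_circ mult.commute)
    have m3: "has_mean t (\<lambda>u. inner (U *v b u) (q u)) 0"
      by (rule has_mean_mholo_cong[where x = y and y = x and F = "\<lambda>u. mat u ** adj_res t W u ** U\<^sup>\<dagger> ** mat ((of_real t)^2) ** Y\<^sup>\<dagger> ** adj_res t Z u"])
        (auto intro!: mholo_intros rW rZ tp simp: ctranspose_inner b_circ mvec q_circ mult.commute)
    \<comment> \<open>The only cross term with a mean that need not vanish: here
      \<open>cnj u\<close> cancels the factor \<open>u\<close> of \<open>a\<close>. This is how
      \<Gamma> enters the result.\<close>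
    have m4: "has_mean t (\<lambda>u. inner (cnj u *s a u) (\<Gamma> *v y)) (inner x (\<Gamma> *v y))"
      unfolding a_def by (intro has_mean_res tp stZ)
    have m5: "has_mean t (\<lambda>u. inner x (u *s (K u *v y))) 0"
      by (rule has_mean_mholo_cong[where x = x and y = y and F = "\<lambda>u. mat u ** K u"])
        (auto intro!: mholo_intros K' tp simp: mvec)
    have m6: "has_mean t (\<lambda>u. inner (V *v b u) (S u *v q u)) 0"
      by (rule has_mean_mholo_cong[where x = y and y = x and F = "\<lambda>u. mat u ** adj_res t W u ** V\<^sup>\<dagger> ** S u ** mat ((of_real t)^2) ** Y\<^sup>\<dagger> ** adj_res t Z u"])
        (auto intro!: mholo_intros rW rZ S' tp simp: ctranspose_inner b_circ mvec q_circ mult.commute)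
    let ?A = "\<lambda>u. inner (cnj u *s a u) (GL *v x) + inner (cnj u *s a u) (GL\<^sup>\<dagger> *v x) - inner x (GL *v x)"
    have m7: "has_mean t ?A (inner x (GL *v x))"
    proof -
      have "has_mean t ?A (inner x (GL *v x) + inner x (GL\<^sup>\<dagger> *v x) - inner x (GL *v x))"
        unfolding a_def by (intro has_mean_diff has_mean_add has_mean_const has_mean_res tp stZ)
      moreover have "inner x (GL\<^sup>\<dagger> *v x) = inner x (GL *v x)" by (metis ctranspose_inner inner_commute)
      ultimately show ?thesis by simp
    qed
    let ?B = "\<lambda>u. inner (u *s b u) (GR *v y) + inner (u *s b u) (GR\<^sup>\<dagger> *v y) - inner y (GR *v y)"
    have m8: "has_mean t ?B (inner y (GR *v y))"
    proof -
      have "has_mean t ?B (inner y (GR *v y) + inner y (GR\<^sup>\<dagger> *v y) - inner y (GR *v y))"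
        unfolding b_def by (intro has_mean_diff has_mean_add has_mean_const has_mean_res tp stW)
      moreover have "inner y (GR\<^sup>\<dagger> *v y) = inner y (GR *v y)" by (metis ctranspose_inner inner_commute)
      ultimately show ?thesis by simp
    qed
    let ?I = "\<lambda>u. t^2 * ?A u + ?B u + 2 * (- inner (V *v b u) (L u *v y) - inner x (H u *v (u *s q u))
        + inner (U *v b u) (q u) - inner (cnj u *s a u) (\<Gamma> *v y) - inner x (u *s (K u *v y))
        - inner (V *v b u) (S u *v q u))"
    have mI: "has_mean t ?I (t^2 * inner x (GL *v x) + inner y (GR *v y) + 2 * (- 0 - 0 + 0 - inner x (\<Gamma> *v y) - 0 - 0))"
      by (intro has_mean_add has_mean_diff has_mean_uminus has_mean_cmult m1 m2 m3 m4 m5 m6 m7 m8)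
    have "- ((1 - t^2) * (CL + CR)) \<le> ?I u" if u: "norm u = t" for u
    proof -
      have nu: "norm u < 1" using u t by simp
      have nZ: "u \<notin> spectrum Z" and nW: "u \<notin> spectrum W" using stZ[of u] stW[of u] u by auto
      note ra = res_vec(2)[OF nZ, of x, folded a_def] and rb = res_vec(1)[OF nW, of y, folded b_def]
      define h f v g where "h = U *v b u" and "f = cnj u *s (X\<^sup>\<dagger> *v a u)" and "v = V *v b u" and "g = h + q u"
      have eA: "(norm f)^2 - (norm (q u))^2 = t^2 * ((1 - t^2) * inner (a u) (GL *v a u) + ?A u)"
      proof -
        have *: "inner (a u) ((GL - Z ** GL ** Z\<^sup>\<dagger>) *v a u) = (1 - t^2) * inner (a u) (GL *v a u) + ?A u"
          using stein_pointwise[OF ra ra, of t GL] u by (simp add: inner_ctranspose[of x] inner_commute[of "GL\<^sup>\<dagger> *v x"])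
        have n: "(norm (cnj u *s w))^2 = t^2 * (norm w)^2" for w :: "complex^'k"
          using u by (simp add: norm_smult power_mult_distrib)
        show ?thesis unfolding *[symmetric] GL f_def q_def n
          by (simp add: mvec inner_diff_right inner_ctranspose power2_norm_eq_inner algebra_simps)
      qed
      have eB: "(norm h)^2 - (norm v)^2 = (1 - t^2) * inner (b u) (GR *v b u) + ?B u"
      proof -
        have *: "inner (b u) ((GR - W\<^sup>\<dagger> ** GR ** W) *v b u) = (1 - t^2) * inner (b u) (GR *v b u) + ?B u"
          using stein_pointwise[OF rb rb, of t GR] u by (simp add: inner_ctranspose[of y] inner_commute[of "GR\<^sup>\<dagger> *v y"])
        show ?thesis unfolding *[symmetric] GR h_def v_def
          by (simp add: mvec inner_diff_right inner_ctranspose power2_norm_eq_inner algebra_simps)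
      qed
      have SU: "S u *v (U *v w) = V *v w + L u *v (u *s w - W *v w)" for w
        using arg_cong[OF eL[OF nu], of "\<lambda>M. M *v w"] by (simp add: mvec algebra_simps)
      have XS: "X *v (S u *v w) = Y *v w + u *s (H u *v w) - Z *v (H u *v w)" for w
        using arg_cong[OF eH[OF nu], of "\<lambda>M. M *v w"] by (simp add: mvec algebra_simps)
      have HU: "H u *v (U *v w) = \<Gamma> *v w + K u *v (u *s w - W *v w)" for w
        using arg_cong[OF eK[OF nu], of "\<lambda>M. M *v w"] by (simp add: mvec algebra_simps)
      have XV: "X *v (V *v w) = Y *v (U *v w) + \<Gamma> *v (W *v w) - Z *v (\<Gamma> *v w)" for w
        using arg_cong[OF syl, of "\<lambda>M. M *v w"] by (simp add: mvec algebra_simps)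
      \<comment> \<open>The adjoint of \<open>u - Z\<close> maps \<open>a u\<close> to
        \<open>x\<close>, so pairing with \<open>a u\<close> removes the pencil in front of
        \<open>H\<close> and \<Gamma>.\<close>
      have aZ: "inner (a u) (u *s w - Z *v w) = inner x w" for w
        by (simp add: inner_diff_right inner_ctranspose[of "a u"] ra inner_smult_right inner_diff_left)
      have fX: "inner f w = inner (a u) (u *s (X *v w))" for w
        using inner_ctranspose[of "a u" X "u *s w"] by (simp add: f_def inner_smult mat_vec_scale)
      have qY: "inner (a u) (u *s (Y *v w)) = inner (q u) w" for w
        using inner_ctranspose[of "a u" Y "u *s w"] by (simp add: q_def inner_smult mat_vec_scale)
      have fXS: "inner f (S u *v w) = inner (a u) (u *s (Y *v w)) + inner x (H u *v (u *s w))" for w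
      proof -
        have "u *s (X *v (S u *v w)) = X *v (S u *v (u *s w))" by (simp only: mat_vec_scale)
        also have "\<dots> = Y *v (u *s w) + (u *s (H u *v (u *s w)) - Z *v (H u *v (u *s w)))"
          by (simp only: XS add_diff_eq)
        finally show ?thesis by (simp only: fX inner_add_right aZ mat_vec_scale[of Y])
      qed
      have vSh: "inner v (S u *v h) = (norm v)^2 + inner v (L u *v y)"
        by (simp add: h_def SU rb inner_add_right power2_norm_eq_inner v_def)
      have fSq: "inner f (S u *v q u) = (norm (q u))^2 + inner x (H u *v (u *s q u))"
      proof -
        show ?thesis unfolding fXS qY by (simp add: power2_norm_eq_inner)
      qed
      have fSh: "inner f (S u *v h) = inner (q u) h + inner (cnj u *s x) (\<Gamma> *v b u) + inner x (u *s (K u *v y))"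
      proof -
        have "H u *v (u *s h) = u *s (\<Gamma> *v b u) + u *s (K u *v y)"
          by (simp add: h_def mat_vec_scale HU rb vector_add_ldistrib)
        then show ?thesis unfolding fXS qY by (simp add: inner_add_right inner_smult)
      qed
      \<comment> \<open>The term pairing \<open>x\<close> with \<open>\<Gamma> *v b u\<close> occurs
        here and in \<open>fSh\<close>; it cancels in the difference of the two.\<close>
      have fv: "inner f v = inner (q u) h - inner (cnj u *s a u) (\<Gamma> *v y) + inner (cnj u *s x) (\<Gamma> *v b u)"
      proof -
        have "X *v v = Y *v h + (u *s (\<Gamma> *v b u) - Z *v (\<Gamma> *v b u)) - \<Gamma> *v y"
          by (simp add: XV h_def v_def rb mvec)
        then have "u *s (X *v v) = u *s (Y *v h) + (u *s (\<Gamma> *v (u *s b u)) - Z *v (\<Gamma> *v (u *s b u))) - u *s (\<Gamma> *v y)"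
          by (simp only: vector_add_ldistrib vector_ssub_ldistrib mat_vec_scale)
        then have "inner f v = inner (a u) (u *s (Y *v h)) + inner x (\<Gamma> *v (u *s b u)) - inner (a u) (u *s (\<Gamma> *v y))"
          by (simp only: fX inner_add_right inner_diff_right[of _ _ "u *s (\<Gamma> *v y)"] aZ)
        then show ?thesis unfolding qY by (simp add: mvec inner_smult)
      qed
      \<comment> \<open>A square plus the contractivity defect of \<open>S u\<close> at
        \<open>g\<close>; with k = \<open>f + v\<close> the sum is the averaged inequality.\<close>
      have "0 \<le> (norm (f + v - S u *v g))^2 + ((norm g)^2 - (norm (S u *v g))^2)"
        using power_mono[OF S(2)[OF nu, of g], of 2] by simp
      also have "\<dots> = (norm g)^2 + (norm (f + v))^2 - 2 * inner (f + v) (S u *v g)"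
        by (simp add: power2_norm_eq_inner inner_diff_left inner_diff_right inner_commute)
      also have "\<dots> = (norm h)^2 + (norm (q u))^2 + 2 * inner h (q u) + (norm f)^2 + (norm v)^2 + 2 * inner f v
           - 2 * (inner f (S u *v h) + inner f (S u *v q u) + inner v (S u *v h) + inner v (S u *v q u))"
        by (simp add: power2_norm_eq_inner inner_add_left inner_add_right inner_commute g_def mvec)
      also have "\<dots> = ?I u + t^2 * ((1 - t^2) * inner (a u) (GL *v a u)) + (1 - t^2) * inner (b u) (GR *v b u)"
        using eA eB unfolding vSh fSq fSh fv v_def[symmetric] h_def[symmetric]
        by (simp add: algebra_simps inner_commute[of _ h])
      finally have "- (t^2 * ((1 - t^2) * inner (a u) (GL *v a u)) + (1 - t^2) * inner (b u) (GR *v b u)) \<le> ?I u"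
        by simp
      moreover have "t^2 * ((1 - t^2) * inner (a u) (GL *v a u)) \<le> 1 * ((1 - t^2) * CL)"
      proof -
        have "\<bar>inner (a u) (GL *v a u)\<bar> \<le> CL" using CL(2)[OF D D, of u u] u t t0 by auto
        then have "t^2 * ((1 - t^2) * \<bar>inner (a u) (GL *v a u)\<bar>) \<le> 1 * ((1 - t^2) * CL)"
          using t2 by (intro mult_mono) auto
        moreover have "t^2 * ((1 - t^2) * inner (a u) (GL *v a u)) \<le> t^2 * ((1 - t^2) * \<bar>inner (a u) (GL *v a u)\<bar>)"
          using t2 by (intro mult_left_mono) auto
        ultimately show ?thesis by simp
      qed
      moreover have "(1 - t^2) * inner (b u) (GR *v b u) \<le> (1 - t^2) * CR"
      proof -
        have "\<bar>inner (b u) (GR *v b u)\<bar> \<le> CR" using CR(2)[OF D' D', of u u] u t t0 by auto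
        then show ?thesis using t2 by (intro mult_left_mono) auto
      qed
      ultimately show ?thesis by (simp add: algebra_simps)
    qed
    from has_mean_mono[OF has_mean_const mI _ this] tp
    show ?thesis by (simp add: algebra_simps)
  qed
  then have "0 \<le> 1^2 * inner x (GL *v x) + inner y (GR *v y) - 2 * inner x (\<Gamma> *v y) + (1 - 1^2) * (CL + CR)"
    by (intro nonneg_at_1[of "\<lambda>t. t^2 * inner x (GL *v x) + inner y (GR *v y) - 2 * inner x (\<Gamma> *v y) + (1 - t^2) * (CL + CR)" t0] continuous_intros t0)
  then show ?thesis by simp
qed

text \<open>Collecting equal terms produces numerals that act by the componentwise product; they are
  turned back into scalar multiples.\<close>

lemma numeral_vec: "(numeral k :: 'a::comm_ring_1^'n) * x = numeral k *s x" "x * numeral k = numeral k *s (x :: 'a^'n)"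
  by (simp_all add: vec_eq_iff mult.commute)

subsection \<open>The Cayley transform\<close>

text \<open>This is (Z - 1)(Z + 1)^{-1}, written so that a single inverse occurs. The matching
  change of variable is \<lambda> = (1 + u)/(1 - u).\<close>

definition cayley :: "complex^'n^'n \<Rightarrow> complex^'n^'n"
  where "cayley Z = mat 1 - mat 2 ** matrix_inv (Z + mat 1)"

lemma invertible_add_1:
  assumes "spectrum Z \<subseteq> \<Pi>\<^sub>+" shows "invertible (Z + mat 1)"
proof -
  have "- 1 \<notin> spectrum Z" using assms by (auto simp: right_half_plane_def)
  then have "invertible (mat (-1) - Z)" by (simp add: spectrum_def)
  moreover have "invertible (mat (-1) :: complex^'a^'a)"
    by (rule matrix_inv_eqI(2)[of _ "mat (-1)"], rule mat_eqI) (simp add: mvec)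
  moreover have "Z + mat 1 = mat (-1) ** (mat (-1) - Z)" by (rule mat_eqI) (simp add: mvec)
  ultimately show ?thesis by (simp add: invertible_mult_iff)
qed

lemma cayley_vec:
  fixes Z :: "complex^'n^'n"
  assumes "spectrum Z \<subseteq> \<Pi>\<^sub>+"
  shows "matrix_inv (Z + mat 1) *v (Z *v x) = x - matrix_inv (Z + mat 1) *v x"
    and "Z *v (matrix_inv (Z + mat 1) *v x) = x - matrix_inv (Z + mat 1) *v x"
    and "(matrix_inv (Z + mat 1))\<^sup>\<dagger> *v (Z\<^sup>\<dagger> *v x) = x - (matrix_inv (Z + mat 1))\<^sup>\<dagger> *v x"
    and "Z\<^sup>\<dagger> *v ((matrix_inv (Z + mat 1))\<^sup>\<dagger> *v x) = x - (matrix_inv (Z + mat 1))\<^sup>\<dagger> *v x"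
proof -
  note i = invertible_add_1[OF assms]
  have i': "invertible (Z\<^sup>\<dagger> + mat 1)" using i invertible_ctranspose[of "Z + mat 1"] by (simp add: ctr)
  have e: "(matrix_inv (Z + mat 1))\<^sup>\<dagger> = matrix_inv (Z\<^sup>\<dagger> + mat 1)"
    using matrix_inv_ctranspose[OF i] by (simp add: ctr)
  from inv_vec(2)[OF i, of x] show "matrix_inv (Z + mat 1) *v (Z *v x) = x - matrix_inv (Z + mat 1) *v x"
    by (simp add: mvec algebra_simps)
  from inv_vec(1)[OF i, of x] show "Z *v (matrix_inv (Z + mat 1) *v x) = x - matrix_inv (Z + mat 1) *v x"
    by (simp add: mvec algebra_simps)
  from inv_vec(2)[OF i', of x] show "(matrix_inv (Z + mat 1))\<^sup>\<dagger> *v (Z\<^sup>\<dagger> *v x) = x - (matrix_inv (Z + mat 1))\<^sup>\<dagger> *v x"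
    unfolding e by (simp add: mvec algebra_simps)
  from inv_vec(1)[OF i', of x] show "Z\<^sup>\<dagger> *v ((matrix_inv (Z + mat 1))\<^sup>\<dagger> *v x) = x - (matrix_inv (Z + mat 1))\<^sup>\<dagger> *v x"
    unfolding e by (simp add: mvec algebra_simps)
qed

lemma cayley_point:
  assumes "norm u < 1" shows "u \<noteq> 1" "(1 + u) / (1 - u) \<in> \<Pi>\<^sub>+"
proof -
  show u1: "u \<noteq> 1" using assms by auto
  have "(norm u)^2 < 1" using assms by (simp add: power_less_one_iff abs_square_less_1)
  then have "(Re u)^2 + (Im u)^2 < 1" by (simp add: cmod_power2)
  then have "(1 + Re u) * (1 - Re u) - Im u * Im u > 0" by (simp add: power2_eq_square algebra_simps)
  moreover have "(1 - Re u)^2 + (Im u)^2 > 0" using u1 by (auto simp: complex_eq_iff sum_power2_gt_zero_iff)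
  ultimately show "(1 + u) / (1 - u) \<in> \<Pi>\<^sub>+"
    by (simp add: right_half_plane_def Re_divide field_simps power2_eq_square)
qed

text \<open>\<open>Z + mat 1\<close> times \<open>mat u - cayley Z\<close> is (1 + u) - (1 - u) Z.
  For |u| at least 1 this is invertible: it is 2 when u = 1, and otherwise a nonzero multiple of
  \<lambda> - Z with \<lambda> = (1 + u)/(1 - u) outside the half-plane.\<close>

lemma spectrum_cayley:
  fixes Z :: "complex^'n^'n"
  assumes Z: "spectrum Z \<subseteq> \<Pi>\<^sub>+" and u: "u \<in> spectrum (cayley Z)" shows "norm u < 1"
proof (rule ccontr)
  assume "\<not> norm u < 1"
  then have nu: "1 \<le> norm u" by simp
  have eq: "(Z + mat 1) ** (mat u - cayley Z) = mat (1 + u) - mat (1 - u) ** Z"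
    by (rule mat_eqI) (simp add: mvec cayley_def cayley_vec[OF Z] algebra_simps inv_vec invertible_add_1[OF Z] numeral_vec)
  have "invertible (mat (1 + u) - mat (1 - u) ** Z)"
  proof (cases "u = 1")
    case True
    show ?thesis by (rule matrix_inv_eqI(2)[of _ "mat (1/2)"], rule mat_eqI) (simp add: mvec True)
  next
    case False
    have "1 \<le> (norm u)^2" using nu by simp
    then have "1 \<le> (Re u)^2 + (Im u)^2" by (simp add: cmod_power2)
    then have "(1 + Re u) * (1 - Re u) - Im u * Im u \<le> 0" by (simp add: power2_eq_square algebra_simps)
    moreover have "(1 - Re u)^2 + (Im u)^2 > 0" using False by (auto simp: complex_eq_iff sum_power2_gt_zero_iff)
    ultimately have "(1 + u) / (1 - u) \<notin> \<Pi>\<^sub>+"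
      by (simp add: right_half_plane_def Re_divide field_simps power2_eq_square)
    then have "invertible (mat ((1 + u) / (1 - u)) - Z)" using Z by (auto simp: spectrum_def)
    moreover have "invertible (mat (1 - u) :: complex^'n^'n)"
      using False by (intro matrix_inv_eqI(2)[of _ "mat (inverse (1 - u))"] mat_eqI)
        (simp add: matrix_vector_mul_assoc[symmetric] vector_smult_assoc)
    moreover have "mat (1 + u) - mat (1 - u) ** Z = mat (1 - u) ** (mat ((1 + u) / (1 - u)) - Z)"
      using False by (intro mat_eqI) (simp add: matrix_vector_mul_assoc[symmetric]
        matrix_vector_mult_diff_rdistrib vector_ssub_ldistrib vector_smult_assoc)
    ultimately show ?thesis by (simp add: invertible_mult_iff)
  qed
  then have "invertible (mat u - cayley Z)" using eq invertible_mult_iff by metis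
  then show False using u by (simp add: spectrum_def)
qed

text \<open>The unknown \<open>G\<close> does not change: a Lyapunov equation for \<open>Z\<close>
  and a Stein equation for \<open>cayley Z\<close> have the same solutions, up to conjugating the
  right-hand side.\<close>

lemma cayley_stein:
  fixes Z :: "complex^'n^'n"
  assumes Z: "spectrum Z \<subseteq> \<Pi>\<^sub>+"
  shows "G - cayley Z ** G ** (cayley Z)\<^sup>\<dagger>
    = mat 2 ** matrix_inv (Z + mat 1) ** (G ** Z\<^sup>\<dagger> + Z ** G) ** (matrix_inv (Z + mat 1))\<^sup>\<dagger>"
  by (rule mat_eqI) (simp add: mvec cayley_def ctr cayley_vec[OF Z] algebra_simps numeral_vec)

lemma cayley_stein_right:
  fixes Z :: "complex^'n^'n"
  assumes Z: "spectrum Z \<subseteq> \<Pi>\<^sub>+"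
  shows "G - (cayley Z)\<^sup>\<dagger> ** G ** cayley Z
    = mat 2 ** (matrix_inv (Z + mat 1))\<^sup>\<dagger> ** (G ** Z + Z\<^sup>\<dagger> ** G) ** matrix_inv (Z + mat 1)"
  by (rule mat_eqI) (simp add: mvec cayley_def ctr cayley_vec[OF Z] algebra_simps numeral_vec)

subsection \<open>Lyapunov equations\<close>

lemma lyapunov_unique:
  fixes Z :: "complex^'n^'n"
  assumes Z: "spectrum Z \<subseteq> \<Pi>\<^sub>+" and G: "G ** Z\<^sup>\<dagger> + Z ** G = 0"
  shows "G = 0"
proof (rule stein_unique)
  show "norm z < 1" if "z \<in> spectrum (cayley Z)" for z using spectrum_cayley[OF Z that] .
  show "G = cayley Z ** G ** (cayley Z)\<^sup>\<dagger>" using cayley_stein[OF Z, of G] G by simp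
qed

text \<open>The Lyapunov operator is linear on a finite-dimensional space and injective by
  uniqueness, hence onto. Real linearity is enough.\<close>

lemma lyapunov_ex1:
  fixes Z :: "complex^'n^'n"
  assumes Z: "spectrum Z \<subseteq> \<Pi>\<^sub>+"
  shows "\<exists>!G. G ** Z\<^sup>\<dagger> + Z ** G = D"
proof -
  let ?T = "\<lambda>G. G ** Z\<^sup>\<dagger> + Z ** G"
  have lin: "linear ?T"
  proof
    fix A B :: "complex^'n^'n" and r :: real
    show "?T (A + B) = ?T A + ?T B" by (rule mat_eqI) (simp add: mvec)
    show "?T (r *\<^sub>R A) = r *\<^sub>R ?T A"
      by (simp add: matrix_matrix_mult_def vec_eq_iff scaleR_sum_right algebra_simps)
  qed
  have inj: "inj ?T"
    unfolding linear_injective_0[OF lin] using lyapunov_unique[OF Z] by blast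
  then have "surj ?T" by (rule linear_injective_imp_surjective[OF lin]) (rule refl)
  then have "D \<in> range ?T" by simp
  then obtain G where "D = ?T G" by (rule rangeE)
  then show ?thesis by (intro ex1I[of _ G]) (auto dest: injD[OF inj])
qed

lemma pick_left_eq:
  assumes "spectrum Z \<subseteq> \<Pi>\<^sub>+"
  shows "pick_left Z X Y ** Z\<^sup>\<dagger> + Z ** pick_left Z X Y = X ** X\<^sup>\<dagger> - Y ** Y\<^sup>\<dagger>"
  unfolding pick_left_def by (rule theI', rule lyapunov_ex1[OF assms])

lemma pick_left_eqI:
  assumes "spectrum Z \<subseteq> \<Pi>\<^sub>+" "G ** Z\<^sup>\<dagger> + Z ** G = X ** X\<^sup>\<dagger> - Y ** Y\<^sup>\<dagger>"
  shows "pick_left Z X Y = G"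
  using lyapunov_ex1[OF assms(1)] pick_left_eq[OF assms(1)] assms(2) by metis

lemma pick_left_hermitian:
  assumes "spectrum Z \<subseteq> \<Pi>\<^sub>+"
  shows "(pick_left Z X Y)\<^sup>\<dagger> = pick_left Z X Y"
proof (rule pick_left_eqI[OF assms, symmetric])
  have "(pick_left Z X Y ** Z\<^sup>\<dagger> + Z ** pick_left Z X Y)\<^sup>\<dagger> = (X ** X\<^sup>\<dagger> - Y ** Y\<^sup>\<dagger>)\<^sup>\<dagger>"
    by (simp only: pick_left_eq[OF assms])
  then show "(pick_left Z X Y)\<^sup>\<dagger> ** Z\<^sup>\<dagger> + Z ** (pick_left Z X Y)\<^sup>\<dagger> = X ** X\<^sup>\<dagger> - Y ** Y\<^sup>\<dagger>"
    by (simp add: ctr add.commute)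
qed

text \<open>Right data are left data of the adjoint matrices; existence, uniqueness and symmetry of
  the right solution are inherited through this.\<close>

lemma pick_right_pick_left: "pick_right U V W = pick_left (W\<^sup>\<dagger>) (U\<^sup>\<dagger>) (V\<^sup>\<dagger>)"
  by (simp add: pick_right_def pick_left_def)

lemma spectrum_ctranspose_RHP: "spectrum W \<subseteq> \<Pi>\<^sub>+ \<Longrightarrow> spectrum (W\<^sup>\<dagger>) \<subseteq> \<Pi>\<^sub>+"
  by (auto simp: spectrum_ctranspose right_half_plane_def)

lemma pick_right_eq:
  assumes "spectrum W \<subseteq> \<Pi>\<^sub>+"
  shows "pick_right U V W ** W + W\<^sup>\<dagger> ** pick_right U V W = U\<^sup>\<dagger> ** U - V\<^sup>\<dagger> ** V"
  using pick_left_eq[OF spectrum_ctranspose_RHP[OF assms], of "U\<^sup>\<dagger>" "V\<^sup>\<dagger>"] by (simp add: pick_right_pick_left)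

lemma pick_right_eqI:
  assumes "spectrum W \<subseteq> \<Pi>\<^sub>+" "G ** W + W\<^sup>\<dagger> ** G = U\<^sup>\<dagger> ** U - V\<^sup>\<dagger> ** V"
  shows "pick_right U V W = G"
  using pick_left_eqI[OF spectrum_ctranspose_RHP[OF assms(1)], of G "U\<^sup>\<dagger>" "V\<^sup>\<dagger>"] assms(2)
  by (simp add: pick_right_pick_left)

lemma pick_right_hermitian:
  "spectrum W \<subseteq> \<Pi>\<^sub>+ \<Longrightarrow> (pick_right U V W)\<^sup>\<dagger> = pick_right U V W"
  by (simp add: pick_right_pick_left pick_left_hermitian spectrum_ctranspose_RHP)

subsection \<open>Necessity in the half-plane\<close>

definition interp_functions ::
  "complex^'z^'z \<Rightarrow> complex^'p^'z \<Rightarrow> complex^'m^'z \<Rightarrow> complex^'w^'m \<Rightarrow> complex^'w^'p \<Rightarrow>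
   complex^'w^'w \<Rightarrow> complex^'w^'z \<Rightarrow> (complex \<Rightarrow> complex^'m^'p) \<Rightarrow> (complex \<Rightarrow> complex^'m^'z) \<Rightarrow>
   (complex \<Rightarrow> complex^'w^'p) \<Rightarrow> (complex \<Rightarrow> complex^'w^'z) \<Rightarrow> bool"
  where "interp_functions Z X Y U V W \<Gamma> S H L K \<longleftrightarrow>
    mholo H \<Pi>\<^sub>+ \<and> mholo L \<Pi>\<^sub>+ \<and> mholo K \<Pi>\<^sub>+ \<and>
    (\<forall>z\<in>\<Pi>\<^sub>+. X ** S z - Y = (mat z - Z) ** H z \<and> S z ** U - V = L z ** (mat z - W) \<and>
       H z ** U - \<Gamma> = K z ** (mat z - W))"

lemma interp_functionsD:
  assumes "interp_functions Z X Y U V W \<Gamma> S H L K"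
  shows "mholo H \<Pi>\<^sub>+" "mholo L \<Pi>\<^sub>+" "mholo K \<Pi>\<^sub>+"
    "\<And>z. z \<in> \<Pi>\<^sub>+ \<Longrightarrow> X ** S z - Y = (mat z - Z) ** H z"
    "\<And>z. z \<in> \<Pi>\<^sub>+ \<Longrightarrow> S z ** U - V = L z ** (mat z - W)"
    "\<And>z. z \<in> \<Pi>\<^sub>+ \<Longrightarrow> H z ** U - \<Gamma> = K z ** (mat z - W)"
  using assms unfolding interp_functions_def by auto

lemma half_plane_necessity:
  fixes Z :: "complex^'z^'z" and X :: "complex^'p^'z" and Y :: "complex^'m^'z"
    and U :: "complex^'w^'m" and V :: "complex^'w^'p" and W :: "complex^'w^'w"
    and \<Gamma> :: "complex^'w^'z"
  assumes sZ: "spectrum Z \<subseteq> \<Pi>\<^sub>+" and sW: "spectrum W \<subseteq> \<Pi>\<^sub>+"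
    and S: "S \<in> schur_class" and F: "interp_functions Z X Y U V W \<Gamma> S H L K"
    and syl: "\<Gamma> ** W - Z ** \<Gamma> = X ** V - Y ** U"
  shows "0 \<le> inner x (pick_left Z X Y *v x) + inner y (pick_right U V W *v y) + 2 * inner x (\<Gamma> *v y)"
proof -
  define IZ IW where "IZ = matrix_inv (Z + mat 1)" and "IW = matrix_inv (W + mat 1)"
  define l where "l u = (1 + u) / (1 - u)" for u :: complex
  \<comment> \<open>The factor 2 in \<open>cayley_stein\<close> is split evenly between the two
    sides, so that the transformed data again satisfy equations of the same shape.\<close>
  define s where "s = complex_of_real (sqrt 2)"
  have ss: "s * s = 2" "cnj s = s" "s * (s * a) = 2 * a" for a
    by (simp_all add: s_def flip: of_real_mult mult.assoc)
  note vZ = cayley_vec[OF sZ, folded IZ_def] and vW = cayley_vec[OF sW, folded IW_def]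
  have l: "l u \<in> \<Pi>\<^sub>+" "u \<noteq> 1" "l u + 1 = 2 / (1 - u)" if "norm u < 1" for u
    using cayley_point[OF that] by (auto simp: l_def field_simps)
  have lh: "l holomorphic_on ball 0 1"
    unfolding l_def by (intro holomorphic_intros) auto
  have limg: "l ` ball 0 1 \<subseteq> \<Pi>\<^sub>+" using l by auto
  note comp = mholo_compose[OF _ lh limg]
  define Xt Yt Ut Vt where "Xt = mat s ** IZ ** X" and "Yt = mat s ** IZ ** Y"
    and "Ut = U ** IW ** mat s" and "Vt = V ** IW ** mat s"
  note defs = Xt_def Yt_def Ut_def Vt_def cayley_def IZ_def[symmetric] IW_def[symmetric]
  \<comment> \<open>The disc form has a minus sign at \<Gamma>; replacing \<open>x\<close> by
    \<open>-x\<close> restores the sign of the Pick matrix.\<close>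
  have "0 \<le> inner (-x) (pick_left Z X Y *v (-x)) + inner y (pick_right U V W *v y) - 2 * inner (-x) (\<Gamma> *v y)"
  proof (rule disc_necessity[where Z = "cayley Z" and W = "cayley W" and X = Xt and Y = Yt and U = Ut
        and V = Vt and S = "\<lambda>u. S (l u)" and H = "\<lambda>u. mat (s / (1 - u)) ** H (l u)"
        and L = "\<lambda>u. mat (s / (1 - u)) ** L (l u)"
        and K = "\<lambda>u. mat (1 / (1 - u)) ** \<Gamma> + mat (2 / (1 - u)^2) ** K (l u)"])
    show "norm z < 1" if "z \<in> spectrum (cayley Z)" for z using spectrum_cayley[OF sZ that] .
    show "norm z < 1" if "z \<in> spectrum (cayley W)" for z using spectrum_cayley[OF sW that] .
    show "mholo (\<lambda>u. S (l u)) (ball 0 1)" by (rule comp, rule schur_class_mholo[OF S])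
    show "norm (S (l u) *v v) \<le> norm v" if "norm u < 1" for u v
      using schur_class_le[OF S l(1)[OF that]] .
    note d = interp_functionsD[OF F]
    show "mholo (\<lambda>u. mat (s / (1 - u)) ** H (l u)) (ball 0 1)"
      "mholo (\<lambda>u. mat (s / (1 - u)) ** L (l u)) (ball 0 1)"
      "mholo (\<lambda>u. mat (1 / (1 - u)) ** \<Gamma> + mat (2 / (1 - u)^2) ** K (l u)) (ball 0 1)"
      by (intro mholo_intros mholo_mat comp d(1-3) holomorphic_intros; auto)+
    fix u :: complex assume u: "norm u < 1"
    define d where "d = 1 - u"
    have ud: "u = 1 - d" and d0: "d \<noteq> 0" using l(2)[OF u] by (auto simp: d_def)
    note lu = l(1)[OF u]
    have lu': "l u *s w = (2 / d) *s w - w" for w :: "complex^'k"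
      using l(3)[OF u] unfolding d_def by (metis add_diff_cancel_right' vector_sadd_rdistrib vector_smult_lid)
    show "Xt ** S (l u) - Yt = (mat u - cayley Z) ** (mat (s / (1 - u)) ** H (l u))"
    proof (rule mat_eqI)
      fix w
      have "X *v (S (l u) *v w) - Y *v w = l u *s (H (l u) *v w) - Z *v (H (l u) *v w)"
        using arg_cong[OF d(4)[OF lu], of "\<lambda>M. M *v w"] by (simp add: mvec)
      then have "s *s (IZ *v (X *v (S (l u) *v w) - Y *v w)) = s *s (IZ *v (l u *s (H (l u) *v w) - Z *v (H (l u) *v w)))"
        by simp
      then show "(Xt ** S (l u) - Yt) *v w = ((mat u - cayley Z) ** (mat (s / (1 - u)) ** H (l u))) *v w"
        using d0 by (simp add: mvec defs vZ lu' d_def[symmetric]) (simp add: ud vec_eq_iff field_simps)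
    qed
    show "S (l u) ** Ut - Vt = mat (s / (1 - u)) ** L (l u) ** (mat u - cayley W)"
    proof (rule mat_eqI)
      fix w
      have "S (l u) *v (U *v v) = V *v v + (l u *s (L (l u) *v v) - L (l u) *v (W *v v))" for v
        using arg_cong[OF d(5)[OF lu], of "\<lambda>M. M *v v"] by (simp add: mvec algebra_simps)
      then show "(S (l u) ** Ut - Vt) *v w = (mat (s / (1 - u)) ** L (l u) ** (mat u - cayley W)) *v w"
        using d0 by (simp add: mvec defs vW lu' d_def[symmetric]) (simp add: ud vec_eq_iff field_simps)
    qed
    \<comment> \<open>With \<open>u - cayley W\<close> = 2 \<open>IW\<close> - (1 - u), the constant
      \<Gamma> does not transform into itself: the difference 2 \<Gamma> \<open>IW\<close>/(1 - u) -
      \<Gamma> is \<Gamma>/(1 - u) times this pencil, hence the extra summand.\<close>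
    show "(mat (s / (1 - u)) ** H (l u)) ** Ut - \<Gamma> = (mat (1 / (1 - u)) ** \<Gamma> + mat (2 / (1 - u)^2) ** K (l u)) ** (mat u - cayley W)"
    proof (rule mat_eqI)
      fix w
      have "H (l u) *v (U *v v) = \<Gamma> *v v + (l u *s (K (l u) *v v) - K (l u) *v (W *v v))" for v
        using arg_cong[OF d(6)[OF lu], of "\<lambda>M. M *v v"] by (simp add: mvec algebra_simps)
      then show "((mat (s / (1 - u)) ** H (l u)) ** Ut - \<Gamma>) *v w = ((mat (1 / (1 - u)) ** \<Gamma> + mat (2 / (1 - u)^2) ** K (l u)) ** (mat u - cayley W)) *v w"
        using d0 by (simp add: mvec defs vW lu' ss d_def[symmetric]) (simp add: ud vec_eq_iff field_simps ss power2_eq_square)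
    qed
  next
    have *: "X *v (V *v w) = Y *v (U *v w) + \<Gamma> *v (W *v w) - Z *v (\<Gamma> *v w)" for w
      using arg_cong[OF syl, of "\<lambda>M. M *v w"] by (simp add: mvec algebra_simps)
    show "\<Gamma> ** cayley W - cayley Z ** \<Gamma> = Xt ** Vt - Yt ** Ut"
      by (rule mat_eqI) (simp add: mvec defs * vZ vW ss algebra_simps numeral_vec)
    show "pick_left Z X Y - cayley Z ** pick_left Z X Y ** (cayley Z)\<^sup>\<dagger> = Xt ** Xt\<^sup>\<dagger> - Yt ** Yt\<^sup>\<dagger>"
      unfolding cayley_stein[OF sZ] pick_left_eq[OF sZ] IZ_def[symmetric]
      by (rule mat_eqI) (simp add: mvec defs ctr ss)
    show "pick_right U V W - (cayley W)\<^sup>\<dagger> ** pick_right U V W ** cayley W = Ut\<^sup>\<dagger> ** Ut - Vt\<^sup>\<dagger> ** Vt"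
      unfolding cayley_stein_right[OF sW] pick_right_eq[OF sW] IW_def[symmetric]
      by (rule mat_eqI) (simp add: mvec defs ctr ss)
  qed
  then show ?thesis by (simp add: mvec)
qed

subsection \<open>Residues of matrix functions\<close>

lemma mholo_residue_sum:
  assumes "open s" "a \<in> s" "\<And>k. k \<in> I \<Longrightarrow> f k holomorphic_on s - {a}" "finite I"
  shows "residue (\<lambda>z. \<Sum>k\<in>I. f k z) a = (\<Sum>k\<in>I. residue (f k) a)"
  using assms(4,3)
proof (induction I rule: finite_induct)
  case empty
  show ?case using residue_const[of 0 a] by simp
next
  case (insert k I)
  have "residue (\<lambda>z. f k z + (\<Sum>k\<in>I. f k z)) a = residue (f k) a + residue (\<lambda>z. \<Sum>k\<in>I. f k z) a"
    using insert by (intro residue_add[OF assms(1,2)] holomorphic_intros) auto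
  then show ?case using insert by simp
qed

lemma mat_residue_add:
  assumes "open s" "a \<in> s" "mholo F (s - {a})" "mholo G (s - {a})"
  shows "mat_residue (\<lambda>z. F z + G z) a = mat_residue F a + mat_residue G a"
  using assms residue_add[OF assms(1,2)] by (simp add: mat_residue_def mholo_def vec_eq_iff)

lemma mat_residue_mult_const:
  assumes "open s" "a \<in> s" "mholo F (s - {a})"
  shows "mat_residue (\<lambda>z. F z ** C) a = mat_residue F a ** C"
    and "mat_residue (\<lambda>z. D ** F z) a = D ** mat_residue F a"
proof -
  have h: "(\<lambda>z. F z $ i $ k) holomorphic_on s - {a}" for i k using assms(3) by (simp add: mholo_def)
  have "residue (\<lambda>z. \<Sum>k\<in>UNIV. F z $ i $ k * C $ k $ j) a = (\<Sum>k\<in>UNIV. residue (\<lambda>z. F z $ i $ k) a * C $ k $ j)" for i j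
    by (subst mholo_residue_sum[OF assms(1,2)])
      (auto intro!: holomorphic_intros h sum.cong residue_rmul[OF assms(1,2)])
  then show "mat_residue (\<lambda>z. F z ** C) a = mat_residue F a ** C"
    by (simp add: mat_residue_def matrix_matrix_mult_def vec_eq_iff)
  have "residue (\<lambda>z. \<Sum>k\<in>UNIV. D $ i $ k * F z $ k $ j) a = (\<Sum>k\<in>UNIV. D $ i $ k * residue (\<lambda>z. F z $ k $ j) a)" for i j
    by (subst mholo_residue_sum[OF assms(1,2)])
      (auto intro!: holomorphic_intros h sum.cong residue_lmul[OF assms(1,2)])
  then show "mat_residue (\<lambda>z. D ** F z) a = D ** mat_residue F a"
    by (simp add: mat_residue_def matrix_matrix_mult_def vec_eq_iff)
qed

lemma mat_residue_holo: "open s \<Longrightarrow> a \<in> s \<Longrightarrow> mholo F s \<Longrightarrow> mat_residue F a = 0"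
  by (auto simp: mat_residue_def mholo_def vec_eq_iff intro: residue_holo)

lemma mat_residue_cong:
  assumes "open s" "a \<in> s" "\<And>z. z \<in> s - {a} \<Longrightarrow> F z = G z"
  shows "mat_residue F a = mat_residue G a"
proof -
  have "eventually (\<lambda>z. F z = G z) (at a)"
    using assms eventually_at_topological by blast
  then have "residue (\<lambda>z. F z $ i $ j) a = residue (\<lambda>z. G z $ i $ j) a" for i j
    by (intro residue_cong) (auto elim: eventually_mono)
  then show ?thesis by (simp add: mat_residue_def vec_eq_iff)
qed

lemma has_mean_sum:
  "finite I \<Longrightarrow> (\<And>k. k \<in> I \<Longrightarrow> has_mean t (f k) (c k)) \<Longrightarrow> has_mean t (\<lambda>z. \<Sum>k\<in>I. f k z) (\<Sum>k\<in>I. c k)"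
proof (induction I rule: finite_induct)
  case empty
  then show ?case by (simp add: has_mean_def)
qed (auto intro: has_mean_add)

lemma has_mean_entries:
  fixes C :: "complex^'m^'n"
  assumes "\<And>i j. has_mean t (\<lambda>u. F u $ i $ j) (C $ i $ j)"
  shows "has_mean t (\<lambda>u. inner x (F u *v y)) (inner x (C *v y))"
  unfolding mat_bilinear
  by (intro has_mean_linear[OF bounded_linear_Re] has_mean_sum)
    (auto intro!: has_mean_linear[OF bounded_linear_mult_left] has_mean_linear[OF bounded_linear_mult_right] assms)

lemma mat_residue_sum_mean:
  assumes "finite A" "A \<subseteq> ball 0 t" "t > 0" "mholo F (UNIV - A)"
  shows "has_mean t (\<lambda>u. inner x (u *s (F u *v y))) (inner x ((\<Sum>a\<in>A. mat_residue F a) *v y))"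
proof -
  have "has_mean t (\<lambda>u. inner x ((mat u ** F u) *v y)) (inner x ((\<Sum>a\<in>A. mat_residue F a) *v y))"
  proof (rule has_mean_entries)
    fix i j
    have "has_mean t (\<lambda>z. z * F z $ i $ j) (\<Sum>a\<in>A. residue (\<lambda>z. F z $ i $ j) a)"
      using assms unfolding mholo_def by (intro residue_sum_mean) auto
    moreover have "(mat z ** F z) $ i $ j = z * F z $ i $ j" for z
      by (simp add: matrix_matrix_mult_def mat_def if_distrib[where f="\<lambda>a. a * _"] cong: if_cong)
    ultimately show "has_mean t (\<lambda>u. (mat u ** F u) $ i $ j) ((\<Sum>a\<in>A. mat_residue F a) $ i $ j)"
      by (simp add: mat_residue_def)
  qed
  then show ?thesis by (simp add: mvec)
qed

lemma inner_mat_eqI: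
  fixes A B :: "complex^'n^'m"
  assumes "\<And>x y. inner x (A *v y) = inner x (B *v y)" shows "A = B"
proof (rule mat_eqI)
  fix y
  have "inner (A *v y - B *v y) (A *v y - B *v y) = 0"
    using assms[of "A *v y - B *v y" y] by (simp add: inner_diff_right[of "A *v y - B *v y"])
  then show "A *v y = B *v y" by simp
qed

lemma spectrum_radius:
  fixes Z :: "complex^'n^'n" and W :: "complex^'k^'k"
  obtains t where "t > 0" "spectrum Z \<union> spectrum W \<subseteq> ball 0 t"
proof -
  obtain b where b: "b > 0" "\<And>z. z \<in> spectrum Z \<Longrightarrow> norm z \<le> b"
    using spectrum_bounded[of Z] by auto
  obtain c where c: "c > 0" "\<And>z. z \<in> spectrum W \<Longrightarrow> norm z \<le> c"
    using spectrum_bounded[of W] by auto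
  show ?thesis
  proof (rule that[of "b + c"])
    have "norm z < b + c" if "z \<in> spectrum Z \<union> spectrum W" for z
      using that b(1) c(1) b(2)[of z] c(2)[of z] by fastforce
    then show "spectrum Z \<union> spectrum W \<subseteq> ball 0 (b + c)" by auto
  qed (use b c in simp)
qed

lemma mholo_res: "mholo (res Z) (- spectrum Z)"
  by (intro mholo_intros) (auto simp: spectrum_def)

text \<open>The sum is the mean of u times the resolvent over a circle around the spectrum, which
  \<open>has_mean_res\<close> evaluates.\<close>

lemma sum_residue_res:
  fixes Z :: "complex^'n^'n"
  shows "(\<Sum>a\<in>spectrum Z. mat_residue (res Z) a) = mat 1"
proof (rule inner_mat_eqI)
  fix x y :: "complex^'n"
  obtain t where t: "t > 0" "spectrum Z \<union> spectrum Z \<subseteq> ball 0 t" using spectrum_radius by blast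
  then have "has_mean t (\<lambda>u. inner x (u *s (res Z u *v y))) (inner x ((\<Sum>a\<in>spectrum Z. mat_residue (res Z) a) *v y))"
    using mholo_res[of Z] by (intro mat_residue_sum_mean) (auto simp: finite_spectrum Compl_eq_Diff_UNIV)
  moreover have "has_mean t (\<lambda>u. inner (u *s (res Z u *v y)) x) (inner y x)"
    using t by (intro has_mean_res) auto
  ultimately have "inner x ((\<Sum>a\<in>spectrum Z. mat_residue (res Z) a) *v y) = inner y x"
    by (simp only: inner_commute[of x] has_mean_unique)
  then show "inner x ((\<Sum>a\<in>spectrum Z. mat_residue (res Z) a) *v y) = inner x (mat 1 *v y)"
    by (simp add: inner_commute)
qed

text \<open>A product of two resolvents decays like u^{-2}, so it has no residue at infinity. On a
  large circle this is expressed by passing to adjoints: u times the product becomes a function that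
  is holomorphic inside and vanishes at 0.\<close>

lemma sum_residue_res_res:
  fixes Z :: "complex^'n^'n" and W :: "complex^'k^'k" and C :: "complex^'k^'n"
  shows "(\<Sum>a\<in>spectrum Z \<union> spectrum W. mat_residue (\<lambda>z. res Z z ** C ** res W z) a) = 0"
proof (rule inner_mat_eqI)
  fix x :: "complex^'n" and y :: "complex^'k"
  let ?M = "\<Sum>a\<in>spectrum Z \<union> spectrum W. mat_residue (\<lambda>z. res Z z ** C ** res W z) a"
  obtain t where t: "t > 0" "spectrum Z \<union> spectrum W \<subseteq> ball 0 t" using spectrum_radius by blast
  have "mholo (\<lambda>z. res Z z ** C ** res W z) (UNIV - (spectrum Z \<union> spectrum W))"
    by (intro mholo_mult mholo_const) (rule mholo_subset[OF mholo_res]; auto)+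
  then have "has_mean t (\<lambda>u. inner x (u *s ((res Z u ** C ** res W u) *v y))) (inner x (?M *v y))"
    using t by (intro mat_residue_sum_mean) (auto simp: finite_spectrum)
  moreover have "has_mean t (\<lambda>u. inner x (u *s ((res Z u ** C ** res W u) *v y))) 0"
  proof -
    have sZ: "\<And>z. z \<in> spectrum Z \<Longrightarrow> norm z < t" and sW: "\<And>z. z \<in> spectrum W \<Longrightarrow> norm z < t"
      using t by auto
    let ?F = "\<lambda>u. mat u ** adj_res t W u ** C\<^sup>\<dagger> ** mat ((of_real t)^2) ** adj_res t Z u"
    show ?thesis
    proof (rule has_mean_mholo_cong[where F = ?F and x = y and y = x])
      show "mholo ?F (cball 0 t)"
        using mholo_adj_res[of t Z] mholo_adj_res[of t W] t(1) sZ sW by (intro mholo_mult mholo_const mholo_id) auto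
      fix u :: complex assume u: "norm u = t"
      have cu: "cnj u * u = (of_real t)^2" using u complex_norm_square[of u] by (simp add: mult.commute)
      have 1: "(res Z u)\<^sup>\<dagger> = mat u ** adj_res t Z u" "(res W u)\<^sup>\<dagger> = mat u ** adj_res t W u"
        using resolvent_adjoint_circle(2)[of t Z u] resolvent_adjoint_circle(2)[of t W u] t(1) sZ sW u
        by (simp_all add: adj_res_def)
      have "inner x (u *s ((res Z u ** C ** res W u) *v y)) = inner (((res Z u ** C ** res W u)\<^sup>\<dagger>) *v (cnj u *s x)) y"
        by (simp only: inner_smult_right inner_ctranspose)
      also have "\<dots> = inner y (?F u *v x)"
        by (subst inner_commute) (simp add: ctr 1 mvec cu flip: cu, simp add: mult_ac)
      finally show "inner x (u *s ((res Z u ** C ** res W u) *v y)) = inner y (?F u *v x)" .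
    qed (use t in \<open>auto simp: mvec\<close>)
  qed
  ultimately have "inner x (?M *v y) = 0" by (rule has_mean_unique)
  then show "inner x (?M *v y) = inner x (0 *v y)" by simp
qed

subsection \<open>Division by a linear pencil\<close>

text \<open>Provides one Cauchy contour inside the half-plane that surrounds a whole spectrum: discs
  whose centres move out along the real axis exhaust the half-plane.\<close>

lemma finite_in_disc:
  fixes A :: "complex set"
  assumes "finite A" "A \<subseteq> \<Pi>\<^sub>+"
  obtains c r where "r > 0" "cball c r \<subseteq> \<Pi>\<^sub>+" "A \<subseteq> ball c r"
proof (cases "A = {}")
  case True
  have "cball 1 (1/2) \<subseteq> \<Pi>\<^sub>+"
  proof
    fix z :: complex assume z: "z \<in> cball 1 (1/2)"
    have "1 - Re z \<le> norm (1 - z)" using abs_Re_le_cmod[of "1 - z"] by simp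
    also have "\<dots> \<le> 1/2" using z by (simp add: dist_norm)
    finally show "z \<in> \<Pi>\<^sub>+" by (simp add: right_half_plane_def)
  qed
  then show ?thesis using True by (intro that[of "1/2" 1]) auto
next
  case False
  define b m where "b = Max (norm ` A)" and "m = Min (Re ` A)"
  have b: "norm a \<le> b" and m: "m \<le> Re a" if "a \<in> A" for a
    using that assms(1) by (auto simp: b_def m_def)
  have "m \<in> Re ` A" unfolding m_def using assms(1) False by (intro Min_in) auto
  then have m0: "m > 0" using assms(2) by (auto simp: right_half_plane_def)
  \<comment> \<open>The leftmost point of the disc is m/2 > 0. The choice of \<open>c\<close> makes
    c m = b^2 + m^2, whence |c - a|^2 is at most c^2 - c m - m^2 < r^2.\<close>
  define c r where "c = b^2 / m + m" and "r = c - m / 2"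
  have cm: "c * m = b^2 + m^2" using m0 by (simp add: c_def field_simps power2_eq_square)
  have c0: "c \<ge> m" using m0 by (simp add: c_def)
  show ?thesis
  proof (rule that[of r "of_real c"])
    show "r > 0" using c0 m0 by (simp add: r_def)
    show "cball (of_real c) r \<subseteq> \<Pi>\<^sub>+"
    proof
      fix z :: complex assume "z \<in> cball (of_real c) r"
      then have "c - Re z \<le> r" using abs_Re_le_cmod[of "of_real c - z"] by (auto simp: dist_norm)
      then show "z \<in> \<Pi>\<^sub>+" using m0 by (simp add: right_half_plane_def r_def)
    qed
    show "A \<subseteq> ball (of_real c) r"
    proof
      fix a assume a: "a \<in> A"
      have "(norm (of_real c - a))^2 = (norm a)^2 - 2 * c * Re a + c^2"
        by (simp only: cmod_power2) (simp add: power2_eq_square algebra_simps)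
      also have "\<dots> \<le> b^2 - 2 * c * m + c^2"
        using b[OF a] m[OF a] c0 m0 by (intro add_mono diff_mono power_mono mult_left_mono) auto
      also have "\<dots> < r^2"
      proof -
        have "r^2 = c^2 - c * m + m^2 / 4" by (simp add: r_def power2_eq_square algebra_simps)
        moreover have "m^2 > 0" using m0 by simp
        moreover have "2 * c * m = 2 * b^2 + 2 * m^2" using cm by simp
        ultimately show ?thesis using cm by linarith
      qed
      finally have "norm (of_real c - a) < r" 
        by (rule power_less_imp_less_base) (use c0 m0 in \<open>simp add: r_def\<close>)
      then show "a \<in> ball (of_real c) r" by (simp add: dist_norm)
    qed
  qed
qed

text \<open>Take for \<open>C\<close> the Cauchy integral of (u - Z)^{-1} F(u), and for
  \<open>H z\<close> that of the same function divided by u - z. The identity (z - Z)(u - Z)^{-1} =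
  1 - (u - z)(u - Z)^{-1} gives the division inside the contour, whatever the Jordan structure of
  \<open>Z\<close>.\<close>

lemma pencil_division:
  fixes Z :: "complex^'z^'z" and F :: "complex \<Rightarrow> complex^'m^'z"
  assumes Z: "spectrum Z \<subseteq> \<Pi>\<^sub>+" and F: "mholo F \<Pi>\<^sub>+"
  obtains C H where "mholo H \<Pi>\<^sub>+" "\<And>z. z \<in> \<Pi>\<^sub>+ \<Longrightarrow> F z - C = (mat z - Z) ** H z"
proof -
  obtain c r where r: "r > 0" "cball c r \<subseteq> \<Pi>\<^sub>+" "spectrum Z \<subseteq> ball c r"
    using finite_in_disc[OF finite_spectrum Z] by metis
  have sph: "sphere c r \<subseteq> \<Pi>\<^sub>+" "sphere c r \<subseteq> - spectrum Z" using r by auto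
  define g where "g u = res Z u ** F u" for u
  have g: "mholo g (sphere c r)" unfolding g_def
    by (intro mholo_mult mholo_subset[OF mholo_res sph(2)] mholo_subset[OF F sph(1)])
  have gc: "continuous_on (sphere c r) (\<lambda>u. g u $ i $ j)" for i j
    using g unfolding mholo_def by (blast intro: holomorphic_on_imp_continuous_on)
  define I where "I i j z = contour_integral (circlepath c r) (\<lambda>u. g u $ i $ j / (u - z))" for i j z
  have I: "((\<lambda>u. g u $ i $ j / (u - z)) has_contour_integral I i j z) (circlepath c r)" if "z \<in> ball c r" for i j z
    unfolding I_def
    by (intro has_contour_integral_integral contour_integrable_continuous_circlepath)
      (use that r in \<open>auto intro!: continuous_intros gc\<close>)
  have Iholo: "I i j holomorphic_on ball c r" for i j
  proof -
    have "(I i j has_field_derivative (of_nat 1 * contour_integral (circlepath c r) (\<lambda>u. g u $ i $ j / (u-w)^(Suc 1)))) (at w)"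
      if "w \<in> ball c r" for w
      using that r gc by (intro Cauchy_next_derivative_circlepath(2)[where k = 1]) (auto intro: I)
    then have "I i j field_differentiable (at w within ball c r)" if "w \<in> ball c r" for w
      using that unfolding field_differentiable_def by (blast intro: has_field_derivative_at_within)
    then show ?thesis by (simp add: holomorphic_on_def)
  qed
  define J where "J i j = contour_integral (circlepath c r) (\<lambda>u. g u $ i $ j)" for i j
  have J: "((\<lambda>u. g u $ i $ j) has_contour_integral J i j) (circlepath c r)" for i j
    unfolding J_def
    by (intro has_contour_integral_integral contour_integrable_continuous_circlepath)
      (use r in \<open>auto intro!: gc\<close>)
  define k where "k = 2 * of_real pi * \<i>"
  have k0: "k \<noteq> 0" by (simp add: k_def)
  define C :: "complex^'m^'z" where "C = (\<chi> i j. J i j / k)"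
  define H0 :: "complex \<Rightarrow> complex^'m^'z" where "H0 z = (\<chi> i j. I i j z / k)" for z
  have H0: "mholo H0 (ball c r)" using Iholo k0 unfolding mholo_def H0_def by (auto intro!: holomorphic_intros)
  have eq: "F z - C = (mat z - Z) ** H0 z" if z: "z \<in> ball c r" for z
  proof -
    have "(\<Sum>l\<in>UNIV. (mat z - Z) $ i $ l * I l j z) = k * F z $ i $ j - J i j" for i j
    proof (rule has_contour_integral_unique)
      show "((\<lambda>u. \<Sum>l\<in>UNIV. (mat z - Z) $ i $ l * (g u $ l $ j / (u - z))) has_contour_integral
          (\<Sum>l\<in>UNIV. (mat z - Z) $ i $ l * I l j z)) (circlepath c r)"
        by (intro has_contour_integral_sum has_contour_integral_lmul I z) auto
      have "((\<lambda>u. F u $ i $ j / (u - z)) has_contour_integral (k * F z $ i $ j)) (circlepath c r)"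
        unfolding k_def using F r(2) z unfolding mholo_def
        by (intro Cauchy_integral_circlepath_simple) (auto intro: holomorphic_on_subset simp: dist_norm norm_minus_commute)
      then have "((\<lambda>u. F u $ i $ j / (u - z) - g u $ i $ j) has_contour_integral (k * F z $ i $ j - J i j)) (circlepath c r)"
        by (intro has_contour_integral_diff J)
      moreover have "F u $ i $ j / (u - z) - g u $ i $ j = (\<Sum>l\<in>UNIV. (mat z - Z) $ i $ l * (g u $ l $ j / (u - z)))"
        if u: "u \<in> path_image (circlepath c r)" for u
      proof -
        have uz: "u \<noteq> z" "u \<in> sphere c r" using u z r(1) by auto
        then have "u \<notin> spectrum Z" using sph by auto
        then have "(mat z - Z) ** g u = F u - mat (u - z) ** g u"
          by (intro mat_eqI) (simp add: mvec g_def res_vec)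
        then have "((mat z - Z) ** g u) $ i $ j = (F u - mat (u - z) ** g u) $ i $ j" by simp
        moreover have "(mat (u - z) ** g u) $ i $ j = (u - z) * g u $ i $ j"
          by (simp add: matrix_matrix_mult_def mat_def if_distrib[where f="\<lambda>a. a * _"] cong: if_cong)
        ultimately have "(\<Sum>l\<in>UNIV. (mat z - Z) $ i $ l * g u $ l $ j) = F u $ i $ j - (u - z) * g u $ i $ j"
          by (simp add: matrix_matrix_mult_def)
        then show ?thesis using uz by (simp add: sum_divide_distrib[symmetric] field_simps)
      qed
      ultimately show "((\<lambda>u. \<Sum>l\<in>UNIV. (mat z - Z) $ i $ l * (g u $ l $ j / (u - z))) has_contour_integral
          (k * F z $ i $ j - J i j)) (circlepath c r)"
        by (rule has_contour_integral_eq)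
    qed
    note sum_eq = this
    have "((mat z - Z) ** H0 z) $ i $ j = (k * F z $ i $ j - J i j) / k" for i j
      unfolding sum_eq[symmetric] sum_divide_distrib by (simp add: matrix_matrix_mult_def H0_def)
    then show ?thesis using k0 by (simp add: vec_eq_iff C_def diff_divide_distrib)
  qed
  define H where "H z = (if z \<in> ball c r then H0 z else res Z z ** (F z - C))" for z
  \<comment> \<open>The integral formula and the quotient agree off the spectrum. Thus
    \<open>H\<close> is holomorphic on two open sets that together cover the half-plane.\<close>
  have H_alt: "H z = res Z z ** (F z - C)" if "z \<notin> spectrum Z" for z
  proof (cases "z \<in> ball c r")
    case True
    have "invertible (mat z - Z)" using that by (simp add: spectrum_def)
    then show ?thesis using True unfolding H_def
      by (simp add: eq matrix_mul_assoc matrix_inv_left')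
  qed (simp add: H_def)
  have "mholo H (ball c r)" using mholo_cong[of "ball c r" H H0] H0 by (simp add: H_def)
  moreover have "mholo H (\<Pi>\<^sub>+ - spectrum Z)"
  proof -
    have "mholo (\<lambda>z. res Z z ** (F z - C)) (\<Pi>\<^sub>+ - spectrum Z)"
      by (intro mholo_mult mholo_diff mholo_const mholo_subset[OF mholo_res] mholo_subset[OF F]) auto
    then show ?thesis using mholo_cong[of "\<Pi>\<^sub>+ - spectrum Z" H] H_alt by simp
  qed
  ultimately have "mholo H (ball c r \<union> (\<Pi>\<^sub>+ - spectrum Z))"
    using open_RHP finite_imp_closed[OF finite_spectrum[of Z]] unfolding mholo_def
    by (auto intro!: holomorphic_on_Un)
  moreover have "ball c r \<union> (\<Pi>\<^sub>+ - spectrum Z) = \<Pi>\<^sub>+" using r by auto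
  ultimately have "mholo H \<Pi>\<^sub>+" by simp
  moreover have "F z - C = (mat z - Z) ** H z" if "z \<in> \<Pi>\<^sub>+" for z
  proof (cases "z \<in> ball c r")
    case False
    then have "invertible (mat z - Z)" using r(3) by (auto simp: spectrum_def)
    then show ?thesis using False by (simp add: H_def matrix_mul_assoc matrix_inv_right')
  qed (simp add: eq H_def)
  ultimately show ?thesis by (rule that)
qed

lemma spectrum_transpose: "spectrum (transpose Z) = spectrum Z"
proof -
  have "mat z - transpose Z = transpose (mat z - Z)" for z
    by (simp add: vec_eq_iff transpose_def mat_def)
  then show ?thesis by (simp add: spectrum_def invertible_det_nz)
qed

lemma transpose_diff: "transpose (A - B) = transpose A - transpose (B :: complex^'m^'n)"
  by (simp add: vec_eq_iff transpose_def)

text \<open>Transposition reduces this to the left version; the adjoint would destroy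
  holomorphy.\<close>

lemma pencil_division_right:
  fixes W :: "complex^'w^'w" and F :: "complex \<Rightarrow> complex^'w^'p"
  assumes W: "spectrum W \<subseteq> \<Pi>\<^sub>+" and F: "mholo F \<Pi>\<^sub>+"
  obtains C L where "mholo L \<Pi>\<^sub>+" "\<And>z. z \<in> \<Pi>\<^sub>+ \<Longrightarrow> F z - C = L z ** (mat z - W)"
proof -
  have "spectrum (transpose W) \<subseteq> \<Pi>\<^sub>+" using W by (simp add: spectrum_transpose)
  from pencil_division[OF this mholo_transpose[OF F]]
  obtain C H where H: "mholo H \<Pi>\<^sub>+" "\<And>z. z \<in> \<Pi>\<^sub>+ \<Longrightarrow> transpose (F z) - C = (mat z - transpose W) ** H z"
    by metis
  have "F z - transpose C = transpose (H z) ** (mat z - W)" if "z \<in> \<Pi>\<^sub>+" for z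
    using arg_cong[OF H(2)[OF that], of transpose] by (simp add: transpose_diff matrix_transpose_mul)
  then show ?thesis by (rule that[OF mholo_transpose[OF H(1)]])
qed

subsection \<open>Point evaluations and division\<close>

text \<open>Near each eigenvalue \<open>res Z z ** F z\<close> differs from
  \<open>res Z z ** C\<close> by the holomorphic \<open>H\<close>, and the residues of the resolvent
  sum to the identity. So the constant in a division is the point evaluation.\<close>

lemma sum_mat_residue_left:
  fixes Z :: "complex^'z^'z" and F :: "complex \<Rightarrow> complex^'m^'z"
  assumes Z: "spectrum Z \<subseteq> \<Pi>\<^sub>+" and H: "mholo H \<Pi>\<^sub>+" "\<And>z. z \<in> \<Pi>\<^sub>+ \<Longrightarrow> F z - C = (mat z - Z) ** H z"
  shows "(\<Sum>a\<in>spectrum Z. mat_residue (\<lambda>z. res Z z ** F z) a) = C"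
proof -
  have "mat_residue (\<lambda>z. res Z z ** F z) a = mat_residue (res Z) a ** C" if a: "a \<in> spectrum Z" for a
  proof -
    let ?s = "\<Pi>\<^sub>+ - (spectrum Z - {a})"
    have s: "open ?s" "a \<in> ?s" "?s - {a} \<subseteq> \<Pi>\<^sub>+" "?s - {a} \<subseteq> - spectrum Z" "?s \<subseteq> \<Pi>\<^sub>+"
      using a Z open_RHP finite_imp_closed[of "spectrum Z - {a}"] by (auto simp: finite_spectrum)
    note m = mholo_subset[OF mholo_res s(4)]
    have "mat_residue (\<lambda>z. res Z z ** F z) a = mat_residue (\<lambda>z. res Z z ** C + H z) a"
    proof (rule mat_residue_cong[OF s(1,2)])
      fix z assume z: "z \<in> ?s - {a}"
      then have i: "invertible (mat z - Z)" using s(4) by (auto simp: spectrum_def)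
      have "F z = C + (mat z - Z) ** H z" using H(2)[of z] z by (simp add: algebra_simps)
      then show "res Z z ** F z = res Z z ** C + H z"
        by (simp add: matrix_add_ldistrib matrix_mul_assoc matrix_inv_left' i)
    qed
    also have "\<dots> = mat_residue (\<lambda>z. res Z z ** C) a + mat_residue H a"
      by (intro mat_residue_add[OF s(1,2)] mholo_mult mholo_const m mholo_subset[OF H(1) s(3)])
    also have "mat_residue H a = 0" by (rule mat_residue_holo[OF s(1,2) mholo_subset[OF H(1) s(5)]])
    also have "mat_residue (\<lambda>z. res Z z ** C) a = mat_residue (res Z) a ** C"
      by (rule mat_residue_mult_const[OF s(1,2) m])
    finally show ?thesis by simp
  qed
  then have "(\<Sum>a\<in>spectrum Z. mat_residue (\<lambda>z. res Z z ** F z) a) = (\<Sum>a\<in>spectrum Z. mat_residue (res Z) a ** C)"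
    by simp
  also have "\<dots> = (\<Sum>a\<in>spectrum Z. mat_residue (res Z) a) ** C"
    by (induction rule: finite_induct[OF finite_spectrum[of Z]]) (auto simp: mat_eq_vec mvec)
  finally show ?thesis by (simp add: sum_residue_res)
qed

text \<open>\<open>A\<close> may be larger than the spectrum of \<open>W\<close>, because the
  two-sided evaluation sums over both spectra; the additional residues are 0.\<close>

lemma sum_mat_residue_right:
  fixes W :: "complex^'w^'w" and F :: "complex \<Rightarrow> complex^'w^'p"
  assumes W: "spectrum W \<subseteq> \<Pi>\<^sub>+" and L: "mholo L \<Pi>\<^sub>+" "\<And>z. z \<in> \<Pi>\<^sub>+ \<Longrightarrow> F z - C = L z ** (mat z - W)"
    and A: "finite A" "spectrum W \<subseteq> A" "A \<subseteq> \<Pi>\<^sub>+"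
  shows "(\<Sum>a\<in>A. mat_residue (\<lambda>z. F z ** res W z) a) = C"
proof -
  have "mat_residue (\<lambda>z. F z ** res W z) a = C ** mat_residue (res W) a" if a: "a \<in> A" for a
  proof -
    let ?s = "\<Pi>\<^sub>+ - (spectrum W - {a})"
    have s: "open ?s" "a \<in> ?s" "?s - {a} \<subseteq> \<Pi>\<^sub>+" "?s - {a} \<subseteq> - spectrum W" "?s \<subseteq> \<Pi>\<^sub>+"
      using a A open_RHP finite_imp_closed[of "spectrum W - {a}"] by (auto simp: finite_spectrum)
    note m = mholo_subset[OF mholo_res s(4)]
    have "mat_residue (\<lambda>z. F z ** res W z) a = mat_residue (\<lambda>z. C ** res W z + L z) a"
    proof (rule mat_residue_cong[OF s(1,2)])
      fix z assume z: "z \<in> ?s - {a}"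
      then have i: "invertible (mat z - W)" using s(4) by (auto simp: spectrum_def)
      have "F z = C + L z ** (mat z - W)" using L(2)[of z] z by (simp add: algebra_simps)
      then show "F z ** res W z = C ** res W z + L z"
        by (intro mat_eqI) (simp add: mvec inv_vec(1)[OF i] flip: matrix_vector_mult_diff_rdistrib)
    qed
    also have "\<dots> = mat_residue (\<lambda>z. C ** res W z) a + mat_residue L a"
      by (intro mat_residue_add[OF s(1,2)] mholo_mult mholo_const m mholo_subset[OF L(1) s(3)])
    also have "mat_residue L a = 0" by (rule mat_residue_holo[OF s(1,2) mholo_subset[OF L(1) s(5)]])
    also have "mat_residue (\<lambda>z. C ** res W z) a = C ** mat_residue (res W) a"
      by (rule mat_residue_mult_const[OF s(1,2) m])
    finally show ?thesis by simp
  qed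
  then have "(\<Sum>a\<in>A. mat_residue (\<lambda>z. F z ** res W z) a) = (\<Sum>a\<in>A. C ** mat_residue (res W) a)"
    by simp
  also have "\<dots> = C ** (\<Sum>a\<in>A. mat_residue (res W) a)"
    by (induction rule: finite_induct[OF A(1)]) (auto simp: mat_eq_vec mvec)
  also have "(\<Sum>a\<in>A. mat_residue (res W) a) = (\<Sum>a\<in>spectrum W. mat_residue (res W) a)"
  proof (rule sum.mono_neutral_right[OF A(1,2)], rule ballI)
    fix a assume "a \<in> A - spectrum W"
    then show "mat_residue (res W) a = 0"
      by (intro mat_residue_holo[of "- spectrum W"])
        (auto simp: mholo_res finite_spectrum finite_imp_closed open_Compl)
  qed
  finally show ?thesis by (simp add: sum_residue_res)
qed

text \<open>Dividing by \<open>mat z - Z\<close> first splits the integrand into a product of two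
  resolvents around \<open>Y ** U\<close>, whose residues sum to 0, and
  \<open>H z ** U ** res W z\<close>, a right evaluation of \<open>H\<close>.\<close>

lemma left_right_eval_eq:
  assumes Z: "spectrum Z \<subseteq> \<Pi>\<^sub>+" and W: "spectrum W \<subseteq> \<Pi>\<^sub>+"
    and H: "mholo H \<Pi>\<^sub>+" "\<And>z. z \<in> \<Pi>\<^sub>+ \<Longrightarrow> X ** S z - Y = (mat z - Z) ** H z"
    and K: "mholo K \<Pi>\<^sub>+" "\<And>z. z \<in> \<Pi>\<^sub>+ \<Longrightarrow> H z ** U - C = K z ** (mat z - W)"
  shows "left_right_eval X S U Z W = C"
proof -
  let ?A = "spectrum Z \<union> spectrum W"
  have "mat_residue (\<lambda>z. res Z z ** X ** S z ** U ** res W z) a =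
      mat_residue (\<lambda>z. res Z z ** (Y ** U) ** res W z) a + mat_residue (\<lambda>z. (H z ** U) ** res W z) a"
    if a: "a \<in> ?A" for a
  proof -
    let ?s = "\<Pi>\<^sub>+ - (?A - {a})"
    have s: "open ?s" "a \<in> ?s" "?s - {a} \<subseteq> \<Pi>\<^sub>+" "?s - {a} \<subseteq> - spectrum Z" "?s - {a} \<subseteq> - spectrum W"
      using a Z W open_RHP finite_imp_closed[of "?A - {a}"] by (auto simp: finite_spectrum)
    have "mat_residue (\<lambda>z. res Z z ** X ** S z ** U ** res W z) a =
        mat_residue (\<lambda>z. res Z z ** (Y ** U) ** res W z + (H z ** U) ** res W z) a"
    proof (rule mat_residue_cong[OF s(1,2)])
      fix z assume z: "z \<in> ?s - {a}"
      then have i: "invertible (mat z - Z)" using s(4) by (auto simp: spectrum_def)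
      have "X *v (S z *v w) = Y *v w + (mat z - Z) *v (H z *v w)" for w
        using arg_cong[OF H(2)[of z], of "\<lambda>M. M *v w"] z by (simp add: mvec algebra_simps)
      then show "res Z z ** X ** S z ** U ** res W z = res Z z ** (Y ** U) ** res W z + (H z ** U) ** res W z"
        by (intro mat_eqI) (simp add: matrix_vector_mul_assoc[symmetric] matrix_vector_mult_add_rdistrib matrix_vector_right_distrib inv_vec(2)[OF i])
    qed
    also have "\<dots> = mat_residue (\<lambda>z. res Z z ** (Y ** U) ** res W z) a + mat_residue (\<lambda>z. (H z ** U) ** res W z) a"
      by (intro mat_residue_add[OF s(1,2)] mholo_mult mholo_const mholo_subset[OF mholo_res s(4)]
          mholo_subset[OF mholo_res s(5)] mholo_subset[OF H(1) s(3)])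
    finally show ?thesis .
  qed
  then have "left_right_eval X S U Z W = (\<Sum>a\<in>?A. mat_residue (\<lambda>z. res Z z ** (Y ** U) ** res W z) a) +
      (\<Sum>a\<in>?A. mat_residue (\<lambda>z. (H z ** U) ** res W z) a)"
    by (simp add: left_right_eval_def sum.distrib)
  also have "(\<Sum>a\<in>?A. mat_residue (\<lambda>z. (H z ** U) ** res W z) a) = C"
    by (rule sum_mat_residue_right[OF W K]) (use Z W in \<open>auto simp: finite_spectrum\<close>)
  finally show ?thesis by (simp add: sum_residue_res_res)
qed

lemma left_eval_eq:
  assumes "spectrum Z \<subseteq> \<Pi>\<^sub>+" "mholo H \<Pi>\<^sub>+" "\<And>z. z \<in> \<Pi>\<^sub>+ \<Longrightarrow> X ** S z - Y = (mat z - Z) ** H z"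
  shows "left_eval X S Z = Y"
  unfolding left_eval_def matrix_mul_assoc[symmetric]
  by (rule sum_mat_residue_left[OF assms])

lemma right_eval_eq:
  assumes "spectrum W \<subseteq> \<Pi>\<^sub>+" "mholo L \<Pi>\<^sub>+" "\<And>z. z \<in> \<Pi>\<^sub>+ \<Longrightarrow> S z ** U - V = L z ** (mat z - W)"
  shows "right_eval S U W = V"
  unfolding right_eval_def
  by (rule sum_mat_residue_right[OF assms finite_spectrum order.refl assms(1)])

text \<open>Division is always possible with some constants, and these constants are the three
  evaluations. Hence the conditions say exactly that they are \<open>Y\<close>, \<open>V\<close> and
  \<Gamma>.\<close>

lemma BTOA_interpolant_iff:
  assumes Z: "spectrum Z \<subseteq> \<Pi>\<^sub>+" and W: "spectrum W \<subseteq> \<Pi>\<^sub>+" and S: "mholo S \<Pi>\<^sub>+"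
  shows "BTOA_interpolant Z X Y U V W \<Gamma> S \<longleftrightarrow> (\<exists>H L K. interp_functions Z X Y U V W \<Gamma> S H L K)"
proof
  assume "\<exists>H L K. interp_functions Z X Y U V W \<Gamma> S H L K"
  then obtain H L K where F: "interp_functions Z X Y U V W \<Gamma> S H L K" by blast
  note d = interp_functionsD[OF F]
  show "BTOA_interpolant Z X Y U V W \<Gamma> S"
    unfolding BTOA_interpolant_def
    using left_eval_eq[OF Z d(1,4)] right_eval_eq[OF W d(2,5)] left_right_eval_eq[OF Z W d(1,4) d(3,6)] by simp
next
  assume B: "BTOA_interpolant Z X Y U V W \<Gamma> S"
  obtain C H where H: "mholo H \<Pi>\<^sub>+" "\<And>z. z \<in> \<Pi>\<^sub>+ \<Longrightarrow> X ** S z - C = (mat z - Z) ** H z"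
    using pencil_division[OF Z mholo_mult[OF mholo_const S]] by metis
  obtain D L where L: "mholo L \<Pi>\<^sub>+" "\<And>z. z \<in> \<Pi>\<^sub>+ \<Longrightarrow> S z ** U - D = L z ** (mat z - W)"
    using pencil_division_right[OF W mholo_mult[OF S mholo_const]] by metis
  obtain E K where K: "mholo K \<Pi>\<^sub>+" "\<And>z. z \<in> \<Pi>\<^sub>+ \<Longrightarrow> H z ** U - E = K z ** (mat z - W)"
    using pencil_division_right[OF W mholo_mult[OF H(1) mholo_const]] by metis
  have "C = Y" "D = V" "E = \<Gamma>"
    using B left_eval_eq[OF Z H] right_eval_eq[OF W L] left_right_eval_eq[OF Z W H K]
    by (auto simp: BTOA_interpolant_def)
  then show "\<exists>H L K. interp_functions Z X Y U V W \<Gamma> S H L K"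
    using H L K unfolding interp_functions_def by blast
qed

subsection \<open>The closed-loop system\<close>

text \<open>Here \<open>C1\<close> and \<open>C2\<close> are the block rows of $C$, so the Lyapunov equation is $PA + A^*P + C^*JC = 0$.
  The state \<open>xi\<close> of the closed loop satisfies $(\lambda - A) \xi = B (I + C_2 \xi)$ with $B$ = \<open>feedback G\<close>,
  and \<open>den\<close> is the inverse of the denominator of the linear-fractional formula.\<close>

locale state_space =
  fixes A P :: "complex^'n^'n" and C1 :: "complex^'n^'p" and C2 :: "complex^'n^'m"
  assumes lyapunov: "P ** A + A\<^sup>\<dagger> ** P = C2\<^sup>\<dagger> ** C2 - C1\<^sup>\<dagger> ** C1"
    and pos: "pos_definite P"
begin

lemma P_herm: "P\<^sup>\<dagger> = P" and P_pos: "v \<noteq> 0 \<Longrightarrow> inner v (P *v v) > 0"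
  using pos by (auto simp: pos_definite_def inner_commute)

lemma P_inv: "invertible P"
proof (rule invertible_kerI)
  fix x assume "P *v x = 0"
  then show "x = 0" using P_pos[of x] by auto
qed

lemma lyap_vec: "P *v (A *v x) = C2\<^sup>\<dagger> *v (C2 *v x) - C1\<^sup>\<dagger> *v (C1 *v x) - A\<^sup>\<dagger> *v (P *v x)"
  using arg_cong[OF lyapunov, of "\<lambda>M. M *v x"] by (simp add: mvec algebra_simps)

text \<open>The balance of the indefinite energy |f1|^2 - |f2|^2 with storage function
  \<open>inner w (P *v w)\<close>; it expresses the J-contractivity of \<Theta> on the
  half-plane.\<close>

lemma energy:
  assumes "P *v (z *s w - A *v w) = C1\<^sup>\<dagger> *v f1 - C2\<^sup>\<dagger> *v f2"
  shows "(norm (f1 - C1 *v w))^2 - (norm (f2 - C2 *v w))^2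
    = (norm f1)^2 - (norm f2)^2 - 2 * Re z * inner w (P *v w)"
proof -
  have "inner w (C1\<^sup>\<dagger> *v f1 - C2\<^sup>\<dagger> *v f2) = inner w (P *v (z *s w - A *v w))"
    using assms by simp
  also have "\<dots> = Re z * inner w (P *v w) - inner w (P *v (A *v w))"
    by (simp add: mvec inner_diff_right inner_hermitian_smult P_herm)
  finally have 1: "inner (C1 *v w) f1 - inner (C2 *v w) f2 = Re z * inner w (P *v w) - inner w (P *v (A *v w))"
    by (simp add: inner_diff_right inner_ctranspose)
  have "inner w (P *v (A *v w)) = (norm (C2 *v w))^2 - (norm (C1 *v w))^2 - inner w (A\<^sup>\<dagger> *v (P *v w))"
    unfolding lyap_vec by (simp add: inner_diff_right inner_ctranspose power2_norm_eq_inner)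
  moreover have "inner w (A\<^sup>\<dagger> *v (P *v w)) = inner w (P *v (A *v w))"
    using inner_ctranspose[of w "A\<^sup>\<dagger>" "P *v w"] inner_ctranspose[of "A *v w" P w] P_herm
      inner_commute[of "P *v (A *v w)" w] by simp
  ultimately have 2: "(norm (C2 *v w))^2 - (norm (C1 *v w))^2 = 2 * inner w (P *v (A *v w))" by simp
  have "(norm (f1 - C1 *v w))^2 = (norm f1)^2 - 2 * inner (C1 *v w) f1 + (norm (C1 *v w))^2"
    "(norm (f2 - C2 *v w))^2 = (norm f2)^2 - 2 * inner (C2 *v w) f2 + (norm (C2 *v w))^2"
    by (simp_all add: power2_norm_eq_inner inner_diff_left inner_diff_right inner_commute)
  then show ?thesis using 1 2 by (simp add: algebra_simps)
qed

definition feedback :: "complex^'m^'p \<Rightarrow> complex^'m^'n"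
  where "feedback G = matrix_inv P ** (C1\<^sup>\<dagger> ** G - C2\<^sup>\<dagger>)"

definition closed_loop :: "complex \<Rightarrow> complex^'m^'p \<Rightarrow> complex^'n^'n"
  where "closed_loop z G = mat z - A - feedback G ** C2"

definition xi :: "complex \<Rightarrow> complex^'m^'p \<Rightarrow> complex^'m^'n"
  where "xi z G = matrix_inv (closed_loop z G) ** feedback G"

definition den :: "complex \<Rightarrow> complex^'m^'p \<Rightarrow> complex^'m^'m"
  where "den z G = mat 1 + C2 ** xi z G"

definition sol :: "complex \<Rightarrow> complex^'m^'p \<Rightarrow> complex^'m^'p"
  where "sol z G = G ** den z G - C1 ** xi z G"

lemma P_feedback: "P *v (feedback G *v x) = C1\<^sup>\<dagger> *v (G *v x) - C2\<^sup>\<dagger> *v x"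
  by (simp add: feedback_def inv_vec(1)[OF P_inv] flip: matrix_vector_mul_assoc)
    (simp add: mvec)

text \<open>For a kernel vector the second component of the output in \<open>energy\<close> is 0, so
  the left side is nonnegative, whereas contractivity of \<open>G\<close> makes the right side at
  most -2 Re z \<open>inner w (P *v w)\<close>. Nothing is asked of z - A, so eigenvalues of
  \<open>A\<close> cause no poles.\<close>

lemma closed_loop_invertible:
  assumes z: "Re z > 0" and G: "\<And>v. norm (G *v v) \<le> norm v"
  shows "invertible (closed_loop z G)"
proof (rule invertible_kerI)
  fix w assume "closed_loop z G *v w = 0"
  then have "z *s w - A *v w = feedback G *v (C2 *v w)" by (simp add: closed_loop_def mvec)
  then have "P *v (z *s w - A *v w) = C1\<^sup>\<dagger> *v (G *v (C2 *v w)) - C2\<^sup>\<dagger> *v (C2 *v w)"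
    by (simp only: P_feedback)
  from energy[OF this] have "2 * Re z * inner w (P *v w) \<le> (norm (G *v (C2 *v w)))^2 - (norm (C2 *v w))^2"
    by simp (metis zero_le_power2 diff_ge_0_iff_ge)
  also have "\<dots> \<le> 0" using power_mono[OF G[of "C2 *v w"], of 2] by simp
  finally show "w = 0" using P_pos[of w] z by (smt (verit) mult_pos_pos)
qed

context
  fixes z :: complex and G :: "complex^'m^'p"
  assumes z: "Re z > 0" and G: "\<And>v. norm (G *v v) \<le> norm v"
begin

lemma closed_loop_vec: "z *s w - A *v w = closed_loop z G *v w + feedback G *v (C2 *v w)"
  by (simp add: closed_loop_def mvec)

lemma xi_state: "z *s (xi z G *v v) - A *v (xi z G *v v) = feedback G *v (den z G *v v)"
proof -
  have "closed_loop z G *v (xi z G *v v) = feedback G *v v"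
    by (simp add: xi_def inv_vec(1)[OF closed_loop_invertible[OF z G]] flip: matrix_vector_mul_assoc)
  then show ?thesis unfolding closed_loop_vec by (simp add: den_def mvec)
qed

lemma xi_P: "P *v (z *s (xi z G *v v) - A *v (xi z G *v v)) = C1\<^sup>\<dagger> *v (G *v (den z G *v v)) - C2\<^sup>\<dagger> *v (den z G *v v)"
  by (simp only: xi_state P_feedback)

text \<open>With inputs \<open>G *v (den z G *v v)\<close> and \<open>den z G *v v\<close>, the
  outputs in \<open>energy\<close> are \<open>sol z G *v v\<close> and \<open>v\<close>.\<close>

lemma sol_contractive: "norm (sol z G *v v) \<le> norm v"
proof -
  from energy[OF xi_P[of v]]
  have "(norm (sol z G *v v))^2 - (norm v)^2 =
      (norm (G *v (den z G *v v)))^2 - (norm (den z G *v v))^2 - 2 * Re z * inner (xi z G *v v) (P *v (xi z G *v v))"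
    by (simp add: sol_def den_def mvec)
  moreover have "0 \<le> inner w (P *v w)" for w using P_pos[of w] by (cases "w = 0") auto
  moreover have "(norm (G *v (den z G *v v)))^2 \<le> (norm (den z G *v v))^2" using G by (intro power_mono) auto
  ultimately have "(norm (sol z G *v v))^2 \<le> (norm v)^2" using z by (smt (verit) mult_nonneg_nonneg)
  then show ?thesis by (rule power2_le_imp_le) simp
qed

text \<open>The Lyapunov equation exchanges \<open>A\<close> for its adjoint, and \<open>G\<close>
  disappears in favour of \<open>sol\<close>. The left interpolation condition is the
  \<open>Z\<close> component of this equation.\<close>

lemma sol_state:
  "z *s (P *v (xi z G *v v)) + A\<^sup>\<dagger> *v (P *v (xi z G *v v)) = C1\<^sup>\<dagger> *v (sol z G *v v) - C2\<^sup>\<dagger> *v v"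
proof -
  have "z *s (P *v (xi z G *v v)) = P *v (A *v (xi z G *v v)) + C1\<^sup>\<dagger> *v (G *v (den z G *v v)) - C2\<^sup>\<dagger> *v (den z G *v v)"
    using xi_P[of v] by (simp add: mvec algebra_simps)
  then show ?thesis unfolding lyap_vec by (simp add: sol_def den_def mvec)
qed

text \<open>Off the spectrum of \<open>A\<close> the state is
  \<open>res A z ** feedback G ** den z G\<close>; inserting this in \<open>den\<close> and
  \<open>sol\<close> yields numerator and denominator of the linear-fractional formula.\<close>

lemma sol_lft:
  assumes "invertible (mat z - A)"
  shows "(mat 1 - C2 ** res A z ** feedback G) ** den z G = mat 1"
    and "(G - C1 ** res A z ** feedback G) ** den z G = sol z G"
proof -
  have x: "xi z G *v v = res A z *v (feedback G *v (den z G *v v))" for v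
    unfolding xi_state[symmetric] using inv_vec(2)[OF assms, of "xi z G *v v"] by (simp add: mvec)
  show "(mat 1 - C2 ** res A z ** feedback G) ** den z G = mat 1"
    by (rule mat_eqI) (simp add: matrix_vector_mul_assoc[symmetric] matrix_vector_mult_diff_rdistrib x[symmetric],
        simp add: den_def mvec)
  show "(G - C1 ** res A z ** feedback G) ** den z G = sol z G"
    by (rule mat_eqI) (simp add: matrix_vector_mul_assoc[symmetric] matrix_vector_mult_diff_rdistrib x[symmetric] sol_def)
qed

lemma xi_unique:
  assumes "\<And>v. z *s (x *v v) - A *v (x *v v) = feedback G *v (v + C2 *v (x *v v))"
  shows "x = xi z G"
proof (rule mat_eqI)
  fix v
  have "closed_loop z G *v (x *v v) = feedback G *v v"
    using assms[of v] unfolding closed_loop_vec by (simp add: mvec)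
  then show "x *v v = xi z G *v v"
    by (simp add: xi_def flip: matrix_vector_mul_assoc)
      (metis inv_vec(2)[OF closed_loop_invertible[OF z G]])
qed

end

lemma
  assumes G: "G \<in> schur_class"
  shows mholo_xi: "mholo (\<lambda>z. xi z (G z)) \<Pi>\<^sub>+"
    and sol_schur: "(\<lambda>z. sol z (G z)) \<in> schur_class"
    and mholo_inv_closed_loop: "mholo (\<lambda>z. matrix_inv (closed_loop z (G z))) \<Pi>\<^sub>+"
proof -
  note g = schur_class_mholo[OF G]
  have i: "invertible (closed_loop z (G z))" if "z \<in> \<Pi>\<^sub>+" for z
    using closed_loop_invertible schur_class_le[OF G that] that by (simp add: RHP_iff)
  have f: "mholo (\<lambda>z. feedback (G z)) \<Pi>\<^sub>+" unfolding feedback_def by (intro mholo_intros g)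
  show c: "mholo (\<lambda>z. matrix_inv (closed_loop z (G z))) \<Pi>\<^sub>+"
    using i by (intro mholo_inv) (auto simp: closed_loop_def intro!: mholo_diff mholo_mult mholo_id mholo_const f)
  show x: "mholo (\<lambda>z. xi z (G z)) \<Pi>\<^sub>+" unfolding xi_def by (intro mholo_mult c f)
  show "(\<lambda>z. sol z (G z)) \<in> schur_class"
  proof (rule schur_classI)
    show "mholo (\<lambda>z. sol z (G z)) \<Pi>\<^sub>+"
      unfolding sol_def den_def by (intro mholo_diff mholo_add mholo_mult mholo_const g x)
    show "norm (sol z (G z) *v v) \<le> norm v" if "z \<in> \<Pi>\<^sub>+" for z v
      using sol_contractive[of z "G z" v] schur_class_le[OF G that] that by (simp add: RHP_iff)
  qed
qed

definition inv_num :: "complex^'m^'p \<Rightarrow> complex^'m^'n \<Rightarrow> complex^'m^'p"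
  where "inv_num S x = S + C1 ** x"

definition inv_den :: "complex^'m^'n \<Rightarrow> complex^'m^'m"
  where "inv_den x = mat 1 + C2 ** x"

text \<open>The inverse of the linear-fractional map: \<open>[S; I] + C \<xi>\<close> recovers the parameter up to a
  right factor.\<close>

context
  fixes z :: complex and S :: "complex^'m^'p" and x :: "complex^'m^'n"
  assumes st: "\<And>v. z *s (P *v (x *v v)) + A\<^sup>\<dagger> *v (P *v (x *v v)) = C1\<^sup>\<dagger> *v (S *v v) - C2\<^sup>\<dagger> *v v"
begin

lemma inverse_state:
  "P *v (z *s (x *v v) - A *v (x *v v)) = C1\<^sup>\<dagger> *v (inv_num S x *v v) - C2\<^sup>\<dagger> *v (inv_den x *v v)"
proof -
  have "P *v (z *s (x *v v)) = C1\<^sup>\<dagger> *v (S *v v) - C2\<^sup>\<dagger> *v v - A\<^sup>\<dagger> *v (P *v (x *v v))"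
    using st[of v] by (simp add: mat_vec_scale algebra_simps)
  then show ?thesis
    by (simp add: matrix_vector_mult_diff_distrib lyap_vec inv_num_def inv_den_def) (simp add: mvec)
qed

lemma inverse_energy:
  "(norm (S *v v))^2 - (norm v)^2 = (norm (inv_num S x *v v))^2 - (norm (inv_den x *v v))^2
     - 2 * Re z * inner (x *v v) (P *v (x *v v))"
  using energy[OF inverse_state[of v]] by (simp add: inv_num_def inv_den_def mvec)

text \<open>A kernel vector of the denominator is also one of the numerator, so the state solves the
  homogeneous equation, vanishes, and leaves \<open>inv_den x *v v\<close> =
  \<open>v\<close>.\<close>

lemma inv_den_invertible:
  assumes i: "invertible (mat z - A)" and le: "\<And>v. norm (inv_num S x *v v) \<le> norm (inv_den x *v v)"
  shows "invertible (inv_den x)"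
proof (rule invertible_kerI)
  fix v assume v: "inv_den x *v v = 0"
  then have n: "inv_num S x *v v = 0" using le[of v] by simp
  have "P *v (z *s (x *v v) - A *v (x *v v)) = 0" using inverse_state[of v] v n by simp
  then have "z *s (x *v v) - A *v (x *v v) = 0" by (rule invertible_ker[OF P_inv])
  then have "(mat z - A) *v (x *v v) = 0" by (simp add: mvec)
  then have "x *v v = 0" by (rule invertible_ker[OF i])
  then show "v = 0" using v by (simp add: inv_den_def mvec)
qed

lemma inverse_feedback:
  assumes "inv_num S x = G ** inv_den x"
  shows "z *s (x *v v) - A *v (x *v v) = feedback G *v (v + C2 *v (x *v v))"
proof -
  have "P *v (z *s (x *v v) - A *v (x *v v)) = P *v (feedback G *v (inv_den x *v v))"
    unfolding inverse_state P_feedback by (simp add: assms mvec)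
  then have "z *s (x *v v) - A *v (x *v v) = feedback G *v (inv_den x *v v)"
    by (metis inv_vec(2)[OF P_inv])
  then show ?thesis by (simp add: inv_den_def mvec)
qed

end

end

subsection \<open>Block matrices through the two inclusions\<close>

text \<open>The isometric inclusions of the two summands. Writing block matrices as sums of products
  with them makes block computations accessible to \<open>mvec\<close>.\<close>

definition incl :: "complex^'a^('a::finite + 'b::finite)"
  where "incl = (\<chi> i j. case i of Inl a \<Rightarrow> if a = j then 1 else 0 | Inr b \<Rightarrow> 0)"

definition incr :: "complex^'b^('a::finite + 'b::finite)"
  where "incr = (\<chi> i j. case i of Inl a \<Rightarrow> 0 | Inr b \<Rightarrow> if b = j then 1 else 0)"

lemma sum_UNIV_sum_type: "(\<Sum>i\<in>UNIV. f i) = (\<Sum>a\<in>UNIV. f (Inl a)) + (\<Sum>b\<in>UNIV. f (Inr b))"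
  for f :: "'a::finite + 'b::finite \<Rightarrow> 'c::comm_monoid_add"
  using sum.Plus[of "UNIV :: 'a set" "UNIV :: 'b set" f] by (simp add: UNIV_Plus_UNIV o_def)

lemma all_sum_type: "(\<forall>i::'a + 'b. Q i) \<longleftrightarrow> (\<forall>a. Q (Inl a)) \<and> (\<forall>b. Q (Inr b))"
  by (metis sum.exhaust)

lemma incl_nth [simp]:
  "(incl *v x) $ Inl a = x $ a" "(incl *v x) $ Inr b = 0"
  "(incr *v y) $ Inl a = 0" "(incr *v y) $ Inr b = y $ b"
  by (simp_all add: incl_def incr_def matrix_vector_mult_def if_distrib[where f="\<lambda>a. a * _"] cong: if_cong)

lemma incl_ctranspose_nth [simp]:
  fixes w :: "complex^('a::finite + 'b::finite)"
  shows "(incl\<^sup>\<dagger> *v w) $ a = w $ Inl a" "(incr\<^sup>\<dagger> *v w) $ b = w $ Inr b"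
  by (simp_all add: incl_def incr_def matrix_vector_mult_def ctranspose_nth sum_UNIV_sum_type
      if_distrib[where f=cnj] if_distrib[where f="\<lambda>a. a * _"] cong: if_cong)

lemma incl_simps [simp]:
  "incl\<^sup>\<dagger> *v (incl *v x) = x" "incr\<^sup>\<dagger> *v (incr *v y) = y"
  "incl\<^sup>\<dagger> *v (incr *v y) = 0" "incr\<^sup>\<dagger> *v (incl *v x) = 0"
  by (simp_all add: vec_eq_iff)

lemma incl_decomp: "incl *v (incl\<^sup>\<dagger> *v w) + incr *v (incr\<^sup>\<dagger> *v w) = w"
  by (simp add: vec_eq_iff all_sum_type)

lemma mult_incl_nth:
  "(M *v (incl\<^sup>\<dagger> *v w)) $ i = (\<Sum>a\<in>UNIV. M $ i $ a * w $ Inl a)"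
  "(N *v (incr\<^sup>\<dagger> *v w)) $ i = (\<Sum>b\<in>UNIV. N $ i $ b * w $ Inr b)"
  by (subst matrix_vector_mult_def, simp)+

lemma block_matrix_incl:
  "block_matrix A B C D = incl ** A ** incl\<^sup>\<dagger> + incl ** B ** incr\<^sup>\<dagger> + incr ** C ** incl\<^sup>\<dagger> + incr ** D ** incr\<^sup>\<dagger>"
proof (rule mat_eqI)
  fix w
  show "block_matrix A B C D *v w =
    (incl ** A ** incl\<^sup>\<dagger> + incl ** B ** incr\<^sup>\<dagger> + incr ** C ** incl\<^sup>\<dagger> + incr ** D ** incr\<^sup>\<dagger>) *v w"
    by (simp add: mvec vec_eq_iff all_sum_type mult_incl_nth)
      (simp add: block_matrix_def matrix_vector_mult_def sum_UNIV_sum_type)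
qed

lemma mat_vec_axis: "(M *v axis j 1) $ i = (M $ i $ j :: complex)"
  by (simp add: matrix_vector_mult_def axis_def if_distrib[where f="\<lambda>a. _ * a"] cong: if_cong)

lemma incl_axis: "incl *v axis j 1 = axis (Inl j) 1" "incr *v axis k 1 = axis (Inr k) 1"
  by (simp_all add: vec_eq_iff all_sum_type axis_def)

lemma blocks_incl:
  "block11 M = incl\<^sup>\<dagger> ** M ** incl" "block12 M = incl\<^sup>\<dagger> ** M ** incr"
  "block21 M = incr\<^sup>\<dagger> ** M ** incl" "block22 M = incr\<^sup>\<dagger> ** M ** incr"
  by (simp_all add: vec_eq_iff block11_def block12_def block21_def block22_def flip: mat_vec_axis)
    (simp_all add: mvec incl_axis mat_vec_axis)

lemma inner_incl:
  "inner (incl *v x) (incl *v x') = inner x x'" "inner (incr *v y) (incr *v y') = inner y y'"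
  "inner (incl *v x) (incr *v y) = 0" "inner (incr *v y) (incl *v x) = 0"
  by (simp_all add: ctranspose_inner)

subsection \<open>The state space of the interpolation problem\<close>

locale btoa =
  fixes Z :: "complex^'z^'z" and X :: "complex^'p^'z" and Y :: "complex^'m^'z"
    and U :: "complex^'w^'m" and V :: "complex^'w^'p" and W :: "complex^'w^'w"
    and \<Gamma> :: "complex^'w^'z"
  assumes sZ: "spectrum Z \<subseteq> \<Pi>\<^sub>+" and sW: "spectrum W \<subseteq> \<Pi>\<^sub>+"
    and syl: "\<Gamma> ** W - Z ** \<Gamma> = X ** V - Y ** U"
begin

abbreviation "GL \<equiv> pick_left Z X Y"
abbreviation "GR \<equiv> pick_right U V W"
abbreviation "P \<equiv> pick_matrix Z X Y U V W \<Gamma>"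

text \<open>\<open>A\<close> is the block diagonal matrix of \<open>- Z\<^sup>\<dagger>\<close> and
  \<open>W\<close>, and \<open>C1\<close>, \<open>C2\<close> are the block rows of the left factor
  in \<Theta>; only \<open>W\<close> contributes eigenvalues in the half-plane.\<close>

definition "A = incr ** W ** incr\<^sup>\<dagger> - incl ** Z\<^sup>\<dagger> ** incl\<^sup>\<dagger>"
definition "C1 = V ** incr\<^sup>\<dagger> - X\<^sup>\<dagger> ** incl\<^sup>\<dagger>"
definition "C2 = U ** incr\<^sup>\<dagger> - Y\<^sup>\<dagger> ** incl\<^sup>\<dagger>"

lemma P_eq: "P = incl ** GL ** incl\<^sup>\<dagger> + incl ** \<Gamma> ** incr\<^sup>\<dagger> + incr ** \<Gamma>\<^sup>\<dagger> ** incl\<^sup>\<dagger> + incr ** GR ** incr\<^sup>\<dagger>"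
  by (simp add: pick_matrix_def block_matrix_incl)

lemma P_hermitian: "P\<^sup>\<dagger> = P"
  unfolding P_eq by (rule mat_eqI) (simp add: ctr mvec pick_left_hermitian sZ pick_right_hermitian sW algebra_simps)

lemma P_form: "inner (incl *v x + incr *v y) (P *v (incl *v x + incr *v y)) =
    inner x (GL *v x) + inner y (GR *v y) + 2 * inner x (\<Gamma> *v y)"
proof -
  have "inner y (\<Gamma>\<^sup>\<dagger> *v x) = inner x (\<Gamma> *v y)"
    using ctranspose_inner[of \<Gamma> y x] by (simp add: inner_commute)
  then show ?thesis
    by (simp add: P_eq mvec inner_add_left inner_add_right inner_incl)
qed

lemma P_psd_iff: "pos_semidefinite P \<longleftrightarrow> (\<forall>x y. 0 \<le> inner x (GL *v x) + inner y (GR *v y) + 2 * inner x (\<Gamma> *v y))"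
  unfolding pos_semidefinite_def P_form[symmetric] using P_hermitian incl_decomp inner_commute by metis

lemma syl_vec: "\<Gamma> *v (W *v w) = Z *v (\<Gamma> *v w) + X *v (V *v w) - Y *v (U *v w)"
  "W\<^sup>\<dagger> *v (\<Gamma>\<^sup>\<dagger> *v x) = \<Gamma>\<^sup>\<dagger> *v (Z\<^sup>\<dagger> *v x) + V\<^sup>\<dagger> *v (X\<^sup>\<dagger> *v x) - U\<^sup>\<dagger> *v (Y\<^sup>\<dagger> *v x)"
  using arg_cong[OF syl, of "\<lambda>M. M *v w"] arg_cong[OF arg_cong[OF syl, of ctranspose], of "\<lambda>M. M *v x"]
  by (simp_all add: ctr mvec algebra_simps)

lemma GL_vec: "GL *v (Z\<^sup>\<dagger> *v x) = X *v (X\<^sup>\<dagger> *v x) - Y *v (Y\<^sup>\<dagger> *v x) - Z *v (GL *v x)"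
  using arg_cong[OF pick_left_eq[OF sZ, of X Y], of "\<lambda>M. M *v x"] by (simp add: mvec algebra_simps)

lemma GR_vec: "GR *v (W *v x) = U\<^sup>\<dagger> *v (U *v x) - V\<^sup>\<dagger> *v (V *v x) - W\<^sup>\<dagger> *v (GR *v x)"
  using arg_cong[OF pick_right_eq[OF sW, of U V], of "\<lambda>M. M *v x"] by (simp add: mvec algebra_simps)

text \<open>The diagonal blocks are the two Lyapunov equations of the Pick matrix, the off-diagonal
  ones the Sylvester equation and its adjoint.\<close>

lemma P_lyapunov: "P ** A + A\<^sup>\<dagger> ** P = C2\<^sup>\<dagger> ** C2 - C1\<^sup>\<dagger> ** C1"
  by (rule mat_eqI)
    (simp add: P_eq A_def C1_def C2_def ctr mvec syl_vec GL_vec GR_vec algebra_simps)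

lemma invertible_A:
  assumes "z \<in> \<Pi>\<^sub>+" "z \<notin> spectrum W"
  shows "invertible (mat z - A)"
proof (rule invertible_kerI)
  fix x assume x: "(mat z - A) *v x = 0"
  have "- z \<notin> spectrum (Z\<^sup>\<dagger>)" using spectrum_ctranspose_RHP[OF sZ] assms(1) by (auto simp: right_half_plane_def)
  then have 1: "invertible (mat (- z) - Z\<^sup>\<dagger>)" by (simp add: spectrum_def)
  have 2: "invertible (mat z - W)" using assms(2) by (simp add: spectrum_def)
  have "incl\<^sup>\<dagger> *v ((mat z - A) *v x) = 0" "incr\<^sup>\<dagger> *v ((mat z - A) *v x) = 0" by (simp_all add: x)
  then have a: "z *s (incl\<^sup>\<dagger> *v x) + Z\<^sup>\<dagger> *v (incl\<^sup>\<dagger> *v x) = 0" and b: "z *s (incr\<^sup>\<dagger> *v x) - W *v (incr\<^sup>\<dagger> *v x) = 0"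
    by (simp_all add: A_def mvec)
  have "(mat (- z) - Z\<^sup>\<dagger>) *v (incl\<^sup>\<dagger> *v x) = - (z *s (incl\<^sup>\<dagger> *v x) + Z\<^sup>\<dagger> *v (incl\<^sup>\<dagger> *v x))"
    by (simp add: mvec)
  then have "(mat (- z) - Z\<^sup>\<dagger>) *v (incl\<^sup>\<dagger> *v x) = 0" "(mat z - W) *v (incr\<^sup>\<dagger> *v x) = 0"
    using a b by (simp_all add: matrix_vector_mult_diff_rdistrib)
  then have "incl\<^sup>\<dagger> *v x = 0" "incr\<^sup>\<dagger> *v x = 0"
    using invertible_ker[OF 1] invertible_ker[OF 2] by auto
  then show "x = 0" using incl_decomp[of x] by simp
qed

end

locale btoa_pos = btoa Z X Y U V W \<Gamma>
  for Z :: "complex^'z^'z" and X :: "complex^'p^'z" and Y :: "complex^'m^'z"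
    and U :: "complex^'w^'m" and V :: "complex^'w^'p" and W :: "complex^'w^'w"
    and \<Gamma> :: "complex^'w^'z" +
  assumes P_posdef: "pos_definite P"
begin

sublocale state_space A P C1 C2
  by unfold_locales (rule P_lyapunov P_posdef)+

abbreviation "\<Theta> \<equiv> BTOA_Theta Z X Y U V W \<Gamma>"

lemma Theta_eq: "\<Theta> z = mat 1 + (incl ** C1 + incr ** C2) ** res A z ** matrix_inv P ** (C2\<^sup>\<dagger> ** incr\<^sup>\<dagger> - C1\<^sup>\<dagger> ** incl\<^sup>\<dagger>)"
proof -
  have 1: "block_matrix (mat 1) 0 0 (mat 1) = mat 1"
    by (rule mat_eqI) (simp add: block_matrix_incl mvec incl_decomp)
  have 2: "block_matrix (- (X\<^sup>\<dagger>)) V (- (Y\<^sup>\<dagger>)) U = incl ** C1 + incr ** C2"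
    by (rule mat_eqI) (simp add: block_matrix_incl mvec C1_def C2_def algebra_simps)
  have 3: "block_matrix (mat z + Z\<^sup>\<dagger>) 0 0 (mat z - W) = mat z - A"
  proof (rule mat_eqI)
    fix x :: "complex^('z + 'w)"
    have "z *s x = z *s (incl *v (incl\<^sup>\<dagger> *v x)) + z *s (incr *v (incr\<^sup>\<dagger> *v x))"
      using incl_decomp[of x] by (simp only: vector_add_ldistrib[symmetric])
    then show "block_matrix (mat z + Z\<^sup>\<dagger>) 0 0 (mat z - W) *v x = (mat z - A) *v x"
      by (simp add: block_matrix_incl mvec A_def algebra_simps)
  qed
  have 4: "block_matrix X (- Y) (- (V\<^sup>\<dagger>)) (U\<^sup>\<dagger>) = C2\<^sup>\<dagger> ** incr\<^sup>\<dagger> - C1\<^sup>\<dagger> ** incl\<^sup>\<dagger>"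
    by (rule mat_eqI) (simp add: block_matrix_incl ctr mvec C1_def C2_def algebra_simps)
  show ?thesis unfolding BTOA_Theta_def 1 2 3 4 ..
qed

lemma lft_denominator_eq: "lft_denominator (\<Theta> z) G = mat 1 - C2 ** res A z ** feedback G"
  by (rule mat_eqI) (simp add: lft_denominator_def blocks_incl Theta_eq feedback_def ctr mvec algebra_simps)

lemma lft_numerator_eq: "block11 (\<Theta> z) ** G + block12 (\<Theta> z) = G - C1 ** res A z ** feedback G"
  by (rule mat_eqI) (simp add: blocks_incl Theta_eq feedback_def ctr mvec algebra_simps)

lemma
  assumes G: "G \<in> schur_class" and z: "z \<in> \<Pi>\<^sub>+" "z \<notin> spectrum W"
  shows invertible_lft_denominator: "invertible (lft_denominator (\<Theta> z) (G z))"
    and lft_eq_sol: "lft (\<Theta> z) (G z) = sol z (G z)"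
proof -
  have *: "Re z > 0" "\<And>v. norm (G z *v v) \<le> norm v"
    using z(1) schur_class_le[OF G] by (auto simp: RHP_iff)
  note s = sol_lft[OF * invertible_A[OF z]]
  have "lft_denominator (\<Theta> z) (G z) ** den z (G z) = mat 1"
    unfolding lft_denominator_eq by (rule s(1))
  note m = matrix_inv_eqI[OF this]
  from m(2) show "invertible (lft_denominator (\<Theta> z) (G z))" .
  show "lft (\<Theta> z) (G z) = sol z (G z)"
    unfolding lft_def m(1) lft_numerator_eq by (rule s(2))
qed

lemma sol_interp:
  assumes G: "G \<in> schur_class"
  shows "\<exists>H L K. interp_functions Z X Y U V W \<Gamma> (\<lambda>z. sol z (G z)) H L K"
proof -
  define \<Psi> where "\<Psi> z = matrix_inv (closed_loop z (G z)) ** (incr :: complex^'w^('z+'w))" for z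
  \<comment> \<open>Minus the upper block of \<open>P ** xi\<close>, since the upper block of
    \<open>sol_state\<close> is the left division identity.\<close>
  define H where "H z = - (incl\<^sup>\<dagger> ** P ** xi z (G z))" for z
  define L where "L z = (G z ** C2 - C1) ** \<Psi> z" for z
  define K where "K z = - (incl\<^sup>\<dagger> ** P ** \<Psi> z)" for z
  have \<Psi>h: "mholo \<Psi> \<Pi>\<^sub>+" unfolding \<Psi>_def by (intro mholo_mult mholo_const mholo_inv_closed_loop G)
  have "mholo H \<Pi>\<^sub>+" "mholo L \<Pi>\<^sub>+" "mholo K \<Pi>\<^sub>+"
    unfolding H_def L_def K_def
    by (intro mholo_uminus mholo_diff mholo_mult mholo_const mholo_xi \<Psi>h G schur_class_mholo)+
  moreover have "X ** sol z (G z) - Y = (mat z - Z) ** H z \<and> sol z (G z) ** U - V = L z ** (mat z - W) \<and>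
       H z ** U - \<Gamma> = K z ** (mat z - W)" if z: "z \<in> \<Pi>\<^sub>+" for z
  proof (intro conjI mat_eqI)
    have *: "Re z > 0" "\<And>v. norm (G z *v v) \<le> norm v"
      using z(1) schur_class_le[OF G] by (auto simp: RHP_iff)
    fix v
    have "incl\<^sup>\<dagger> *v (z *s (P *v (xi z (G z) *v v)) + A\<^sup>\<dagger> *v (P *v (xi z (G z) *v v)))
        = incl\<^sup>\<dagger> *v (C1\<^sup>\<dagger> *v (sol z (G z) *v v) - C2\<^sup>\<dagger> *v v)"
      by (simp only: sol_state[OF *])
    then show "(X ** sol z (G z) - Y) *v v = ((mat z - Z) ** H z) *v v"
      by (simp add: H_def A_def C1_def C2_def ctr mvec algebra_simps)
  next
    have *: "Re z > 0" "\<And>v. norm (G z *v v) \<le> norm v"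
      using z(1) schur_class_le[OF G] by (auto simp: RHP_iff)
    note i = closed_loop_invertible[OF *]
    have Cr: "C2 *v (incr *v v) = U *v v" "C1 *v (incr *v v) = V *v v" for v
      by (simp_all add: C1_def C2_def mvec)
    have Ar: "A *v (incr *v v) = incr *v (W *v v)" for v
      by (simp add: A_def mvec)
    \<comment> \<open>Apply the closed loop to \<open>xi U + incr\<close>: because \<open>C2\<close>
      restricts to \<open>U\<close> on the \<open>W\<close> component, the feedback terms cancel and
      the pencil \<open>z - W\<close> remains. Both right divisions follow from it.\<close>
    have xiU: "xi z (G z) *v (U *v v) = \<Psi> z *v (z *s v - W *v v) - incr *v v" for v
    proof -
      have "closed_loop z (G z) *v (xi z (G z) *v (U *v v) + incr *v v) = incr *v (z *s v - W *v v)"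
        unfolding matrix_vector_right_distrib
        by (simp add: xi_def inv_vec(1)[OF i] flip: matrix_vector_mul_assoc)
          (simp add: closed_loop_def Ar Cr mvec)
      then have "xi z (G z) *v (U *v v) + incr *v v = matrix_inv (closed_loop z (G z)) *v (incr *v (z *s v - W *v v))"
        using inv_vec(2)[OF i, of "xi z (G z) *v (U *v v) + incr *v v"] by simp
      then show ?thesis by (simp add: \<Psi>_def matrix_vector_mul_assoc[symmetric] algebra_simps)
    qed
    fix v
    show "(sol z (G z) ** U - V) *v v = (L z ** (mat z - W)) *v v"
      by (simp add: sol_def den_def L_def matrix_vector_mul_assoc[symmetric] matrix_vector_mult_diff_rdistrib
          matrix_vector_mult_add_rdistrib xiU)
        (simp add: mvec Cr algebra_simps)
    have "incl\<^sup>\<dagger> *v (P *v (incr *v v)) = \<Gamma> *v v" for v by (simp add: P_eq mvec)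
    then show "(H z ** U - \<Gamma>) *v v = (K z ** (mat z - W)) *v v"
      by (simp add: H_def K_def matrix_vector_mul_assoc[symmetric] matrix_vector_mult_diff_rdistrib
          uminus_mat_vec xiU)
        (simp add: mvec algebra_simps)
  qed
  ultimately show ?thesis unfolding interp_functions_def by blast
qed

end

subsection \<open>The fundamental matrix inequality\<close>

lemma difference_quotient:
  fixes F :: "complex \<Rightarrow> complex^'m^'n"
  assumes F: "mholo F \<Pi>\<^sub>+" and a: "a \<in> \<Pi>\<^sub>+"
  obtains D where "mholo D \<Pi>\<^sub>+" "\<And>z. F z - F a = mat (z - a) ** D z"
proof -
  define D :: "complex \<Rightarrow> complex^'m^'n" where
    "D z = (\<chi> i j. if z = a then deriv (\<lambda>z. F z $ i $ j) a else (F z $ i $ j - F a $ i $ j) / (z - a))" for z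
  have "mholo D \<Pi>\<^sub>+" unfolding mholo_def D_def
  proof (intro allI)
    fix i j
    have "(\<lambda>z. F z $ i $ j) holomorphic_on \<Pi>\<^sub>+" using F by (simp add: mholo_def)
    moreover have "a \<in> interior \<Pi>\<^sub>+" using a interior_open[OF open_RHP] by simp
    ultimately have "(\<lambda>z. if z = a then deriv (\<lambda>z. F z $ i $ j) a
        else (F z $ i $ j - F a $ i $ j) / (z - a)) holomorphic_on \<Pi>\<^sub>+"
      by (rule pole_lemma)
    then show "(\<lambda>z. (\<chi> i j. if z = a then deriv (\<lambda>z. F z $ i $ j) a
        else (F z $ i $ j - F a $ i $ j) / (z - a)) $ i $ j) holomorphic_on \<Pi>\<^sub>+"
      by simp
  qed
  moreover have "F z - F a = mat (z - a) ** D z" for z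
    by (simp add: vec_eq_iff matrix_matrix_mult_def mat_def if_distrib[where f="\<lambda>a. a * _"] D_def cong: if_cong)
  ultimately show ?thesis by (rule that)
qed

lemma inner_of_real_smult: "inner x (of_real t *s y) = t * inner x (y::complex^'n)"
  by (simp add: inner_vec_def inner_complex_def sum_distrib_left algebra_simps)

definition column_matrix :: "complex^'n \<Rightarrow> complex^unit^'n"
  where "column_matrix v = (\<chi> i j. v $ i)"

lemma column_matrix_vec: "column_matrix v *v c = (c $ ()) *s v"
  by (simp add: column_matrix_def matrix_vector_mult_def vec_eq_iff UNIV_unit mult.commute)

text \<open>Positivity of the Pick matrix is applied to the data enlarged by the right tangential
  condition \<open>S(z\<^sub>0) v = S z\<^sub>0 v\<close>.\<close>

lemma (in btoa) fundamental_inequality: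
  assumes S: "S \<in> schur_class" and F: "interp_functions Z X Y U V W \<Gamma> S H L K" and z0: "z0 \<in> \<Pi>\<^sub>+"
    and r: "z0 *s r + W\<^sup>\<dagger> *v r = U\<^sup>\<dagger> *v v - V\<^sup>\<dagger> *v (S z0 *v v)"
  shows "0 \<le> inner x (GL *v x) + inner y (GR *v y) + 2 * inner x (\<Gamma> *v y)
      + 2 * inner y r + 2 * inner x (H z0 *v v) + ((norm v)^2 - (norm (S z0 *v v))^2) / (2 * Re z0)"
proof -
  note d = interp_functionsD[OF F]
  obtain DS where DS: "mholo DS \<Pi>\<^sub>+" "\<And>z. S z - S z0 = mat (z - z0) ** DS z"
    using difference_quotient[OF schur_class_mholo[OF S] z0] by metis
  obtain DH where DH: "mholo DH \<Pi>\<^sub>+" "\<And>z. H z - H z0 = mat (z - z0) ** DH z"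
    using difference_quotient[OF d(1) z0] by metis
  have Re0: "Re z0 > 0" using z0 by (simp add: RHP_iff)
  \<comment> \<open>The new diagonal Pick entry: the solution of \<open>(z0 + cnj z0) * t\<close> =
    |v|^2 - |S(z0) v|^2. The vector \<open>r\<close> plays the same role for the new off-diagonal
    column.\<close>
  define t where "t = ((norm v)^2 - (norm (S z0 *v v))^2) / (2 * Re z0)"
  define vc where "vc = column_matrix v"
  define rc where "rc = column_matrix r"
  define W' :: "complex^('w+unit)^('w+unit)" where "W' = incl ** W ** incl\<^sup>\<dagger> + incr ** mat z0 ** incr\<^sup>\<dagger>"
  define U' :: "complex^('w+unit)^'m" where "U' = U ** incl\<^sup>\<dagger> + vc ** incr\<^sup>\<dagger>"
  define V' :: "complex^('w+unit)^'p" where "V' = V ** incl\<^sup>\<dagger> + S z0 ** vc ** incr\<^sup>\<dagger>"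
  \<comment> \<open>The new column must solve (z0 - Z) g = X S(z0) v - Y v. The choice
    \<open>H z0 *v v\<close> does so even when \<open>z0\<close> is an eigenvalue of
    \<open>Z\<close>, so no points are excluded.\<close>
  define \<Gamma>' :: "complex^('w+unit)^'z" where "\<Gamma>' = \<Gamma> ** incl\<^sup>\<dagger> + H z0 ** vc ** incr\<^sup>\<dagger>"
  define G' :: "complex^('w+unit)^('w+unit)" where
    "G' = incl ** GR ** incl\<^sup>\<dagger> + incl ** rc ** incr\<^sup>\<dagger> + incr ** rc\<^sup>\<dagger> ** incl\<^sup>\<dagger> + incr ** mat (of_real t) ** incr\<^sup>\<dagger>"
  define L' where "L' z = L z ** incl\<^sup>\<dagger> + DS z ** vc ** incr\<^sup>\<dagger>" for z
  define K' where "K' z = K z ** incl\<^sup>\<dagger> + DH z ** vc ** incr\<^sup>\<dagger>" for z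
  have sW': "spectrum W' \<subseteq> \<Pi>\<^sub>+"
  proof
    fix z assume z: "z \<in> spectrum W'"
    show "z \<in> \<Pi>\<^sub>+"
    proof (rule ccontr)
      assume n: "z \<notin> \<Pi>\<^sub>+"
      then have i: "invertible (mat z - W)" and nz: "z \<noteq> z0" using sW z0 by (auto simp: spectrum_def)
      have "invertible (mat z - W')"
      proof (rule invertible_kerI)
        fix x assume x: "(mat z - W') *v x = 0"
        have "incl\<^sup>\<dagger> *v ((mat z - W') *v x) = 0" "incr\<^sup>\<dagger> *v ((mat z - W') *v x) = 0" by (simp_all add: x)
        then have "(mat z - W) *v (incl\<^sup>\<dagger> *v x) = 0" "(z - z0) *s (incr\<^sup>\<dagger> *v x) = 0"
          by (simp_all add: W'_def mvec)
        then have "incl\<^sup>\<dagger> *v x = 0" "incr\<^sup>\<dagger> *v x = 0" using invertible_ker[OF i] nz by auto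
        then show "x = 0" using incl_decomp[of x] by simp
      qed
      then show False using z by (simp add: spectrum_def)
    qed
  qed
  have F': "interp_functions Z X Y U' V' W' \<Gamma>' S H L' K'"
    unfolding interp_functions_def
  proof (intro conjI ballI)
    show "mholo H \<Pi>\<^sub>+" by (rule d)
    show "mholo L' \<Pi>\<^sub>+" "mholo K' \<Pi>\<^sub>+" unfolding L'_def K'_def
      by (intro mholo_add mholo_mult mholo_const d DS DH)+
    fix z assume z: "z \<in> \<Pi>\<^sub>+"
    show "X ** S z - Y = (mat z - Z) ** H z" by (rule d(4)[OF z])
    have 1: "S z *v (U *v w) = V *v w + z *s (L z *v w) - L z *v (W *v w)"
      "H z *v (U *v w) = \<Gamma> *v w + z *s (K z *v w) - K z *v (W *v w)" for w
      using arg_cong[OF d(5)[OF z], of "\<lambda>M. M *v w"] arg_cong[OF d(6)[OF z], of "\<lambda>M. M *v w"]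
      by (simp_all add: mvec algebra_simps)
    have 2: "S z *v w = S z0 *v w + z *s (DS z *v w) - z0 *s (DS z *v w)"
      "H z *v w = H z0 *v w + z *s (DH z *v w) - z0 *s (DH z *v w)" for w
      using arg_cong[OF DS(2)[of z], of "\<lambda>M. M *v w"] arg_cong[OF DH(2)[of z], of "\<lambda>M. M *v w"]
      by (simp_all add: mvec algebra_simps)
    show "S z ** U' - V' = L' z ** (mat z - W')"
      by (rule mat_eqI) (simp add: U'_def V'_def L'_def W'_def mvec 1 2[of "vc *v w" for w] algebra_simps)
    show "H z ** U' - \<Gamma>' = K' z ** (mat z - W')"
      by (rule mat_eqI) (simp add: U'_def \<Gamma>'_def K'_def W'_def mvec 1 2[of "vc *v w" for w] algebra_simps)
  qed
  have syl': "\<Gamma>' ** W' - Z ** \<Gamma>' = X ** V' - Y ** U'"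
  proof (rule mat_eqI)
    fix w
    have "X *v (S z0 *v w) = Y *v w + z0 *s (H z0 *v w) - Z *v (H z0 *v w)" for w
      using arg_cong[OF d(4)[OF z0], of "\<lambda>M. M *v w"] by (simp add: mvec algebra_simps)
    then show "(\<Gamma>' ** W' - Z ** \<Gamma>') *v w = (X ** V' - Y ** U') *v w"
      by (simp add: \<Gamma>'_def W'_def V'_def U'_def mvec syl_vec algebra_simps)
  qed
  have "pick_right U' V' W' = G'"
  proof (rule pick_right_eqI[OF sW'], rule mat_eqI)
    fix w
    have r1: "W\<^sup>\<dagger> *v (rc *v c) = U\<^sup>\<dagger> *v (vc *v c) - V\<^sup>\<dagger> *v (S z0 *v (vc *v c)) - z0 *s (rc *v c)" for c
    proof -
      have "W\<^sup>\<dagger> *v r = U\<^sup>\<dagger> *v v - V\<^sup>\<dagger> *v (S z0 *v v) - z0 *s r" using r by (simp add: algebra_simps)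
      then show ?thesis by (simp add: rc_def vc_def column_matrix_vec mvec mult.commute)
    qed
    then have "W\<^sup>\<dagger> ** rc = U\<^sup>\<dagger> ** vc - V\<^sup>\<dagger> ** S z0 ** vc - mat z0 ** rc"
      by (intro mat_eqI) (simp add: mvec)
    from arg_cong[OF this, of ctranspose]
    have rcW: "rc\<^sup>\<dagger> ** W = vc\<^sup>\<dagger> ** U - vc\<^sup>\<dagger> ** (S z0)\<^sup>\<dagger> ** V - rc\<^sup>\<dagger> ** mat (cnj z0)"
      by (simp add: ctr matrix_mul_assoc)
    have r2: "rc\<^sup>\<dagger> *v (W *v x) = vc\<^sup>\<dagger> *v (U *v x) - vc\<^sup>\<dagger> *v ((S z0)\<^sup>\<dagger> *v (V *v x)) - cnj z0 *s (rc\<^sup>\<dagger> *v x)" for x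
      using arg_cong[OF rcW, of "\<lambda>M. M *v x"] by (simp add: mvec)
    have r3: "z0 *s ((of_real t) *s c) + cnj z0 *s ((of_real t) *s c) = vc\<^sup>\<dagger> *v (vc *v c) - vc\<^sup>\<dagger> *v ((S z0)\<^sup>\<dagger> *v (S z0 *v (vc *v c)))" for c :: "complex^unit"
    proof -
      have n: "(column_matrix w)\<^sup>\<dagger> *v (column_matrix w *v c) = (of_real ((norm w)^2)) *s c" for w :: "complex^'k"
      proof -
        have "(norm w)^2 = (\<Sum>i\<in>UNIV. (norm (w $ i))^2)"
          by (simp add: norm_vec_def L2_set_def sum_nonneg)
        then have "of_real ((norm w)^2) = (\<Sum>i\<in>UNIV. cnj (w $ i) * w $ i)"
          by (simp add: complex_norm_square mult.commute del: of_real_power)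
        then show ?thesis
          by (simp add: column_matrix_vec vec_eq_iff matrix_vector_mult_def ctranspose_nth column_matrix_def
              UNIV_unit sum_distrib_left sum_distrib_right mult_ac del: of_real_power)
      qed
      have "S z0 ** vc = column_matrix (S z0 *v v)"
        by (rule mat_eqI) (simp add: mvec vc_def column_matrix_vec)
      then have e: "vc\<^sup>\<dagger> *v ((S z0)\<^sup>\<dagger> *v (S z0 *v (vc *v c))) = (of_real ((norm (S z0 *v v))^2)) *s c"
        using n[of "S z0 *v v"] by (simp only: ctr matrix_vector_mul_assoc flip: \<open>S z0 ** vc = _\<close>) (simp only: matrix_mul_assoc)
      have two_t: "(norm v)^2 - (norm (S z0 *v v))^2 = (2 * Re z0) * t" using Re0 by (simp add: t_def)
      have "z0 + cnj z0 = of_real (2 * Re z0)" by (rule complex_add_cnj)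
      then have "(z0 + cnj z0) * of_real t = of_real ((norm v)^2 - (norm (S z0 *v v))^2)"
        using two_t by (simp only: of_real_mult)
      then have "((z0 + cnj z0) * of_real t) *s c = (of_real ((norm v)^2)) *s c - (of_real ((norm (S z0 *v v))^2)) *s c"
        by (simp only: of_real_diff vector_sub_rdistrib)
      then show ?thesis unfolding e unfolding vc_def n
        by (simp add: vector_smult_assoc vector_sadd_rdistrib distrib_right)
    qed
    show "(G' ** W' + W'\<^sup>\<dagger> ** G') *v w = (U'\<^sup>\<dagger> ** U' - V'\<^sup>\<dagger> ** V') *v w"
      using arg_cong[OF r3[of "incr\<^sup>\<dagger> *v w"], of "(*v) incr"]
      by (simp add: G'_def W'_def U'_def V'_def ctr mvec r1 r2 GR_vec) (simp add: algebra_simps)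
  qed
  moreover have "0 \<le> inner x (pick_left Z X Y *v x) + inner (incl *v y + incr *v axis () 1) (pick_right U' V' W' *v (incl *v y + incr *v axis () 1))
      + 2 * inner x (\<Gamma>' *v (incl *v y + incr *v axis () 1))"
    by (rule half_plane_necessity[OF sZ sW' S F' syl'])
  moreover have "rc *v axis () 1 = r" "vc *v axis () 1 = v" by (simp_all add: rc_def vc_def column_matrix_vec)
  moreover have "inner (axis () 1) (rc\<^sup>\<dagger> *v y) = inner y (rc *v axis () 1)"
    using ctranspose_inner[of rc "axis () 1" y] inner_commute[of y "rc *v axis () 1"] by simp
  moreover have "inner (axis () (1::complex)) (axis () 1 :: complex^unit) = 1"
    by (simp add: inner_vec_def UNIV_unit axis_def)
  ultimately show ?thesis unfolding t_def[symmetric]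
    by (simp add: G'_def \<Gamma>'_def mvec inner_add_left inner_add_right inner_incl inner_of_real_smult)
qed

subsection \<open>Every interpolant arises from a parameter\<close>

lemma eventually_at_RHP:
  assumes "finite B" "z \<in> \<Pi>\<^sub>+" shows "eventually (\<lambda>u. u \<in> \<Pi>\<^sub>+ - B) (at z)"
proof -
  have "open (\<Pi>\<^sub>+ - (B - {z}))" using open_RHP assms(1) by (simp add: finite_imp_closed open_Diff)
  moreover have "z \<in> \<Pi>\<^sub>+ - (B - {z})" using assms(2) by simp
  ultimately show ?thesis unfolding eventually_at_topological by (intro exI[of _ "\<Pi>\<^sub>+ - (B - {z})"]) auto
qed

lemma mholo_tendsto:
  fixes F :: "complex \<Rightarrow> complex^'m^'n"
  assumes "mholo F \<Pi>\<^sub>+" "z \<in> \<Pi>\<^sub>+"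
  shows "((\<lambda>u. F u $ i $ j) \<longlongrightarrow> F z $ i $ j) (at z)"
proof -
  have "continuous_on \<Pi>\<^sub>+ (\<lambda>u. F u $ i $ j)"
    using assms(1) by (simp add: mholo_def holomorphic_on_imp_continuous_on)
  then show ?thesis using assms(2) open_RHP continuous_on_eq_continuous_at isCont_def by blast
qed

lemma mholo_eq_off_finite:
  fixes F G :: "complex \<Rightarrow> complex^'m^'n"
  assumes "mholo F \<Pi>\<^sub>+" "mholo G \<Pi>\<^sub>+" "finite B" "\<And>z. z \<in> \<Pi>\<^sub>+ - B \<Longrightarrow> F z = G z" "z \<in> \<Pi>\<^sub>+"
  shows "F z = G z"
proof -
  have "F z $ i $ j = G z $ i $ j" for i j
  proof (rule tendsto_unique[OF at_neq_bot])
    show "((\<lambda>u. F u $ i $ j) \<longlongrightarrow> F z $ i $ j) (at z)" by (rule mholo_tendsto[OF assms(1,5)])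
    have "eventually (\<lambda>u. G u $ i $ j = F u $ i $ j) (at z)"
      using eventually_at_RHP[OF assms(3,5)] assms(4) by (auto elim!: eventually_mono)
    then show "((\<lambda>u. F u $ i $ j) \<longlongrightarrow> G z $ i $ j) (at z)"
      using mholo_tendsto[OF assms(2,5), of i j] by (rule Lim_transform_eventually[rotated])
  qed
  then show ?thesis by (simp add: vec_eq_iff)
qed

lemma contraction_entry:
  fixes M :: "complex^'m^'p"
  assumes "\<And>v. norm (M *v v) \<le> norm v" shows "norm (M $ i $ j) \<le> 1"
proof -
  have "norm (M $ i $ j) \<le> norm (M *v axis j 1)"
    using Finite_Cartesian_Product.norm_nth_le[of "M *v axis j 1" i] by (simp add: mat_vec_axis)
  also have "\<dots> \<le> norm (axis j 1 :: complex^'m)" by (rule assms)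
  finally show ?thesis by (simp add: norm_axis_1)
qed

text \<open>Contractivity bounds every entry by 1, so the singularities in \<open>B\<close> are
  removable, and the norm bound persists by continuity.\<close>

lemma schur_extension:
  fixes F :: "complex \<Rightarrow> complex^'m^'p"
  assumes B: "finite B" "B \<subseteq> \<Pi>\<^sub>+" and F: "mholo F (\<Pi>\<^sub>+ - B)"
    and le: "\<And>z v. z \<in> \<Pi>\<^sub>+ - B \<Longrightarrow> norm (F z *v v) \<le> norm v"
  obtains G where "G \<in> schur_class" "\<And>z. z \<in> \<Pi>\<^sub>+ - B \<Longrightarrow> G z = F z"
proof -
  have bound: "norm (F z $ i $ j) \<le> 1" if "z \<in> \<Pi>\<^sub>+ - B" for z i j
    by (rule contraction_entry[OF le[OF that]])
  have "\<exists>g. g holomorphic_on \<Pi>\<^sub>+ \<and> (\<forall>z\<in>\<Pi>\<^sub>+ - B. g z = F z $ i $ j)" for i j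
  proof (rule removable_singularities[OF B(1)])
    show "B \<subseteq> interior \<Pi>\<^sub>+" using B(2) by (simp add: interior_open open_RHP)
    show "(\<lambda>z. F z $ i $ j) holomorphic_on \<Pi>\<^sub>+ - B" using F by (simp add: mholo_def)
    fix z assume "z \<in> B"
    then have "z \<in> \<Pi>\<^sub>+" using B(2) by auto
    then have "eventually (\<lambda>u. norm (F u $ i $ j) \<le> 1 * norm (1::complex)) (at z)"
      by (rule eventually_mono[OF eventually_at_RHP[OF B(1)]]) (use bound in simp)
    then show "(\<lambda>z. F z $ i $ j) \<in> O[at z](\<lambda>_. 1)" by (rule landau_o.bigI[rotated]) simp
  qed
  then obtain g where g: "\<And>i j. g i j holomorphic_on \<Pi>\<^sub>+" "\<And>i j z. z \<in> \<Pi>\<^sub>+ - B \<Longrightarrow> g i j z = F z $ i $ j"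
    by metis
  define G :: "complex \<Rightarrow> complex^'m^'p" where "G z = (\<chi> i j. g i j z)" for z
  have GF: "G z = F z" if "z \<in> \<Pi>\<^sub>+ - B" for z using g(2)[OF that] by (simp add: G_def vec_eq_iff)
  have Gm: "mholo G \<Pi>\<^sub>+" using g(1) by (simp add: mholo_def G_def)
  have "G \<in> schur_class"
  proof (rule schur_classI[OF Gm])
    fix z v assume z: "z \<in> \<Pi>\<^sub>+"
    have "((\<lambda>u. \<Sum>j\<in>UNIV. G u $ i $ j * v $ j) \<longlongrightarrow> (\<Sum>j\<in>UNIV. G z $ i $ j * v $ j)) (at z)" for i
      by (intro tendsto_intros mholo_tendsto[OF Gm z])
    then have "((\<lambda>u. G u *v v) \<longlongrightarrow> G z *v v) (at z)"
      by (intro vec_tendstoI) (simp add: matrix_vector_mult_def)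
    then have "((\<lambda>u. norm (G u *v v)) \<longlongrightarrow> norm (G z *v v)) (at z)" by (rule tendsto_norm)
    moreover have "eventually (\<lambda>u. norm (G u *v v) \<le> norm v) (at z)"
      by (rule eventually_mono[OF eventually_at_RHP[OF B(1) z]]) (use GF le in simp)
    ultimately show "norm (G z *v v) \<le> norm v" by (rule tendsto_upperbound) simp
  qed
  then show ?thesis using GF that by blast
qed

lemma (in btoa_pos) interp_is_sol:
  assumes S: "S \<in> schur_class" and F: "interp_functions Z X Y U V W \<Gamma> S H L K"
  shows "\<exists>G\<in>schur_class. \<forall>z\<in>\<Pi>\<^sub>+. S z = sol z (G z)"
proof -
  note d = interp_functionsD[OF F]
  define r where "r z = matrix_inv (mat z + W\<^sup>\<dagger>) ** (U\<^sup>\<dagger> - V\<^sup>\<dagger> ** S z)" for z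
  \<comment> \<open>Chosen so that \<open>P ** x z\<close> stacks \<open>- H z\<close> over
    \<open>- r z\<close>; then the left division identity and the equation for \<open>r\<close>
    together are the adjoint state equation \<open>st\<close>.\<close>
  define x where "x z = matrix_inv P ** (- (incl ** H z) - incr ** r z)" for z
  have iW: "invertible (mat z + W\<^sup>\<dagger>)" if "z \<in> \<Pi>\<^sub>+" for z
  proof -
    have "- z \<notin> spectrum (W\<^sup>\<dagger>)" using spectrum_ctranspose_RHP[OF sW] that by (auto simp: right_half_plane_def)
    then have "invertible (mat (- z) - W\<^sup>\<dagger>)" by (simp add: spectrum_def)
    moreover have "mat (- z) - W\<^sup>\<dagger> = mat (- 1) ** (mat z + W\<^sup>\<dagger>)" by (rule mat_eqI) (simp add: mvec)
    ultimately show ?thesis by (simp add: invertible_mult_iff)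
  qed
  have r: "z *s (r z *v v) + W\<^sup>\<dagger> *v (r z *v v) = U\<^sup>\<dagger> *v v - V\<^sup>\<dagger> *v (S z *v v)" if "z \<in> \<Pi>\<^sub>+" for z v
    using inv_vec(1)[OF iW[OF that], of "(U\<^sup>\<dagger> - V\<^sup>\<dagger> ** S z) *v v"] by (simp add: r_def mvec algebra_simps)
  have Px: "P *v (x z *v v) = - (incl *v (H z *v v)) - incr *v (r z *v v)" for z v
    unfolding x_def matrix_vector_mul_assoc[symmetric] inv_vec(1)[OF P_inv] by (simp add: mvec)
  have Sm: "mholo S \<Pi>\<^sub>+" by (rule schur_class_mholo[OF S])
  have xm: "mholo x \<Pi>\<^sub>+" unfolding x_def r_def
    using iW by (intro mholo_mult mholo_diff mholo_uminus mholo_const d mholo_inv mholo_add mholo_id Sm) auto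
  have st: "z *s (P *v (x z *v v)) + A\<^sup>\<dagger> *v (P *v (x z *v v)) = C1\<^sup>\<dagger> *v (S z *v v) - C2\<^sup>\<dagger> *v v"
    if z: "z \<in> \<Pi>\<^sub>+" for z v
  proof -
    have "z *s (H z *v v) = X *v (S z *v v) - Y *v v + Z *v (H z *v v)"
      using arg_cong[OF d(4)[OF z], of "\<lambda>M. M *v v"] by (simp add: mvec algebra_simps)
    moreover have "z *s (r z *v v) = U\<^sup>\<dagger> *v v - V\<^sup>\<dagger> *v (S z *v v) - W\<^sup>\<dagger> *v (r z *v v)"
      using r[OF z, of v] by (simp add: algebra_simps)
    ultimately have "z *s (incl *v (H z *v v)) = (incl :: complex^'z^('z+'w)) *v (X *v (S z *v v) - Y *v v + Z *v (H z *v v))"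
      "z *s (incr *v (r z *v v)) = (incr :: complex^'w^('z+'w)) *v (U\<^sup>\<dagger> *v v - V\<^sup>\<dagger> *v (S z *v v) - W\<^sup>\<dagger> *v (r z *v v))"
      by (simp_all only: mat_vec_scale[symmetric])
    then show ?thesis by (simp add: Px A_def C1_def C2_def ctr mvec)
  qed
  have le: "norm (inv_num (S z) (x z) *v v) \<le> norm (inv_den (x z) *v v)" if z: "z \<in> \<Pi>\<^sub>+" for z v
  proof -
    have Re: "Re z > 0" using z by (simp add: RHP_iff)
    \<comment> \<open>The fundamental inequality is quadratic in its test vector with linear part -2
      \<open>P *v a\<close>, so \<open>a\<close> is the minimiser. There the form equals the defect
      of \<open>S z\<close> over 2 Re z minus \<open>inner a (P *v a)\<close>, which
      \<open>inverse_energy\<close> converts into the claim.\<close>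
    define a where "a = x z *v v"
    have "0 \<le> inner a (P *v a) + 2 * (inner (incr\<^sup>\<dagger> *v a) (r z *v v) + inner (incl\<^sup>\<dagger> *v a) (H z *v v))
        + ((norm v)^2 - (norm (S z *v v))^2) / (2 * Re z)"
      using fundamental_inequality[OF S F z r[OF z, of v], of "incl\<^sup>\<dagger> *v a" "incr\<^sup>\<dagger> *v a"]
      by (simp add: P_form[symmetric] incl_decomp distrib_left)
    also have "inner (incr\<^sup>\<dagger> *v a) (r z *v v) + inner (incl\<^sup>\<dagger> *v a) (H z *v v) = - inner a (P *v a)"
      unfolding a_def Px by (simp add: inner_diff_right inner_ctranspose)
    finally have "inner a (P *v a) \<le> ((norm v)^2 - (norm (S z *v v))^2) / (2 * Re z)" by simp
    then have "2 * Re z * inner a (P *v a) \<le> (norm v)^2 - (norm (S z *v v))^2"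
      using Re by (simp add: field_simps)
    then have "(norm (inv_num (S z) (x z) *v v))^2 \<le> (norm (inv_den (x z) *v v))^2"
      using inverse_energy[OF st[OF z], of v] unfolding a_def by linarith
    then show ?thesis by (rule power2_le_imp_le) simp
  qed
  define G0 where "G0 z = inv_num (S z) (x z) ** matrix_inv (inv_den (x z))" for z
  \<comment> \<open>This needs z - A invertible, so the parameter is first defined off the spectrum
    of \<open>W\<close> and then extended.\<close>
  have inv: "invertible (inv_den (x z))" if "z \<in> \<Pi>\<^sub>+ - spectrum W" for z
    using inv_den_invertible[OF st invertible_A le, of z] that by auto
  obtain G where G: "G \<in> schur_class" "\<And>z. z \<in> \<Pi>\<^sub>+ - spectrum W \<Longrightarrow> G z = G0 z"
  proof (rule schur_extension[OF finite_spectrum sW, of G0])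
    have sub: "\<Pi>\<^sub>+ - spectrum W \<subseteq> \<Pi>\<^sub>+" by auto
    show "mholo G0 (\<Pi>\<^sub>+ - spectrum W)" unfolding G0_def
      using inv by (intro mholo_mult mholo_inv)
        (auto simp: inv_num_def inv_den_def intro!: mholo_add mholo_mult mholo_const mholo_subset[OF Sm sub] mholo_subset[OF xm sub])
    fix z v assume z: "z \<in> \<Pi>\<^sub>+ - spectrum W"
    show "norm (G0 z *v v) \<le> norm v"
      using le[of z "matrix_inv (inv_den (x z)) *v v"] z inv_vec(1)[OF inv[OF z], of v]
      by (simp add: G0_def flip: matrix_vector_mul_assoc)
  qed blast
  have "S z = sol z (G z)" if z: "z \<in> \<Pi>\<^sub>+ - spectrum W" for z
  proof -
    have zz: "z \<in> \<Pi>\<^sub>+" "Re z > 0" using z by (auto simp: RHP_iff)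
    have eq: "inv_num (S z) (x z) = G z ** inv_den (x z)"
      unfolding G(2)[OF z] G0_def by (simp add: matrix_inv_left'[OF inv[OF z]] flip: matrix_mul_assoc)
    have "x z = xi z (G z)"
      by (rule xi_unique[OF zz(2) schur_class_le[OF G(1) zz(1)] inverse_feedback[OF st[OF zz(1)] eq]])
    moreover have "S z = inv_num (S z) (x z) - C1 ** x z" by (simp add: inv_num_def)
    ultimately show ?thesis unfolding eq by (simp add: sol_def inv_den_def den_def)
  qed
  then have "S z = sol z (G z)" if "z \<in> \<Pi>\<^sub>+" for z
    using mholo_eq_off_finite[OF Sm schur_class_mholo[OF sol_schur[OF G(1)]] finite_spectrum _ that] by blast
  then show ?thesis using G(1) by blast
qed

subsection \<open>Definiteness from controllability and observability\<close>

text \<open>If \<open>M *v x\<close> were nonzero, a small step from the minimum \<open>x\<close> of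
  the form in the direction of minus \<open>M *v x\<close> would make it negative.\<close>

lemma psd_form_zero:
  fixes M :: "complex^'n^'n"
  assumes M: "M\<^sup>\<dagger> = M" "\<And>v. 0 \<le> inner v (M *v v)" and x: "inner x (M *v x) = 0"
  shows "M *v x = 0"
proof (rule ccontr)
  assume n: "M *v x \<noteq> 0"
  define w c d where "w = M *v x" and "c = inner w w" and "d = inner w (M *v w)"
  have c: "c > 0" using n by (simp add: c_def w_def)
  have d: "d \<ge> 0" using M(2) by (simp add: d_def)
  have 1: "0 \<le> - 2 * t * c + t^2 * d" for t :: real
  proof -
    have "inner x (M *v w) = c" using inner_ctranspose[of x M w] M(1) by (simp add: c_def w_def)
    moreover have "0 \<le> inner (x - t *\<^sub>R w) (M *v (x - t *\<^sub>R w))" by (rule M(2))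
    moreover have "M *v (t *\<^sub>R w) = t *\<^sub>R (M *v w)" by (rule linear_scale) simp
    ultimately show ?thesis
      using x by (simp add: matrix_vector_mult_diff_distrib inner_diff_left inner_diff_right w_def[symmetric] c_def[symmetric]
          d_def[symmetric] power2_eq_square algebra_simps)
  qed
  show False
  proof (cases "d = 0")
    case True
    then show False using 1[of 1] c by simp
  next
    case False
    \<comment> \<open>\<open>c / d\<close> minimises the quadratic polynomial in \<open>t\<close>,
      with value -c^2/d.\<close>
    then have "(c / d)^2 * d = c * (c / d)" by (simp add: power2_eq_square)
    then have "0 \<le> - (c * (c / d))" using 1[of "c / d"] by simp
    moreover have "0 < c * (c / d)" using c d False by simp
    ultimately show False by linarith
  qed
qed

lemma mat_pow_commute: "mat_pow A k ** A = A ** mat_pow A k"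
proof (induction k)
  case (Suc k)
  then show ?case by (simp add: matrix_mul_assoc[symmetric])
qed simp

lemma mat_pow_ctranspose: "(mat_pow A k)\<^sup>\<dagger> = mat_pow (A\<^sup>\<dagger>) k"
proof (induction k)
  case (Suc k)
  then show ?case by (simp add: ctr mat_pow_commute)
qed (simp add: ctr)

text \<open>Instance of the necessity result: the function 0 interpolates zero values, and
  \<open>Z\<close> itself serves as a dummy \<open>W\<close> with admissible spectrum.\<close>

lemma gramian_psd:
  fixes Z :: "complex^'z^'z" and X :: "complex^'p^'z"
  assumes "spectrum Z \<subseteq> \<Pi>\<^sub>+"
  shows "0 \<le> inner x (pick_left Z X (0 :: complex^'m^'z) *v x)"
proof -
  have "interp_functions Z X (0::complex^'m^'z) (0::complex^'z^'m) 0 Z 0 (\<lambda>z. 0) (\<lambda>z. 0) (\<lambda>z. 0) (\<lambda>z. 0)"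
    by (simp add: interp_functions_def mholo_const)
  moreover have "(\<lambda>z. 0 :: complex^'m^'p) \<in> schur_class" by (rule schur_classI) (simp_all add: mholo_const)
  ultimately have "0 \<le> inner x (pick_left Z X (0 :: complex^'m^'z) *v x)
      + inner 0 (pick_right (0::complex^'z^'m) (0::complex^'z^'p) Z *v 0) + 2 * inner x ((0::complex^'z^'z) *v 0)"
    by (intro half_plane_necessity[OF assms assms]) (simp_all del: inner_zero_left inner_zero_right)
  then show ?thesis by simp
qed

text \<open>If G y = 0, pairing the Lyapunov equation with y gives
  \<open>X\<^sup>\<dagger> *v y\<close> = 0, and then the equation itself puts
  \<open>Z\<^sup>\<dagger> *v y\<close> in the kernel again.\<close>

lemma gramian_kernel:
  fixes Z :: "complex^'z^'z" and X :: "complex^'p^'z"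
  assumes Z: "spectrum Z \<subseteq> \<Pi>\<^sub>+" and x: "inner x (pick_left Z X (0 :: complex^'m^'z) *v x) = 0"
  shows "X\<^sup>\<dagger> *v (mat_pow (Z\<^sup>\<dagger>) k *v x) = 0"
proof -
  let ?G = "pick_left Z X (0 :: complex^'m^'z)"
  note h = pick_left_hermitian[OF Z, of X "0 :: complex^'m^'z"]
  have step: "X\<^sup>\<dagger> *v y = 0 \<and> ?G *v (Z\<^sup>\<dagger> *v y) = 0" if y: "?G *v y = 0" for y
  proof -
    have e: "?G *v (Z\<^sup>\<dagger> *v y) = X *v (X\<^sup>\<dagger> *v y)"
      using arg_cong[OF pick_left_eq[OF Z, of X "0 :: complex^'m^'z"], of "\<lambda>M. M *v y"] y by (simp add: mvec)
    then have "inner y (X *v (X\<^sup>\<dagger> *v y)) = inner (?G *v y) (Z\<^sup>\<dagger> *v y)"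
      using inner_ctranspose[of y ?G "Z\<^sup>\<dagger> *v y"] h by simp
    then have "inner (X\<^sup>\<dagger> *v y) (X\<^sup>\<dagger> *v y) = 0" using y by (simp add: inner_ctranspose[of y X])
    then have "X\<^sup>\<dagger> *v y = 0" by simp
    then show ?thesis using e by simp
  qed
  have "?G *v (mat_pow (Z\<^sup>\<dagger>) k *v x) = 0" for k
  proof (induction k)
    case 0
    then show ?case using psd_form_zero[OF h gramian_psd[OF Z] x] by simp
  next
    case (Suc k)
    then show ?case using step by (simp add: matrix_vector_mul_assoc[symmetric])
  qed
  then show ?thesis using step by blast
qed

text \<open>The conjugated entries of such an \<open>x\<close> annihilate the rows of the
  controllability matrix; a nontrivial relation would push the row rank below full.\<close>

lemma controllable_kernel:
  fixes Z :: "complex^'z^'z" and X :: "complex^'p^'z"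
  assumes c: "controllable Z X" and x: "\<And>k. X\<^sup>\<dagger> *v (mat_pow (Z\<^sup>\<dagger>) k *v x) = 0"
  shows "x = 0"
proof (rule ccontr)
  assume "x \<noteq> 0"
  then obtain i where i: "x $ i \<noteq> 0" by (auto simp: vec_eq_iff)
  let ?K = "controllability_matrix Z X"
  have dep: "(\<Sum>l\<in>UNIV. cnj (x $ l) *s row l ?K) = 0"
  proof -
    have "(\<Sum>l\<in>UNIV. cnj (x $ l) * (mat_pow Z k ** X) $ l $ j) = 0" for k j
    proof -
      have "(mat_pow Z k ** X)\<^sup>\<dagger> *v x = 0"
        using x[of k] by (simp add: ctr mat_pow_ctranspose matrix_vector_mul_assoc)
      then have "cnj (((mat_pow Z k ** X)\<^sup>\<dagger> *v x) $ j) = 0" by simp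
      then show ?thesis by (simp add: matrix_vector_mult_def ctranspose_nth mult.commute)
    qed
    then show ?thesis
      by (simp add: vec_eq_iff row_def controllability_matrix_def)
  qed
  have "row i ?K \<in> vec.span ((\<lambda>l. row l ?K) ` (UNIV - {i}))"
  proof -
    have "cnj (x $ i) *s row i ?K = - (\<Sum>l\<in>UNIV - {i}. cnj (x $ l) *s row l ?K)"
      using dep by (simp add: sum.remove[of UNIV i] add_eq_0_iff2)
    then have "inverse (cnj (x $ i)) *s (cnj (x $ i) *s row i ?K)
        = inverse (cnj (x $ i)) *s (- (\<Sum>l\<in>UNIV - {i}. cnj (x $ l) *s row l ?K))" by simp
    then have "row i ?K = inverse (cnj (x $ i)) *s (- (\<Sum>l\<in>UNIV - {i}. cnj (x $ l) *s row l ?K))"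
      using i by (simp only: vector_smult_assoc left_inverse complex_cnj_zero_iff not_False_eq_True vector_smult_lid)
    also have "\<dots> \<in> vec.span ((\<lambda>l. row l ?K) ` (UNIV - {i}))"
      by (intro vec.span_scale vec.span_neg vec.span_sum vec.span_base) auto
    finally show ?thesis .
  qed
  then have "row l ?K \<in> vec.span ((\<lambda>l. row l ?K) ` (UNIV - {i}))" for l
    by (cases "l = i") (auto intro: vec.span_base)
  then have "rows ?K \<subseteq> vec.span ((\<lambda>l. row l ?K) ` (UNIV - {i}))"
    by (auto simp: rows_def)
  then have "vec.dim (rows ?K) \<le> card ((\<lambda>l. row l ?K) ` (UNIV - {i}))"
    by (intro vec.dim_le_card) auto
  also have "\<dots> \<le> card (UNIV - {i})" by (rule card_image_le) simp
  also have "\<dots> < CARD('z)" by (rule psubset_card_mono) auto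
  finally show False using c by (simp add: controllable_def row_rank_def_gen)
qed

subsection \<open>Convergence of point evaluations\<close>

text \<open>All residues are integrals over one fixed circle in the punctured domain, on which
  convergence is uniform.\<close>

lemma residue_tendsto:
  fixes f :: "nat \<Rightarrow> complex \<Rightarrow> complex"
  assumes s: "open s" "p \<in> s" and f: "\<And>n. f n holomorphic_on s - {p}" and g: "g holomorphic_on s - {p}"
    and lim: "\<And>C. compact C \<Longrightarrow> C \<subseteq> s - {p} \<Longrightarrow> uniform_limit C f g sequentially"
  shows "(\<lambda>n. residue (f n) p) \<longlonglongrightarrow> residue g p"
proof -
  obtain r where r: "r > 0" "cball p r \<subseteq> s" using s open_contains_cball by blast
  have sub: "sphere p r \<subseteq> s - {p}" using r by auto
  have res: "residue h p = contour_integral (circlepath p r) h / (2 * pi * \<i>)" if "h holomorphic_on s - {p}" for h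
    using contour_integral_unique[OF base_residue[OF s r(1) that r(2)]] by simp
  have "(\<lambda>n. contour_integral (circlepath p r) (f n)) \<longlonglongrightarrow> contour_integral (circlepath p r) g"
  proof (rule contour_integral_uniform_limit_circlepath(2))
    show "\<forall>\<^sub>F n in sequentially. f n contour_integrable_on circlepath p r"
      by (intro always_eventually allI contour_integrable_continuous_circlepath)
        (use r holomorphic_on_imp_continuous_on[OF holomorphic_on_subset[OF f sub]] in simp)
    show "uniform_limit (sphere p r) f g sequentially" by (rule lim[OF _ sub]) simp
  qed (use r in simp_all)
  then show ?thesis unfolding res[OF f] res[OF g] by (intro tendsto_divide tendsto_const) simp_all
qed

lemma uniform_limit_finite_sum:
  fixes f :: "'k \<Rightarrow> 'n \<Rightarrow> 'z \<Rightarrow> 'e::real_normed_vector"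
  assumes "finite I" "\<And>k. k \<in> I \<Longrightarrow> uniform_limit C (\<lambda>n z. f k n z) (g k) F"
  shows "uniform_limit C (\<lambda>n z. \<Sum>k\<in>I. f k n z) (\<lambda>z. \<Sum>k\<in>I. g k z) F"
  using assms
proof (induction I rule: finite_induct)
  case empty
  show ?case by (simp add: uniform_limit_const)
next
  case (insert k I)
  then show ?case unfolding sum.insert[OF insert.hyps]
    by (intro uniform_limit_add) simp_all
qed

lemma mat_residue_tendsto:
  fixes A :: "complex \<Rightarrow> complex^'p^'z" and B :: "complex \<Rightarrow> complex^'w^'m"
    and F :: "nat \<Rightarrow> complex \<Rightarrow> complex^'m^'p"
  assumes s: "open s" "p \<in> s" and A: "mholo A (s - {p})" and B: "mholo B (s - {p})"
    and F: "\<And>n. mholo (F n) s" and G: "mholo G s"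
    and lim: "\<And>C i j. compact C \<Longrightarrow> C \<subseteq> s \<Longrightarrow> uniform_limit C (\<lambda>n z. F n z $ i $ j) (\<lambda>z. G z $ i $ j) sequentially"
  shows "(\<lambda>n. mat_residue (\<lambda>z. A z ** F n z ** B z) p) \<longlonglongrightarrow> mat_residue (\<lambda>z. A z ** G z ** B z) p"
proof (intro vec_tendstoI)
  fix i j
  have sub: "s - {p} \<subseteq> s" by auto
  have Fm: "mholo (\<lambda>z. A z ** F n z ** B z) (s - {p})" for n by (intro mholo_mult A B mholo_subset[OF F sub])
  have Gm: "mholo (\<lambda>z. A z ** G z ** B z) (s - {p})" by (intro mholo_mult A B mholo_subset[OF G sub])
  have "(\<lambda>n. residue (\<lambda>z. (A z ** F n z ** B z) $ i $ j) p) \<longlonglongrightarrow> residue (\<lambda>z. (A z ** G z ** B z) $ i $ j) p"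
  proof (rule residue_tendsto[OF s])
    show "(\<lambda>z. (A z ** F n z ** B z) $ i $ j) holomorphic_on s - {p}" for n using Fm by (simp add: mholo_def)
    show "(\<lambda>z. (A z ** G z ** B z) $ i $ j) holomorphic_on s - {p}" using Gm by (simp add: mholo_def)
    fix C assume C: "compact C" "C \<subseteq> s - {p}"
    have bd: "bounded ((\<lambda>z. h z) ` C)" if "h holomorphic_on s - {p}" for h :: "complex \<Rightarrow> complex"
      using that C by (meson compact_continuous_image compact_imp_bounded holomorphic_on_imp_continuous_on holomorphic_on_subset)
    have bA: "bounded ((\<lambda>z. A z $ i $ k) ` C)" and bB: "bounded ((\<lambda>z. B z $ l $ j) ` C)"
      and bG: "bounded ((\<lambda>z. G z $ k $ l) ` C)" for k l
      using A B mholo_subset[OF G sub] by (auto simp: mholo_def intro!: bd)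
    have bAG: "bounded ((\<lambda>z. \<Sum>k\<in>UNIV. A z $ i $ k * G z $ k $ l) ` C)" for l
      by (rule bd) (use A mholo_subset[OF G sub] in \<open>auto simp: mholo_def intro!: holomorphic_intros\<close>)
    have "uniform_limit C (\<lambda>n z. \<Sum>l\<in>UNIV. (\<Sum>k\<in>UNIV. A z $ i $ k * F n z $ k $ l) * B z $ l $ j)
        (\<lambda>z. \<Sum>l\<in>UNIV. (\<Sum>k\<in>UNIV. A z $ i $ k * G z $ k $ l) * B z $ l $ j) sequentially"
      by (intro uniform_limit_finite_sum uniform_lim_mult uniform_limit_const lim bA bB bG bAG) (use C in auto)
    then show "uniform_limit C (\<lambda>n z. (A z ** F n z ** B z) $ i $ j) (\<lambda>z. (A z ** G z ** B z) $ i $ j) sequentially"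
      by (simp add: matrix_matrix_mult_def)
  qed
  then show "(\<lambda>n. mat_residue (\<lambda>z. A z ** F n z ** B z) p $ i $ j) \<longlonglongrightarrow> mat_residue (\<lambda>z. A z ** G z ** B z) p $ i $ j"
    by (simp add: mat_residue_def)
qed

lemma eval_tendsto:
  fixes Z :: "complex^'z^'z" and W :: "complex^'w^'w" and F :: "nat \<Rightarrow> complex \<Rightarrow> complex^'m^'p"
  assumes Z: "spectrum Z \<subseteq> \<Pi>\<^sub>+" and W: "spectrum W \<subseteq> \<Pi>\<^sub>+"
    and F: "\<And>n. mholo (F n) \<Pi>\<^sub>+" and G: "mholo G \<Pi>\<^sub>+"
    and lim: "\<And>C i j. compact C \<Longrightarrow> C \<subseteq> \<Pi>\<^sub>+ \<Longrightarrow> uniform_limit C (\<lambda>n z. F n z $ i $ j) (\<lambda>z. G z $ i $ j) sequentially"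
  shows "(\<lambda>n. left_eval X (F n) Z) \<longlonglongrightarrow> left_eval X G Z"
    and "(\<lambda>n. right_eval (F n) U W) \<longlonglongrightarrow> right_eval G U W"
    and "(\<lambda>n. left_right_eval X (F n) U Z W) \<longlonglongrightarrow> left_right_eval X G U Z W"
proof -
  have main: "(\<lambda>n. mat_residue (\<lambda>z. A z ** F n z ** B z) p) \<longlonglongrightarrow> mat_residue (\<lambda>z. A z ** G z ** B z) p"
    if p: "p \<in> spectrum Z \<union> spectrum W" and A: "mholo A (- (spectrum Z \<union> spectrum W))"
      and B: "mholo B (- (spectrum Z \<union> spectrum W))"
    for p and A :: "complex \<Rightarrow> complex^'p^'a" and B :: "complex \<Rightarrow> complex^'b^'m"
  proof (rule mat_residue_tendsto[where s = "\<Pi>\<^sub>+ - ((spectrum Z \<union> spectrum W) - {p})"])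
    let ?s = "\<Pi>\<^sub>+ - ((spectrum Z \<union> spectrum W) - {p})"
    have sub: "?s - {p} \<subseteq> - (spectrum Z \<union> spectrum W)" "?s \<subseteq> \<Pi>\<^sub>+" by auto
    show "open ?s" using open_RHP by (simp add: finite_imp_closed finite_spectrum open_Diff)
    show "p \<in> ?s" using p Z W by auto
    show "mholo A (?s - {p})" "mholo B (?s - {p})" by (rule mholo_subset[OF A sub(1)] mholo_subset[OF B sub(1)])+
    show "mholo (F n) ?s" for n by (rule mholo_subset[OF F sub(2)])
    show "mholo G ?s" by (rule mholo_subset[OF G sub(2)])
    show "uniform_limit C (\<lambda>n z. F n z $ i $ j) (\<lambda>z. G z $ i $ j) sequentially" if "compact C" "C \<subseteq> ?s" for C i j
      using lim that sub(2) by blast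
  qed
  have rZ: "mholo (res Z) (- (spectrum Z \<union> spectrum W))" and rW: "mholo (res W) (- (spectrum Z \<union> spectrum W))"
    by (rule mholo_subset[OF mholo_res]; blast)+
  \<comment> \<open>The factors \<open>mat 1\<close> bring the one-sided evaluations into the
    two-sided shape treated by \<open>main\<close>.\<close>
  have "(\<lambda>n. \<Sum>p\<in>spectrum Z. mat_residue (\<lambda>z. (res Z z ** X) ** F n z ** mat 1) p)
      \<longlonglongrightarrow> (\<Sum>p\<in>spectrum Z. mat_residue (\<lambda>z. (res Z z ** X) ** G z ** mat 1) p)"
    by (intro tendsto_sum main mholo_mult mholo_const rZ) auto
  then show "(\<lambda>n. left_eval X (F n) Z) \<longlonglongrightarrow> left_eval X G Z" by (simp add: left_eval_def)
  have "(\<lambda>n. \<Sum>p\<in>spectrum W. mat_residue (\<lambda>z. mat 1 ** F n z ** (U ** res W z)) p)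
      \<longlonglongrightarrow> (\<Sum>p\<in>spectrum W. mat_residue (\<lambda>z. mat 1 ** G z ** (U ** res W z)) p)"
    by (intro tendsto_sum main mholo_mult mholo_const rW) auto
  then show "(\<lambda>n. right_eval (F n) U W) \<longlonglongrightarrow> right_eval G U W" by (simp add: right_eval_def matrix_mul_assoc)
  have "(\<lambda>n. \<Sum>p\<in>spectrum Z \<union> spectrum W. mat_residue (\<lambda>z. (res Z z ** X) ** F n z ** (U ** res W z)) p)
      \<longlonglongrightarrow> (\<Sum>p\<in>spectrum Z \<union> spectrum W. mat_residue (\<lambda>z. (res Z z ** X) ** G z ** (U ** res W z)) p)"
    by (intro tendsto_sum main mholo_mult mholo_const rZ rW) auto
  then show "(\<lambda>n. left_right_eval X (F n) U Z W) \<longlonglongrightarrow> left_right_eval X G U Z W"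
    by (simp add: left_right_eval_def matrix_mul_assoc)
qed

text \<open>Successive extraction yields one subsequence for finitely many scalar families, to be
  used for all matrix entries at once.\<close>

lemma Montel_family:
  fixes F :: "'k \<Rightarrow> nat \<Rightarrow> complex \<Rightarrow> complex"
  assumes "finite I" "open s" and F: "\<And>k n. F k n holomorphic_on s" "\<And>k n z. z \<in> s \<Longrightarrow> norm (F k n z) \<le> 1"
  shows "\<exists>r g. strict_mono (r :: nat \<Rightarrow> nat) \<and> (\<forall>k\<in>I. g k holomorphic_on s \<and>
    (\<forall>C. compact C \<longrightarrow> C \<subseteq> s \<longrightarrow> uniform_limit C (\<lambda>n. F k (r n)) (g k) sequentially))"
  using assms(1)
proof (induction I rule: finite_induct)
  case empty
  show ?case by (auto intro: strict_mono_id)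
next
  case (insert k I)
  then obtain r g where r: "strict_mono r" and g: "\<And>l. l \<in> I \<Longrightarrow> g l holomorphic_on s"
    "\<And>l C. l \<in> I \<Longrightarrow> compact C \<Longrightarrow> C \<subseteq> s \<Longrightarrow> uniform_limit C (\<lambda>n. F l (r n)) (g l) sequentially"
    by blast
  let ?H = "{h. h holomorphic_on s \<and> (\<forall>z\<in>s. norm (h z) \<le> 1)}"
  obtain h q where q: "strict_mono (q :: nat \<Rightarrow> nat)" and h: "h holomorphic_on s"
    "\<And>C. compact C \<Longrightarrow> C \<subseteq> s \<Longrightarrow> uniform_limit C ((\<lambda>n. F k (r n)) \<circ> q) h sequentially"
  proof (rule Montel[OF assms(2), of ?H "\<lambda>n. F k (r n)"])
    show "\<exists>B. \<forall>h\<in>?H. \<forall>z\<in>K. norm (h z) \<le> B" if "compact K" "K \<subseteq> s" for K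
      using that by (intro exI[of _ 1]) auto
  qed (use F in auto)
  have "uniform_limit C (\<lambda>n. F l (r (q n))) (g l) sequentially" if "l \<in> I" "compact C" "C \<subseteq> s" for l C
    using filterlim_compose[OF g(2)[OF that] filterlim_subseq[OF q]] .
  moreover have "strict_mono (\<lambda>n. r (q n))" using strict_mono_o[OF r q] by (simp add: o_def)
  ultimately show ?case using insert.hyps g(1) h
    by (intro exI[of _ "\<lambda>n. r (q n)"] exI[of _ "g(k := h)"]) (auto simp: o_def)
qed

lemma schur_subsequence:
  fixes F :: "nat \<Rightarrow> complex \<Rightarrow> complex^'m^'p"
  assumes F: "\<And>n. F n \<in> schur_class"
  obtains r G where "strict_mono (r :: nat \<Rightarrow> nat)" "G \<in> schur_class"
    "\<And>C i j. compact C \<Longrightarrow> C \<subseteq> \<Pi>\<^sub>+ \<Longrightarrow> uniform_limit C (\<lambda>n z. F (r n) z $ i $ j) (\<lambda>z. G z $ i $ j) sequentially"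
proof -
  have "\<exists>r g. strict_mono (r :: nat \<Rightarrow> nat) \<and> (\<forall>k\<in>UNIV. g k holomorphic_on \<Pi>\<^sub>+ \<and>
    (\<forall>C. compact C \<longrightarrow> C \<subseteq> \<Pi>\<^sub>+ \<longrightarrow>
      uniform_limit C (\<lambda>n. (\<lambda>k n z. F n z $ fst k $ snd (k :: 'p \<times> 'm)) k (r n)) (g k) sequentially))"
    using schur_class_mholo[OF F] contraction_entry[OF schur_class_le[OF F]]
    by (intro Montel_family open_RHP) (auto simp: mholo_def)
  then obtain r g where r: "strict_mono (r :: nat \<Rightarrow> nat)" and g: "\<And>k. g k holomorphic_on \<Pi>\<^sub>+"
    "\<And>k C. compact C \<Longrightarrow> C \<subseteq> \<Pi>\<^sub>+ \<Longrightarrow> uniform_limit C (\<lambda>n z. F (r n) z $ fst k $ snd (k :: 'p \<times> 'm)) (g k) sequentially"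
    by (simp del: split_paired_All) blast
  define G :: "complex \<Rightarrow> complex^'m^'p" where "G z = (\<chi> i j. g (i, j) z)" for z
  have lim: "uniform_limit C (\<lambda>n z. F (r n) z $ i $ j) (\<lambda>z. G z $ i $ j) sequentially" if "compact C" "C \<subseteq> \<Pi>\<^sub>+" for C i j
    using g(2)[OF that, of "(i, j)"] by (simp add: G_def)
  have "G \<in> schur_class"
  proof (rule schur_classI)
    show "mholo G \<Pi>\<^sub>+" using g(1) by (simp add: mholo_def G_def)
    fix z v assume z: "z \<in> \<Pi>\<^sub>+"
    have "(\<lambda>n. F (r n) z $ i $ j) \<longlonglongrightarrow> G z $ i $ j" for i j
      using lim[of "{z}" i j] z by simp
    then have "(\<lambda>n. \<Sum>j\<in>UNIV. F (r n) z $ i $ j * v $ j) \<longlonglongrightarrow> (\<Sum>j\<in>UNIV. G z $ i $ j * v $ j)" for i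
      by (intro tendsto_sum tendsto_mult tendsto_const)
    then have "(\<lambda>n. F (r n) z *v v) \<longlonglongrightarrow> G z *v v"
      by (intro vec_tendstoI) (simp add: matrix_vector_mult_def)
    then have "(\<lambda>n. norm (F (r n) z *v v)) \<longlonglongrightarrow> norm (G z *v v)" by (rule tendsto_norm)
    then show "norm (G z *v v) \<le> norm v"
      by (rule LIMSEQ_le_const2) (use schur_class_le[OF F z] in blast)
  qed
  then show ?thesis using r lim that by blast
qed

subsection \<open>Existence in the semidefinite case\<close>

text \<open>Linearity of the Lyapunov equation separates the Gramians of \<open>X\<close> and
  \<open>Y\<close>, making the dependence on \<open>r\<close> explicit.\<close>

lemma pick_left_scaled:
  fixes Y :: "complex^'m^'z"
  assumes Z: "spectrum Z \<subseteq> \<Pi>\<^sub>+"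
  shows "pick_left Z X (mat (of_real r) ** Y) = pick_left Z X (0 :: complex^'m^'z) - mat (of_real (r^2)) ** pick_left Z Y (0 :: complex^'m^'z)"
proof (rule pick_left_eqI[OF Z], rule mat_eqI)
  fix x
  have lyap: "pick_left Z X' (0 :: complex^'m^'z) *v (Z\<^sup>\<dagger> *v x) = X' *v (X'\<^sup>\<dagger> *v x) - Z *v (pick_left Z X' (0 :: complex^'m^'z) *v x)" for X' :: "complex^'k^'z"
    using arg_cong[OF pick_left_eq[OF Z, of X' "0 :: complex^'m^'z"], of "\<lambda>M. M *v x"] by (simp add: mvec algebra_simps)
  show "((pick_left Z X (0 :: complex^'m^'z) - mat (of_real (r^2)) ** pick_left Z Y (0 :: complex^'m^'z)) ** Z\<^sup>\<dagger>
      + Z ** (pick_left Z X (0 :: complex^'m^'z) - mat (of_real (r^2)) ** pick_left Z Y (0 :: complex^'m^'z))) *v x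
    = (X ** X\<^sup>\<dagger> - mat (of_real r) ** Y ** (mat (of_real r) ** Y)\<^sup>\<dagger>) *v x"
    by (simp add: mvec ctr power2_eq_square lyap)
qed

lemma pick_right_scaled:
  fixes V :: "complex^'w^'p" and U :: "complex^'w^'m"
  assumes W: "spectrum W \<subseteq> \<Pi>\<^sub>+"
  shows "pick_right U (mat (of_real r) ** V) W = pick_left (W\<^sup>\<dagger>) (U\<^sup>\<dagger>) (0 :: complex^'p^'w)
    - mat (of_real (r^2)) ** pick_left (W\<^sup>\<dagger>) (V\<^sup>\<dagger>) (0 :: complex^'p^'w)"
proof -
  have "(mat (of_real r) ** V)\<^sup>\<dagger> = mat (of_real r) ** V\<^sup>\<dagger>" by (rule mat_eqI) (simp add: ctr mvec)
  then show ?thesis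
    using pick_left_scaled[OF spectrum_ctranspose_RHP[OF W], of "U\<^sup>\<dagger>" r "V\<^sup>\<dagger>"] by (simp add: pick_right_pick_left)
qed

text \<open>Scaling \<open>S\<close> to \<open>r S\<close> with \<open>r < 1\<close> turns a positive semidefinite Pick matrix into
  \<open>r\<close> times itself plus positive multiples of the Gramians of \<open>X\<close>, \<open>Y\<close>, \<open>U\<close>, \<open>V\<close>.\<close>

lemma (in btoa) scaled_pos_definite:
  assumes psd: "pos_semidefinite P" and ctrl: "controllable Z X" and obs: "observable U W"
    and r: "0 < r" "r < 1"
  shows "btoa_pos Z X (mat (of_real r) ** Y) U (mat (of_real r) ** V) W (mat (of_real r) ** \<Gamma>)"
proof -
  let ?Y = "mat (of_real r) ** Y" and ?V = "mat (of_real r) ** V" and ?\<Gamma> = "mat (of_real r) ** \<Gamma>"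
  have "?\<Gamma> ** W - Z ** ?\<Gamma> = X ** ?V - ?Y ** U"
    by (rule mat_eqI) (simp add: mvec syl_vec)
  then interpret b: btoa Z X ?Y U ?V W ?\<Gamma>
    by unfold_locales (rule sZ sW)+
  let ?gX = "\<lambda>x. inner x (pick_left Z X (0 :: complex^'m^'z) *v x)"
  let ?gY = "\<lambda>x. inner x (pick_left Z Y (0 :: complex^'m^'z) *v x)"
  let ?gU = "\<lambda>y. inner y (pick_left (W\<^sup>\<dagger>) (U\<^sup>\<dagger>) (0 :: complex^'p^'w) *v y)"
  let ?gV = "\<lambda>y. inner y (pick_left (W\<^sup>\<dagger>) (V\<^sup>\<dagger>) (0 :: complex^'p^'w) *v y)"
  note sW' = spectrum_ctranspose_RHP[OF sW]
  have form: "inner x (pick_left Z X (mat (of_real t) ** Y) *v x) + inner y (pick_right U (mat (of_real t) ** V) W *v y)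
       + 2 * inner x ((mat (of_real t) ** \<Gamma>) *v y)
     = ?gX x - t^2 * ?gY x + ?gU y - t^2 * ?gV y + 2 * t * inner x (\<Gamma> *v y)" for t x y
    unfolding pick_left_scaled[OF sZ] pick_right_scaled[OF sW]
    by (simp add: mvec inner_diff_right inner_of_real_smult del: of_real_power)
  have nonneg: "0 \<le> ?gX x" "0 \<le> ?gY x" "0 \<le> ?gU y" "0 \<le> ?gV y" for x y
    by (intro gramian_psd sZ sW')+
  have strict: "0 < ?gX x + ?gU y" if "x \<noteq> 0 \<or> y \<noteq> 0" for x y
  proof (rule ccontr)
    assume "\<not> 0 < ?gX x + ?gU y"
    then have "?gX x = 0" "?gU y = 0" using nonneg(1)[of x] nonneg(3)[of y] by linarith+
    note k = gramian_kernel[OF sZ this(1)] gramian_kernel[OF sW' this(2)]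
    have "x = 0" by (rule controllable_kernel[OF ctrl k(1)])
    moreover have "y \<in> (\<Inter>k. {v. (U ** mat_pow W k) *v v = 0})" using k(2) by (simp add: mvec)
    then have "y = 0" unfolding obs[unfolded observable_def] by simp
    ultimately show False using that by simp
  qed
  have "pos_definite (pick_matrix Z X ?Y U ?V W ?\<Gamma>)"
    unfolding pos_definite_def
  proof (intro conjI allI impI)
    show "(pick_matrix Z X ?Y U ?V W ?\<Gamma>)\<^sup>\<dagger> = pick_matrix Z X ?Y U ?V W ?\<Gamma>" by (rule b.P_hermitian)
    fix v :: "complex^('z + 'w)" assume v: "v \<noteq> 0"
    define x y where "x = incl\<^sup>\<dagger> *v v" and "y = incr\<^sup>\<dagger> *v v"
    have vxy: "v = incl *v x + incr *v y" unfolding x_def y_def by (rule incl_decomp[symmetric])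
    then have "x \<noteq> 0 \<or> y \<noteq> 0" using v by auto
    \<comment> \<open>The scaled form is the sum of three parts: (1 - r) times the Gramians of
      \<open>X\<close> and \<open>U\<close>, r times the original form, and (r - r^2) times the
      Gramians of \<open>Y\<close> and \<open>V\<close>. The first part is positive, the others are
      nonnegative.\<close>
    from strict[OF this] have s: "0 < (1 - r) * (?gX x + ?gU y)" using r by simp
    have "0 \<le> inner x (GL *v x) + inner y (GR *v y) + 2 * inner x (\<Gamma> *v y)"
      using psd unfolding P_psd_iff by blast
    then have "0 \<le> ?gX x - ?gY x + ?gU y - ?gV y + 2 * inner x (\<Gamma> *v y)"
      using form[of x 1 y] by simp
    then have p: "0 \<le> r * (?gX x - ?gY x + ?gU y - ?gV y + 2 * inner x (\<Gamma> *v y))" using r by simp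
    have "0 \<le> (r - r^2) * (?gY x + ?gV y)"
      using r nonneg(2)[of x] nonneg(4)[of y] by (intro mult_nonneg_nonneg) (auto simp: power2_eq_square)
    with s p have "0 < ?gX x - r^2 * ?gY x + ?gU y - r^2 * ?gV y + 2 * r * inner x (\<Gamma> *v y)"
      by (simp add: algebra_simps)
    then show "0 < inner (pick_matrix Z X ?Y U ?V W ?\<Gamma> *v v) v"
      unfolding vxy form[symmetric] inner_commute[of "_ *v _" "incl *v x + incr *v y"] b.P_form .
  qed
  then show ?thesis by unfold_locales
qed

lemma (in btoa_pos) sol_interpolant:
  assumes "G \<in> schur_class"
  shows "BTOA_interpolant Z X Y U V W \<Gamma> (\<lambda>z. sol z (G z))"
  using BTOA_interpolant_iff[OF sZ sW schur_class_mholo[OF sol_schur[OF assms]]] sol_interp[OF assms] by blast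

lemma (in btoa) interpolant_exists:
  assumes psd: "pos_semidefinite P" and ctrl: "controllable Z X" and obs: "observable U W"
  shows "\<exists>S\<in>schur_class. BTOA_interpolant Z X Y U V W \<Gamma> S"
proof -
  \<comment> \<open>The shift by 2 keeps the value at n = 0 strictly positive.\<close>
  define r where "r n = 1 - inverse (real (n + 2))" for n
  have r01: "0 < r n" "r n < 1" for n by (simp_all add: r_def inverse_less_1_iff field_simps)
  have "(\<lambda>n. inverse (real (n + 2))) \<longlonglongrightarrow> 0" by (rule LIMSEQ_ignore_initial_segment[OF lim_inverse_n])
  then have rlim: "r \<longlonglongrightarrow> 1" unfolding r_def using tendsto_diff[OF tendsto_const, of _ 0 sequentially 1] by force
  have "\<exists>S\<in>schur_class. BTOA_interpolant Z X (mat (of_real (r n)) ** Y) U (mat (of_real (r n)) ** V) W (mat (of_real (r n)) ** \<Gamma>) S" for n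
  proof -
    interpret b: btoa_pos Z X "mat (of_real (r n)) ** Y" U "mat (of_real (r n)) ** V" W "mat (of_real (r n)) ** \<Gamma>"
      by (rule scaled_pos_definite[OF psd ctrl obs r01])
    have "(\<lambda>z. 0 :: complex^'m^'p) \<in> schur_class" by (rule schur_classI) (simp_all add: mholo_const)
    then show ?thesis using b.sol_schur b.sol_interpolant by blast
  qed
  then obtain S where S: "\<And>n. S n \<in> schur_class"
    "\<And>n. BTOA_interpolant Z X (mat (of_real (r n)) ** Y) U (mat (of_real (r n)) ** V) W (mat (of_real (r n)) ** \<Gamma>) (S n)"
    by metis
  obtain q G where q: "strict_mono (q :: nat \<Rightarrow> nat)" and G: "G \<in> schur_class"
    and lim: "\<And>C i j. compact C \<Longrightarrow> C \<subseteq> \<Pi>\<^sub>+ \<Longrightarrow> uniform_limit C (\<lambda>n z. S (q n) z $ i $ j) (\<lambda>z. G z $ i $ j) sequentially"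
    by (rule schur_subsequence[of S, OF S(1)]) blast
  have rq: "(\<lambda>n. r (q n)) \<longlonglongrightarrow> 1" using LIMSEQ_subseq_LIMSEQ[OF rlim q] by (simp add: o_def)
  have scale: "(\<lambda>n. mat (of_real (r (q n))) ** M) \<longlonglongrightarrow> M" for M :: "complex^'k^'l"
  proof (intro vec_tendstoI)
    fix i j
    have "(mat (of_real c) ** M) $ i $ j = of_real c * M $ i $ j" for c
      by (simp add: matrix_matrix_mult_def mat_def if_distrib[where f="\<lambda>a. a * _"] cong: if_cong)
    moreover have "(\<lambda>n. of_real (r (q n)) * M $ i $ j) \<longlonglongrightarrow> of_real 1 * M $ i $ j"
      by (intro tendsto_intros rq)
    ultimately show "(\<lambda>n. (mat (of_real (r (q n))) ** M) $ i $ j) \<longlonglongrightarrow> M $ i $ j" by simp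
  qed
  note e = eval_tendsto[OF sZ sW schur_class_mholo[OF S(1)] schur_class_mholo[OF G] lim, simplified]
  have "left_eval X G Z = Y"
    using LIMSEQ_unique[OF e(1)[of X]] scale[of Y] S(2) by (simp add: BTOA_interpolant_def)
  moreover have "right_eval G U W = V"
    using LIMSEQ_unique[OF e(2)[of U]] scale[of V] S(2) by (simp add: BTOA_interpolant_def)
  moreover have "left_right_eval X G U Z W = \<Gamma>"
    using LIMSEQ_unique[OF e(3)[of X U]] scale[of \<Gamma>] S(2) by (simp add: BTOA_interpolant_def)
  ultimately have "left_eval X G Z = Y \<and> right_eval G U W = V \<and> left_right_eval X G U Z W = \<Gamma>" by simp
  then show ?thesis using G by (auto simp: BTOA_interpolant_def)
qed

theorem theorem1p2:
  fixes Z :: "complex ^ 'z ^ 'z" and X :: "complex ^ 'p ^ 'z" and Y :: "complex ^ 'm ^ 'z"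
    and U :: "complex ^ 'w ^ 'm" and V :: "complex ^ 'w ^ 'p" and W :: "complex ^ 'w ^ 'w"
    and \<Gamma> :: "complex ^ 'w ^ 'z"
  assumes "BTOA_admissible Z X Y U V W \<Gamma>"
  shows "((\<exists>S \<in> schur_class. BTOA_interpolant Z X Y U V W \<Gamma> S) \<longleftrightarrow>
            pos_semidefinite (pick_matrix Z X Y U V W \<Gamma>)) \<and>
         (pos_definite (pick_matrix Z X Y U V W \<Gamma>) \<longrightarrow>
            (\<forall>G \<in> (schur_class :: (complex \<Rightarrow> complex ^ 'm ^ 'p) set). \<forall>\<^sub>\<approx>z\<in>\<Pi>\<^sub>+.
               invertible (lft_denominator (BTOA_Theta Z X Y U V W \<Gamma> z) (G z))) \<and>
            (\<forall>S. (S \<in> schur_class \<and> BTOA_interpolant Z X Y U V W \<Gamma> S) \<longleftrightarrow>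
               (\<exists>G \<in> schur_class. \<forall>z\<in>\<Pi>\<^sub>+.
                  S z = mat_remove_sings (\<lambda>s. lft (BTOA_Theta Z X Y U V W \<Gamma> s) (G s)) z)))"
proof -
  interpret btoa Z X Y U V W \<Gamma>
    using assms by unfold_locales (auto simp: BTOA_admissible_def)
  have ctrl: "controllable Z X" and obs: "observable U W" using assms by (auto simp: BTOA_admissible_def)
  have "(\<exists>S \<in> schur_class. BTOA_interpolant Z X Y U V W \<Gamma> S) \<longleftrightarrow> pos_semidefinite P"
  proof
    assume "\<exists>S \<in> schur_class. BTOA_interpolant Z X Y U V W \<Gamma> S"
    then obtain S H L K where "S \<in> schur_class" "interp_functions Z X Y U V W \<Gamma> S H L K"
      using BTOA_interpolant_iff[OF sZ sW schur_class_mholo] by blast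
    then show "pos_semidefinite P"
      unfolding P_psd_iff using half_plane_necessity[OF sZ sW _ _ syl] by blast
  qed (rule interpolant_exists[OF _ ctrl obs])
  moreover have "(\<forall>G \<in> (schur_class :: (complex \<Rightarrow> complex ^ 'm ^ 'p) set). \<forall>\<^sub>\<approx>z\<in>\<Pi>\<^sub>+.
               invertible (lft_denominator (BTOA_Theta Z X Y U V W \<Gamma> z) (G z))) \<and>
            (\<forall>S. (S \<in> schur_class \<and> BTOA_interpolant Z X Y U V W \<Gamma> S) \<longleftrightarrow>
               (\<exists>G \<in> schur_class. \<forall>z\<in>\<Pi>\<^sub>+.
                  S z = mat_remove_sings (\<lambda>s. lft (BTOA_Theta Z X Y U V W \<Gamma> s) (G s)) z))"
    if pd: "pos_definite P"
  proof -
    interpret btoa_pos Z X Y U V W \<Gamma> by unfold_locales (rule pd)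
    have inv: "\<forall>\<^sub>\<approx>z\<in>\<Pi>\<^sub>+. invertible (lft_denominator (\<Theta> z) (G z))"
      if "G \<in> schur_class" for G :: "complex \<Rightarrow> complex ^ 'm ^ 'p"
      unfolding eventually_cosparse_open_eq[OF open_RHP]
    proof
      fix z assume "z \<in> \<Pi>\<^sub>+"
      from eventually_at_RHP[OF finite_spectrum[of W] this] show "\<forall>\<^sub>F z in at z. invertible (lft_denominator (\<Theta> z) (G z))"
        by (rule eventually_mono) (use invertible_lft_denominator[OF that] in auto)
    qed
    \<comment> \<open>\<open>lft\<close> agrees with the holomorphic \<open>sol\<close> off a finite
      set, so its limit exists at every point of the half-plane and is the value of
      \<open>sol\<close>.\<close>
    have rem: "mat_remove_sings (\<lambda>s. lft (\<Theta> s) (G s)) z = sol z (G z)"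
      if G: "G \<in> schur_class" and z: "z \<in> \<Pi>\<^sub>+" for G z
    proof -
      have "((\<lambda>s. lft (\<Theta> s) (G s) $ i $ j) \<longlongrightarrow> sol z (G z) $ i $ j) (at z)" for i j
      proof (rule Lim_transform_eventually[OF mholo_tendsto[OF schur_class_mholo[OF sol_schur[OF G]] z]])
        from eventually_at_RHP[OF finite_spectrum[of W] z]
        show "\<forall>\<^sub>F s in at z. sol s (G s) $ i $ j = lft (\<Theta> s) (G s) $ i $ j"
          by (rule eventually_mono) (use lft_eq_sol[OF G] in auto)
      qed
      then show ?thesis by (simp add: mat_remove_sings_def vec_eq_iff remove_sings_eqI)
    qed
    have param: "(S \<in> schur_class \<and> BTOA_interpolant Z X Y U V W \<Gamma> S) \<longleftrightarrow>
               (\<exists>G \<in> schur_class. \<forall>z\<in>\<Pi>\<^sub>+. S z = mat_remove_sings (\<lambda>s. lft (\<Theta> s) (G s)) z)" for S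
    proof
      assume S: "S \<in> schur_class \<and> BTOA_interpolant Z X Y U V W \<Gamma> S"
      then obtain H L K where "interp_functions Z X Y U V W \<Gamma> S H L K"
        using BTOA_interpolant_iff[OF sZ sW schur_class_mholo] by blast
      then show "\<exists>G \<in> schur_class. \<forall>z\<in>\<Pi>\<^sub>+. S z = mat_remove_sings (\<lambda>s. lft (\<Theta> s) (G s)) z"
        using interp_is_sol[of S] S rem by force
    next
      assume "\<exists>G \<in> schur_class. \<forall>z\<in>\<Pi>\<^sub>+. S z = mat_remove_sings (\<lambda>s. lft (\<Theta> s) (G s)) z"
      then obtain G where G: "G \<in> schur_class" and eq: "\<And>z. z \<in> \<Pi>\<^sub>+ \<Longrightarrow> S z = sol z (G z)"
        using rem by force
      note s = sol_schur[OF G]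
      \<comment> \<open>\<open>S\<close> is prescribed only on the half-plane, so membership in the
        Schur class is transferred by pointwise agreement there.\<close>
      have "mholo S \<Pi>\<^sub>+" using mholo_cong[of "\<Pi>\<^sub>+" S "\<lambda>z. sol z (G z)"] eq schur_class_mholo[OF s] by simp
      then have S: "S \<in> schur_class" by (rule schur_classI) (use eq schur_class_le[OF s] in simp)
      obtain H L K where "interp_functions Z X Y U V W \<Gamma> (\<lambda>z. sol z (G z)) H L K"
        using sol_interp[OF G] by blast
      then have "interp_functions Z X Y U V W \<Gamma> S H L K" using eq by (simp add: interp_functions_def)
      then show "S \<in> schur_class \<and> BTOA_interpolant Z X Y U V W \<Gamma> S"
        using S BTOA_interpolant_iff[OF sZ sW schur_class_mholo[OF S]] by blast
    qed
    show ?thesis using inv param by blast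
  qed
  ultimately show ?thesis by blast
qed

end
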